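(* Suppose that $e_1^{\min}|_{e_0^{\min}}\neq 0$ and let $$\delta=(a_{0n}-a_{0R}^-)(a_{1L}^--a_{10})-(a_{0L}^--a_{00})(a_{1m}-a_{1R}^-).$$ Then, under Selection2: (1) $a_{00},a_{10}$ are both selected, or $a_{0n},a_{1m}$ are both selected, which also implies that $e_0^{\min}|_{e_1^{\min}}\neq 0$; (2) the lower left corner of $N(\phi)$ consists of a single edge connecting the points $(0,e_1^{\min}|_{e_0^{\min}})$ and $(e_0^{\min}|_{e_1^{\min}},0)$, unless all four points $a_{00},a_{10},a_{0n},a_{1m}$ are selected and $\delta\neq0$, in which case the corner consists of two edges connecting $(0,e_1^{\min}|_{e_0^{\min}})$ to a point $p$, and $p$ to $(e_0^{\min}|_{e_1^{\min}},0)$, where $$p=(a_{1L}^--a_{10},\,a_{0n}-a_{0R}^-)\ \text{ if }\delta<0,\qquad p=(a_{1m}-a_{1R}^-,\,a_{0L}^--a_{00})\ \text{ if }\delta>0.$$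
   Context: Consider $x=P_0(t)/Q_0(t)$, $y=P_1(t)/Q_1(t)$ with $P_i,Q_i\in\mathbb{C}[t]$, $\gcd(P_i,Q_i)=1$, where all polynomials have fixed supports and (independent) generic coefficients (the result holds for all coefficient vectors in some open dense subset), and the parameterization has degree $1$. Let $\phi\in\mathbb{C}[x,y]$ be the implicit equation (generator of the ideal of polynomials vanishing on the parameterization) and $N(\phi)$ its Newton polygon (convex hull of the exponent vectors occurring in $\phi$). Let $f_0=xQ_0(t)-P_0(t)$, $f_1=yQ_1(t)-P_1(t)$, with supports in $t$: $A_0=\{a_{00}<a_{01}<\dots<a_{0n}\}$, $A_1=\{a_{10}<a_{11}<\dots<a_{1m}\}$, $A_i=\mathrm{supp}(P_i)\cup\mathrm{supp}(Q_i)$; by coprimality $a_{00}=a_{10}=0$. Selection2: a point of $A_i$ is selected iff it belongs to $\mathrm{supp}(Q_i)\setminus\mathrm{supp}(P_i)$ (i.e. its coefficient in $f_i$ is a monomial in $x$, resp. $y$). The other points of $A_i$ are non-selected (they form $\mathrm{supp}(P_i)$). It is assumed that there is at least one selected (and, automatically, at least one non-selected) point in each of $A_0$ and $A_1$ under Selection2. Let $a_{iL}^-,a_{iR}^-$ denote the leftmost and rightmost non-selected points of $A_i$ (not necessarily distinct), under Selection2. Let $C=\{(a,0):a\in A_0\}\cup\{(a,1):a\in A_1\}\subset\mathbb{R}^2$. A triangulation of $C$ is a subdivision of its convex hull into triangles with vertices in $C$; each triangle has two vertices on one of the two rows (its base) and one on the other row (its apex), and its normalized volume is the length of its base. For a triangulation,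 let $e_0$ be the sum of the normalized volumes of the triangles whose apex is a selected point of $A_0$ (base in $A_1$), and $e_1$ the sum of the normalized volumes of the triangles whose apex is a selected point of $A_1$ (base in $A_0$). Write $e_i^{\min}$ for the minimum of $e_i$ over all triangulations, $e_1^{\min}|_{e_0^{\min}}$ for the minimum of $e_1$ among the triangulations with $e_0=e_0^{\min}$, and $e_0^{\min}|_{e_1^{\min}}$ for the minimum of $e_0$ among the triangulations with $e_1=e_1^{\min}$, all under Selection2. The lower left corner of $N(\phi)$ is the part of its boundary between the points $(0,e_1^{\min}|_{e_0^{\min}})$ and $(e_0^{\min}|_{e_1^{\min}},0)$. *)

theory Defs
  imports "HOL-Analysis.Analysis" "HOL-Computational_Algebra.Polynomial"
begin

section \<open>Supports, coefficient vectors and genericity\<close>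

text \<open>
  The curve is \<open>x = P\<^sub>0(t)/Q\<^sub>0(t)\<close>, \<open>y = P\<^sub>1(t)/Q\<^sub>1(t)\<close>.  A slot names one of the four
  polynomials, in the order \<open>P\<^sub>0, Q\<^sub>0, P\<^sub>1, Q\<^sub>1\<close>; a family of supports is a function from
  slots to exponent sets, and \<open>c (s, k)\<close> is the coefficient of \<open>t\<^sup>k\<close> in the polynomial in
  slot \<open>s\<close>.
\<close>

datatype slot = NumX | DenX | NumY | DenY

type_synonym supports = "slot \<Rightarrow> nat set"
type_synonym coeffs = "slot \<times> nat \<Rightarrow> complex"

definition coef_space :: "supports \<Rightarrow> coeffs set" where
  "coef_space S = {c. {i. c i \<noteq> 0} = Sigma UNIV S}"

definition slot_poly :: "supports \<Rightarrow> coeffs \<Rightarrow> slot \<Rightarrow> complex poly" where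
  "slot_poly S c s = (\<Sum>k\<in>S s. monom (c (s, k)) k)"

inductive_set polynomial_functions :: "(('i \<Rightarrow> complex) \<Rightarrow> complex) set" where
  const: "(\<lambda>_. a) \<in> polynomial_functions"
| coord: "(\<lambda>c. c i) \<in> polynomial_functions"
| add: "\<lbrakk>f \<in> polynomial_functions; g \<in> polynomial_functions\<rbrakk>
        \<Longrightarrow> (\<lambda>c. f c + g c) \<in> polynomial_functions"
| mult: "\<lbrakk>f \<in> polynomial_functions; g \<in> polynomial_functions\<rbrakk>
        \<Longrightarrow> (\<lambda>c. f c * g c) \<in> polynomial_functions"

definition zariski_open :: "('i \<Rightarrow> complex) set \<Rightarrow> bool" where
  "zariski_open U \<longleftrightarrow> (\<exists>G \<subseteq> polynomial_functions. U = {c. \<exists>g\<in>G. g c \<noteq> 0})"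

definition zariski_topology :: "('i \<Rightarrow> complex) topology" where
  "zariski_topology = topology zariski_open"

lemma istopology_zariski_open: "istopology zariski_open"
  unfolding istopology_def
proof (intro conjI allI impI)
  fix U V :: "('i \<Rightarrow> complex) set"
  assume "zariski_open U" "zariski_open V"
  then obtain G H where
      G: "G \<subseteq> polynomial_functions" "U = {c. \<exists>g\<in>G. g c \<noteq> 0}" and
      H: "H \<subseteq> polynomial_functions" "V = {c. \<exists>h\<in>H. h c \<noteq> 0}"
    unfolding zariski_open_def by blast
  let ?K = "(\<lambda>(g, h) c. g c * h c) ` (G \<times> H)"
  have "?K \<subseteq> polynomial_functions"
    using G(1) H(1) by (auto intro!: polynomial_functions.mult)
  moreover have "U \<inter> V = {c. \<exists>k\<in>?K. k c \<noteq> 0}"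
    unfolding G(2) H(2) by auto
  ultimately show "zariski_open (U \<inter> V)"
    unfolding zariski_open_def by blast
next
  fix \<U> :: "('i \<Rightarrow> complex) set set"
  assume "\<forall>U\<in>\<U>. zariski_open U"
  then have "\<forall>U\<in>\<U>. \<exists>G. G \<subseteq> polynomial_functions \<and> U = {c. \<exists>g\<in>G. g c \<noteq> 0}"
    unfolding zariski_open_def by simp
  from bchoice[OF this] obtain G
    where G: "\<forall>U\<in>\<U>. G U \<subseteq> polynomial_functions \<and> U = {c. \<exists>g\<in>G U. g c \<noteq> 0}" ..
  have "(\<Union>U\<in>\<U>. G U) \<subseteq> polynomial_functions"
    using G by blast
  moreover have "\<Union>\<U> = {c. \<exists>g\<in>(\<Union>U\<in>\<U>. G U). g c \<noteq> 0}"
    using G by blast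
  ultimately show "zariski_open (\<Union>\<U>)"
    unfolding zariski_open_def by blast
qed

lemma openin_zariski_topology: "openin zariski_topology U \<longleftrightarrow> zariski_open U"
  unfolding zariski_topology_def by (simp add: istopology_zariski_open)

text \<open>
  The coefficient vectors with exactly the prescribed supports form an algebraic torus.
  Genericity is taken in the Zariski sense; a dense Zariski-open subset of the torus is also
  open and dense for the Euclidean topology.
\<close>

definition generically :: "supports \<Rightarrow> (coeffs \<Rightarrow> bool) \<Rightarrow> bool" where
  "generically S \<Phi> \<longleftrightarrow>
     (\<exists>U. openin (subtopology zariski_topology (coef_space S)) U \<and>
          subtopology zariski_topology (coef_space S) closure_of U = coef_space S \<and>
          (\<forall>c\<in>U. \<Phi> c))"


section \<open>Parameterized curves, implicit equations and Newton polygons\<close>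

definition param_dom :: "complex poly \<Rightarrow> complex poly \<Rightarrow> complex set" where
  "param_dom Q0 Q1 = {t. poly Q0 t \<noteq> 0 \<and> poly Q1 t \<noteq> 0}"

text \<open>The degree is the number of parameter values over a generic point of the curve.\<close>

definition has_param_degree ::
  "complex poly \<Rightarrow> complex poly \<Rightarrow> complex poly \<Rightarrow> complex poly \<Rightarrow> nat \<Rightarrow> bool" where
  "has_param_degree P0 Q0 P1 Q1 d \<longleftrightarrow>
     finite {t \<in> param_dom Q0 Q1.
       card {u \<in> param_dom Q0 Q1. poly P0 u / poly Q0 u = poly P0 t / poly Q0 t \<and>
                                 poly P1 u / poly Q1 u = poly P1 t / poly Q1 t} \<noteq> d}"

text \<open>
  An element of \<open>\<complex>[x,y]\<close> is a polynomial in \<open>y\<close> whose coefficients are polynomials in \<open>x\<close>: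
  the coefficient of \<open>x\<^sup>i y\<^sup>j\<close> in \<open>F\<close> is \<open>coeff (coeff F j) i\<close>.
\<close>

definition eval_xy :: "complex poly poly \<Rightarrow> complex \<Rightarrow> complex \<Rightarrow> complex" where
  "eval_xy F x y = poly (poly F [:y:]) x"

definition vanishing_ideal ::
  "complex poly \<Rightarrow> complex poly \<Rightarrow> complex poly \<Rightarrow> complex poly \<Rightarrow> complex poly poly set" where
  "vanishing_ideal P0 Q0 P1 Q1 =
     {F. \<forall>t\<in>param_dom Q0 Q1. eval_xy F (poly P0 t / poly Q0 t) (poly P1 t / poly Q1 t) = 0}"

definition implicit_equation ::
  "complex poly \<Rightarrow> complex poly \<Rightarrow> complex poly \<Rightarrow> complex poly \<Rightarrow> complex poly poly \<Rightarrow> bool" where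
  "implicit_equation P0 Q0 P1 Q1 \<phi> \<longleftrightarrow> vanishing_ideal P0 Q0 P1 Q1 = {F. \<phi> dvd F}"

definition newton_polygon :: "complex poly poly \<Rightarrow> (real \<times> real) set" where
  "newton_polygon F = convex hull {(real i, real j) | i j. coeff (coeff F j) i \<noteq> 0}"

text \<open>
  For a point \<open>a\<close> on the vertical and a point \<open>b\<close> on the horizontal axis, the two points cut
  the boundary of \<open>N\<close> into two arcs; this is the one facing the origin.  It lies in the
  triangle \<open>0ab\<close>.  The last condition only matters when the chord \<open>ab\<close> is itself the other
  arc: it then removes the inner points of that chord.
\<close>

definition lower_left_corner ::
  "(real \<times> real) set \<Rightarrow> real \<times> real \<Rightarrow> real \<times> real \<Rightarrow> (real \<times> real) set" where
  "lower_left_corner N a b =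
     {z \<in> frontier N \<inter> convex hull {0, a, b}. \<not> (\<exists>w\<in>N. fst w < fst z \<and> snd w < snd z)}"


section \<open>Selected points and triangulations\<close>

definition A0 :: "supports \<Rightarrow> nat set" where "A0 S = S NumX \<union> S DenX"
definition A1 :: "supports \<Rightarrow> nat set" where "A1 S = S NumY \<union> S DenY"

text \<open>The selection rule used throughout; the non-selected points are \<open>S NumX\<close> and \<open>S NumY\<close>.\<close>

definition selected0 :: "supports \<Rightarrow> nat set" where "selected0 S = S DenX - S NumX"
definition selected1 :: "supports \<Rightarrow> nat set" where "selected1 S = S DenY - S NumY"

definition cayley_points :: "supports \<Rightarrow> (real \<times> real) set" where
  "cayley_points S = (\<lambda>a. (real a, 0)) ` A0 S \<union> (\<lambda>a. (real a, 1)) ` A1 S"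

text \<open>Triangulations need not use all the points.\<close>

definition triangulations :: "supports \<Rightarrow> (real \<times> real) set set set" where
  "triangulations S =
     {\<T>. triangulation \<T> \<and> \<Union>\<T> = convex hull (cayley_points S) \<and>
          (\<forall>T\<in>\<T>. 2 simplex T \<and> {v. v extreme_point_of T} \<subseteq> cayley_points S)}"

text \<open>The triples below are the apex and the two end points of the base.\<close>

definition e0 :: "supports \<Rightarrow> (real \<times> real) set set \<Rightarrow> nat" where
  "e0 S \<T> = (\<Sum>(a, b, b') \<in> {(a, b, b'). a \<in> selected0 S \<and> b \<in> A1 S \<and> b' \<in> A1 S \<and> b < b' \<and>
                convex hull {(real a, 0), (real b, 1), (real b', 1)} \<in> \<T>}. b' - b)"

definition e1 :: "supports \<Rightarrow> (real \<times> real) set set \<Rightarrow> nat" where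
  "e1 S \<T> = (\<Sum>(a, b, b') \<in> {(a, b, b'). a \<in> selected1 S \<and> b \<in> A0 S \<and> b' \<in> A0 S \<and> b < b' \<and>
                convex hull {(real a, 1), (real b, 0), (real b', 0)} \<in> \<T>}. b' - b)"

definition e0_min :: "supports \<Rightarrow> nat" where
  "e0_min S = (INF \<T> \<in> triangulations S. e0 S \<T>)"

definition e1_min :: "supports \<Rightarrow> nat" where
  "e1_min S = (INF \<T> \<in> triangulations S. e1 S \<T>)"

definition e1_min_at_e0_min :: "supports \<Rightarrow> nat" where
  "e1_min_at_e0_min S = (INF \<T> \<in> {\<T> \<in> triangulations S. e0 S \<T> = e0_min S}. e1 S \<T>)"

definition e0_min_at_e1_min :: "supports \<Rightarrow> nat" where
  "e0_min_at_e1_min S = (INF \<T> \<in> {\<T> \<in> triangulations S. e1 S \<T> = e1_min S}. e0 S \<T>)"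

definition delta :: "supports \<Rightarrow> int" where
  "delta S =
     (int (Max (A0 S)) - int (Max (S NumX))) * (int (Min (S NumY)) - int (Min (A1 S))) -
     (int (Min (S NumX)) - int (Min (A0 S))) * (int (Max (A1 S)) - int (Max (S NumY)))"

definition corner_vertex :: "supports \<Rightarrow> real \<times> real" where
  "corner_vertex S =
     (if delta S < 0
      then (real (Min (S NumY)) - real (Min (A1 S)), real (Max (A0 S)) - real (Max (S NumX)))
      else (real (Max (A1 S)) - real (Max (S NumY)), real (Min (S NumX)) - real (Min (A0 S))))"

end

theory Submission
  imports Defs "Jordan_Normal_Form.Char_Poly" "HOL-Computational_Algebra.Field_as_Ring"
begin

text \<open>
  The lower left corner of the Newton polygon of \<open>\<phi>\<close> records the branches of the curve through
  the origin.  For generic coefficients the numerators have no common zero apart from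
  \<open>t = 0\<close>, so \<open>x\<close> and \<open>y\<close> can vanish together only at \<open>t = 0\<close> and \<open>t = \<infinity>\<close>.  Let \<open>u\<^sub>0, v\<^sub>0\<close> be the
  distances from the smallest exponents of the two rows to their smallest non-selected exponents,
  and \<open>u\<^sub>1, v\<^sub>1\<close> the corresponding distances at the largest exponents.  Then \<open>x\<close> and \<open>y\<close> vanish
  at \<open>t = 0\<close> to the orders \<open>u\<^sub>0, v\<^sub>0\<close> and at \<open>t = \<infinity>\<close> to the orders \<open>u\<^sub>1, v\<^sub>1\<close>, where \<open>0\<close> stands
  for a value or a pole; an order is positive exactly if the extreme exponent is selected.  A parameter value at which both orders \<open>u, v\<close> are
  positive contributes a boundary vector \<open>(v, -u)\<close>, and these vectors, sorted by slope, form the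
  corner: one edge if there is one such value or if the two vectors are parallel, otherwise
  two edges, whose order is decided by the sign of \<open>\<delta> = u\<^sub>1 v\<^sub>0 - u\<^sub>0 v\<^sub>1\<close>.

  Branches do not occur in the proof.  It works with the resultant \<open>R\<close> of \<open>x Q\<^sub>0(t) - P\<^sub>0(t)\<close> and
  \<open>y Q\<^sub>1(t) - P\<^sub>1(t)\<close> with respect to \<open>t\<close>, written as a Sylvester determinant of formal degrees
  \<open>n = max A\<^sub>0\<close> and \<open>m = max A\<^sub>1\<close>.

  The resultant vanishes on the curve, so \<open>\<phi>\<close> divides it.  Since the parameterization has degree one,
  a general vertical line meets the curve in \<open>n\<close> and a general horizontal line in \<open>m\<close> points.  As
  \<open>n\<close> and \<open>m\<close> are upper bounds for the degrees of \<open>R\<close> in \<open>y\<close> and \<open>x\<close>, \<open>R\<close> is a constant multiple of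
  \<open>\<phi>\<close> (\<open>implicit_equation_support\<close>).

  That \<open>N(R)\<close> lies above the expected corner follows from the Leibniz formula alone: weights on the
  rows and columns of the Sylvester matrix bound the weight of every term from below
  (\<open>curve_resultant_weight\<close>).  That the expected vertices are attained also follows from this
  formula.  A monotone lattice path from \<open>(0, 0)\<close> to \<open>(n, m)\<close> selects one permutation,
  and a convex lifting of the coefficients makes its term the unique dominant one, so that the
  monomial it carries survives for generic coefficients (\<open>curve_resultant_vertex\<close>,
  \<open>generically_monomials\<close>).

  The two minima of the statement are computed directly (\<open>corner_ends\<close>).  A triangulation can make all
  triangles over one row have a non-selected apex.  Then triangles whose bases cover an end segment
  of the other row before its first non-selected point are forced to have the extreme point as apex,
  because any other apex would produce two crossing edges; a zigzag through the
  extreme non-selected points shows that nothing more is needed.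
\<close>

section \<open>Convex geometry of a corner with one or two edges\<close>

lemma convex_half_planes:
  fixes \<alpha> \<beta> c :: real
  shows "convex {z. \<alpha> * fst z + \<beta> * snd z = c}" "convex {z. c \<le> \<alpha> * fst z + \<beta> * snd z}"
    "convex {z. \<alpha> * fst z + \<beta> * snd z \<le> c}"
  using convex_hyperplane[of "(\<alpha>, \<beta>)" c] convex_halfspace_ge[of c "(\<alpha>, \<beta>)"]
    convex_halfspace_le[of "(\<alpha>, \<beta>)" c] by (simp_all add: inner_prod_def)

text \<open>A segment in a supporting line that contains every point of the set on this line is an exposed
  face of dimension one.\<close>

lemma segment_edge_of:
  fixes S :: "(real \<times> real) set"
  assumes S: "convex S" and sup: "\<And>x y. (x, y) \<in> S \<Longrightarrow> c \<le> \<alpha> * x + \<beta> * y"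
    and p: "p \<in> S" "\<alpha> * fst p + \<beta> * snd p = c" and q: "q \<in> S" "\<alpha> * fst q + \<beta> * snd q = c"
    and "p \<noteq> q"
    and tight: "\<And>x y. (x, y) \<in> S \<Longrightarrow> \<alpha> * x + \<beta> * y = c \<Longrightarrow> (x, y) \<in> closed_segment p q"
  shows "closed_segment p q edge_of S"
proof -
  have "S \<inter> {z. (\<alpha>, \<beta>) \<bullet> z = c} face_of S"
    using S by (rule face_of_Int_supporting_hyperplane_ge) (use sup in \<open>auto simp: inner_prod_def\<close>)
  moreover have "S \<inter> {z. (\<alpha>, \<beta>) \<bullet> z = c} = closed_segment p q"
  proof (intro equalityI subsetI)
    fix z assume z: "z \<in> closed_segment p q"
    have "z \<in> S" using z S p(1) q(1) by (meson closed_segment_subset subsetD)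
    moreover have "closed_segment p q \<subseteq> {z. (\<alpha>, \<beta>) \<bullet> z = c}"
      by (rule closed_segment_subset) (use p q in \<open>auto simp: inner_prod_def convex_half_planes\<close>)
    ultimately show "z \<in> S \<inter> {z. (\<alpha>, \<beta>) \<bullet> z = c}" using z by blast
  next
    fix z assume "z \<in> S \<inter> {z. (\<alpha>, \<beta>) \<bullet> z = c}"
    then show "z \<in> closed_segment p q" using tight by (cases z) (auto simp: inner_prod_def)
  qed
  moreover have "aff_dim (closed_segment p q) = 1"
    using \<open>p \<noteq> q\<close> by (simp add: segment_convex_hull aff_dim_convex_hull aff_dim_2)
  ultimately show ?thesis by (simp add: edge_of_def)
qed

lemma mem_closed_segment_line:
  fixes x y :: real
  assumes "p1 < q1" "p1 \<le> x" "x \<le> q1" and "0 < \<beta>"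
    and "\<alpha> * x + \<beta> * y = c" "\<alpha> * p1 + \<beta> * p2 = c" "\<alpha> * q1 + \<beta> * q2 = c"
  shows "(x, y) \<in> closed_segment (p1, p2) (q1, q2)"
proof -
  define s where "s = (x - p1) / (q1 - p1)"
  have "s * (q1 - p1) = x - p1" using assms(1) by (simp add: s_def)
  then have "x = (1 - s) * p1 + s * q1" by (simp add: algebra_simps)
  moreover have "0 \<le> s" "s \<le> 1" using assms(1-3) by (simp_all add: s_def)
  ultimately have s: "0 \<le> s" "s \<le> 1" "x = (1 - s) * p1 + s * q1" by auto
  have "\<beta> * y = (1 - s) * (c - \<alpha> * p1) + s * (c - \<alpha> * q1)"
    using assms(5) unfolding s(3) by (simp add: algebra_simps)
  also have "c - \<alpha> * p1 = \<beta> * p2" using assms(6) by simp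
  also have "c - \<alpha> * q1 = \<beta> * q2" using assms(7) by simp
  finally have "\<beta> * y = \<beta> * ((1 - s) * p2 + s * q2)" by (simp add: algebra_simps)
  then have "y = (1 - s) * p2 + s * q2" using assms(4) by simp
  then show ?thesis using s by (auto simp: closed_segment_def)
qed

text \<open>Describes the triangle in the definition of \<open>lower_left_corner\<close> by inequalities.\<close>

lemma mem_triangle_origin:
  fixes h w x y :: real
  assumes "0 < h" "0 < w"
  shows "(x, y) \<in> convex hull {0, (0, h), (w, 0)} \<longleftrightarrow> 0 \<le> x \<and> 0 \<le> y \<and> h * x + w * y \<le> w * h"
proof
  assume "(x, y) \<in> convex hull {0, (0, h), (w, 0)}"
  then obtain a b c where abc: "0 \<le> a" "0 \<le> b" "0 \<le> c" "a + b + c = 1"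
    and "x = c * w" "y = b * h" by (auto simp: convex_hull_3 zero_prod_def)
  moreover have "h * x + w * y = (b + c) * (w * h)" using calculation by (simp add: algebra_simps)
  moreover have "(b + c) * (w * h) \<le> 1 * (w * h)" using abc assms by (intro mult_right_mono) auto
  ultimately show "0 \<le> x \<and> 0 \<le> y \<and> h * x + w * y \<le> w * h" using assms by auto
next
  assume z: "0 \<le> x \<and> 0 \<le> y \<and> h * x + w * y \<le> w * h"
  have "0 \<le> 1 - y / h - x / w" using z assms by (simp add: field_simps)
  then show "(x, y) \<in> convex hull {0, (0, h), (w, 0)}"
    unfolding convex_hull_3 mem_Collect_eq using z assms
    by (intro exI[of _ "1 - y / h - x / w"] exI[of _ "y / h"] exI[of _ "x / w"]) (auto simp: zero_prod_def)
qed

text \<open>A point on a supporting line whose normal is positive has no point of the set strictly below and to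
  the left of it.\<close>

lemma supported_point_in_corner:
  assumes z: "z \<in> N" "z \<in> convex hull {0, a, b}"
    and sup: "\<And>x y. (x, y) \<in> N \<Longrightarrow> c \<le> \<alpha> * x + \<beta> * y" "\<alpha> * fst z + \<beta> * snd z = c"
    and pos: "0 < \<alpha>" "0 < \<beta>"
  shows "z \<in> lower_left_corner N a b"
proof -
  have low: "\<not> (\<exists>w\<in>N. fst w < fst z \<and> snd w < snd z)"
  proof
    assume "\<exists>w\<in>N. fst w < fst z \<and> snd w < snd z"
    then obtain w where w: "w \<in> N" "fst w < fst z" "snd w < snd z" by blast
    then have "\<alpha> * fst w < \<alpha> * fst z" "\<beta> * snd w < \<beta> * snd z" using pos by auto
    then show False using sup(1)[of "fst w" "snd w"] w(1) sup(2) by simp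
  qed
  have "z \<notin> interior N"
  proof
    assume "z \<in> interior N"
    then obtain e where e: "0 < e" "ball z e \<subseteq> N" by (meson mem_interior)
    have "dist z (fst z - e / 2, snd z) = e / 2" using e by (simp add: dist_prod_def dist_real_def)
    then have "(fst z - e / 2, snd z) \<in> N" using e by auto
    then have "c \<le> \<alpha> * (fst z - e / 2) + \<beta> * snd z" by (rule sup(1))
    moreover have "\<alpha> * (e / 2) > 0" using e pos by simp
    ultimately show False using sup(2) by (simp add: algebra_simps)
  qed
  then have "z \<in> frontier N" using z(1) closure_subset by (auto simp: frontier_def)
  then show ?thesis using z(2) low by (simp add: lower_left_corner_def)
qed

text \<open>The chord itself is the supporting line: the part of the hull inside the triangle with the origin
  lies on both sides of it, hence on it.\<close>

theorem one_edge_corner: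
  fixes P :: "(real \<times> real) set" and h w :: real
  assumes fin: "finite P" and hw: "0 < h" "0 < w"
    and P: "\<And>x y. (x, y) \<in> P \<Longrightarrow> 0 \<le> x \<and> 0 \<le> y \<and> w * h \<le> h * x + w * y"
    and ends: "(0, h) \<in> P" "(w, 0) \<in> P"
  shows "closed_segment (0, h) (w, 0) edge_of convex hull P \<and>
    lower_left_corner (convex hull P) (0, h) (w, 0) = closed_segment (0, h) (w, 0)"
proof -
  let ?N = "convex hull P"
  have "?N \<subseteq> {z. 0 \<le> 1 * fst z + 0 * snd z} \<inter> {z. 0 \<le> 0 * fst z + 1 * snd z} \<inter>
      {z. w * h \<le> h * fst z + w * snd z}"
    by (intro hull_minimal convex_Int convex_half_planes) (use P in auto)
  then have N: "0 \<le> x" "0 \<le> y" "w * h \<le> h * x + w * y" if "(x, y) \<in> ?N" for x y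
    using that by auto
  have ends': "(0, h) \<in> ?N" "(w, 0) \<in> ?N" using ends by (auto intro: hull_inc)
  have tight: "(x, y) \<in> closed_segment (0, h) (w, 0)" if "(x, y) \<in> ?N" "h * x + w * y = w * h" for x y
  proof (rule mem_closed_segment_line[OF _ _ _ _ that(2)])
    have "0 \<le> w * y" using N(2)[OF that(1)] hw by simp
    then have "h * x \<le> h * w" using that(2) by (simp add: mult.commute)
    then show "x \<le> w" using hw by simp
  qed (use N[OF that(1)] hw in auto)
  have "closed_segment (0, h) (w, 0) \<subseteq> ?N \<inter> {z. h * fst z + w * snd z = w * h}"
    by (intro closed_segment_subset convex_Int convex_half_planes convex_convex_hull) (use ends' in auto)
  then have seg: "z \<in> ?N \<and> h * fst z + w * snd z = w * h" if "z \<in> closed_segment (0, h) (w, 0)" for z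
    using that by blast
  have closed: "closed ?N" using fin by (simp add: compact_imp_closed finite_imp_compact_convex_hull)
  have "lower_left_corner ?N (0, h) (w, 0) = closed_segment (0, h) (w, 0)"
  proof (intro equalityI subsetI)
    fix z assume "z \<in> lower_left_corner ?N (0, h) (w, 0)"
    then have "z \<in> frontier ?N" "z \<in> convex hull {0, (0, h), (w, 0)}" by (auto simp: lower_left_corner_def)
    then have "z \<in> ?N" "h * fst z + w * snd z \<le> w * h"
      using closed mem_triangle_origin[OF hw, of "fst z" "snd z"] by (auto simp: frontier_def)
    then show "z \<in> closed_segment (0, h) (w, 0)"
      using tight[of "fst z" "snd z"] N(3)[of "fst z" "snd z"] by simp
  next
    fix z assume z: "z \<in> closed_segment (0, h) (w, 0)"
    have "z \<in> convex hull {0, (0, h), (w, 0)}"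
      using mem_triangle_origin[OF hw, of "fst z" "snd z"] seg[OF z] N[of "fst z" "snd z"] by simp
    then show "z \<in> lower_left_corner ?N (0, h) (w, 0)"
      using supported_point_in_corner[of z ?N _ _ "w * h" h w] seg[OF z] N(3) hw by blast
  qed
  moreover have "closed_segment (0, h) (w, 0) edge_of ?N"
    by (rule segment_edge_of[of _ "w * h" h w]) (use N ends' tight hw in auto)
  ultimately show ?thesis by simp
qed

text \<open>The edge vectors are \<open>(v, -u)\<close> and \<open>(v', -u')\<close>, the first being the steeper one.  The hull meets the
  triangle \<open>0ab\<close> in the triangle \<open>apb\<close>, which also has interior points below the chord.  Such a point is
  excluded by the minimality condition: it can be moved diagonally towards the origin until it meets
  one of the two supporting lines.\<close>

theorem two_edge_corner:
  fixes P :: "(real \<times> real) set" and u v u' v' :: real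
  assumes fin: "finite P" and pos: "0 < u" "0 < v" "0 < u'" "0 < v'" and steep: "u' * v < u * v'"
    and P: "\<And>x y. (x, y) \<in> P \<Longrightarrow> 0 \<le> x \<and> 0 \<le> y \<and>
      v * (u + u') \<le> u * x + v * y \<and> u' * (v + v') \<le> u' * x + v' * y"
    and vertices: "(0, u + u') \<in> P" "(v, u') \<in> P" "(v + v', 0) \<in> P"
  shows "closed_segment (0, u + u') (v, u') edge_of convex hull P \<and>
    closed_segment (v, u') (v + v', 0) edge_of convex hull P \<and>
    lower_left_corner (convex hull P) (0, u + u') (v + v', 0) =
      closed_segment (0, u + u') (v, u') \<union> closed_segment (v, u') (v + v', 0)"
proof -
  let ?N = "convex hull P"
  define h where "h = u + u'"
  define w where "w = v + v'"
  define D where "D = u * v' - u' * v"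
  have D: "0 < D" using steep by (simp add: D_def)
  have hw: "0 < h" "0 < w" using pos by (auto simp: h_def w_def)
  have "?N \<subseteq> {z. 0 \<le> 1 * fst z + 0 * snd z} \<inter> {z. 0 \<le> 0 * fst z + 1 * snd z} \<inter>
      {z. v * h \<le> u * fst z + v * snd z} \<inter> {z. u' * w \<le> u' * fst z + v' * snd z}"
    by (intro hull_minimal convex_Int convex_half_planes) (use P in \<open>auto simp: h_def w_def\<close>)
  then have N: "0 \<le> x" "0 \<le> y" "v * h \<le> u * x + v * y" "u' * w \<le> u' * x + v' * y"
    if "(x, y) \<in> ?N" for x y
    using that by auto
  have vert: "(0, h) \<in> ?N" "(v, u') \<in> ?N" "(w, 0) \<in> ?N"
    using vertices by (auto simp: h_def w_def intro: hull_inc)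
  have tight1: "(x, y) \<in> closed_segment (0, h) (v, u')"
    if "(x, y) \<in> ?N" "u * x + v * y = v * h" for x y
  proof (rule mem_closed_segment_line[OF _ _ _ _ that(2)])
    have "D * x = v' * (u * x + v * y) - v * (u' * x + v' * y)" by (simp add: D_def algebra_simps)
    also have "\<dots> \<le> v' * (v * h) - v * (u' * w)" using N(4)[OF that(1)] that(2) pos by simp
    also have "\<dots> = D * v" by (simp add: D_def h_def w_def algebra_simps)
    finally show "x \<le> v" using D by simp
  qed (use N[OF that(1)] pos in \<open>auto simp: h_def algebra_simps\<close>)
  have tight2: "(x, y) \<in> closed_segment (v, u') (w, 0)"
    if "(x, y) \<in> ?N" "u' * x + v' * y = u' * w" for x y
  proof (rule mem_closed_segment_line[OF _ _ _ _ that(2)])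
    have "D * v = v' * (v * h) - v * (u' * w)" by (simp add: D_def h_def w_def algebra_simps)
    also have "\<dots> \<le> v' * (u * x + v * y) - v * (u' * x + v' * y)"
      using N(3)[OF that(1)] that(2) pos by simp
    also have "\<dots> = D * x" by (simp add: D_def algebra_simps)
    finally show "v \<le> x" using D by simp
    have "0 \<le> v' * y" using N(2)[OF that(1)] pos by simp
    then have "u' * x \<le> u' * w" using that(2) by simp
    then show "x \<le> w" using pos by simp
  qed (use pos in \<open>auto simp: w_def algebra_simps\<close>)
  have inner: "(x, y) \<in> ?N"
    if "v * h \<le> u * x + v * y" "u' * w \<le> u' * x + v' * y" "h * x + w * y \<le> w * h" for x y
  proof -
    define ta where "ta = (u' * x + v' * y - u' * w) / D"
    define tb where "tb = (u * x + v * y - v * h) / D"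
    define tp where "tp = (w * h - h * x - w * y) / D"
    have t: "u' * x + v' * y - u' * w = D * ta" "u * x + v * y - v * h = D * tb"
        "w * h - h * x - w * y = D * tp"
      using D by (auto simp: ta_def tb_def tp_def)
    have "0 \<le> ta" "0 \<le> tb" "0 \<le> tp" using that D by (auto simp: ta_def tb_def tp_def)
    moreover have "ta + tb + tp = 1"
    proof -
      have "(u' * x + v' * y - u' * w) + (u * x + v * y - v * h) + (w * h - h * x - w * y) = D"
        by (simp add: D_def h_def w_def algebra_simps)
      then show ?thesis using D by (simp add: ta_def tb_def tp_def add_divide_distrib[symmetric])
    qed
    moreover have "x = tb * w + tp * v"
    proof -
      have "D * x = (u * x + v * y - v * h) * w + (w * h - h * x - w * y) * v"
        by (simp add: D_def h_def w_def algebra_simps)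
      also have "\<dots> = D * (tb * w + tp * v)" unfolding t by (simp add: algebra_simps)
      finally show ?thesis using D by simp
    qed
    moreover have "y = ta * h + tp * u'"
    proof -
      have "D * y = (u' * x + v' * y - u' * w) * h + (w * h - h * x - w * y) * u'"
        by (simp add: D_def h_def w_def algebra_simps)
      also have "\<dots> = D * (ta * h + tp * u')" unfolding t by (simp add: algebra_simps)
      finally show ?thesis using D by simp
    qed
    ultimately have "(x, y) \<in> convex hull {(0, h), (w, 0), (v, u')}"
      unfolding convex_hull_3 mem_Collect_eq
      by (intro exI[of _ ta] exI[of _ tb] exI[of _ tp]) auto
    moreover have "convex hull {(0, h), (w, 0), (v, u')} \<subseteq> ?N"
      by (rule hull_minimal) (use vert in auto)
    ultimately show ?thesis by blast
  qed
  have "closed_segment (0, h) (v, u') \<subseteq> ?N \<inter> {z. u * fst z + v * snd z = v * h} \<inter> {z. h * fst z + w * snd z \<le> w * h}"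
    by (intro closed_segment_subset convex_Int convex_half_planes convex_convex_hull)
      (use D vert in \<open>auto simp: D_def h_def w_def algebra_simps\<close>)
  then have seg1: "z \<in> ?N \<and> u * fst z + v * snd z = v * h \<and> h * fst z + w * snd z \<le> w * h"
    if "z \<in> closed_segment (0, h) (v, u')" for z using that by blast
  have "closed_segment (v, u') (w, 0) \<subseteq> ?N \<inter> {z. u' * fst z + v' * snd z = u' * w} \<inter> {z. h * fst z + w * snd z \<le> w * h}"
    by (intro closed_segment_subset convex_Int convex_half_planes convex_convex_hull)
      (use D vert in \<open>auto simp: D_def h_def w_def algebra_simps\<close>)
  then have seg2: "z \<in> ?N \<and> u' * fst z + v' * snd z = u' * w \<and> h * fst z + w * snd z \<le> w * h"
    if "z \<in> closed_segment (v, u') (w, 0)" for z using that by blast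
  have closed: "closed ?N" using fin by (simp add: compact_imp_closed finite_imp_compact_convex_hull)
  have "lower_left_corner ?N (0, h) (w, 0) = closed_segment (0, h) (v, u') \<union> closed_segment (v, u') (w, 0)"
  proof (intro equalityI subsetI)
    fix z assume "z \<in> lower_left_corner ?N (0, h) (w, 0)"
    then have "z \<in> frontier ?N" "z \<in> convex hull {0, (0, h), (w, 0)}"
      and min: "\<not> (\<exists>p\<in>?N. fst p < fst z \<and> snd p < snd z)" by (auto simp: lower_left_corner_def)
    moreover obtain x y where z: "z = (x, y)" by (cases z)
    ultimately have xy: "(x, y) \<in> ?N" "h * x + w * y \<le> w * h"
      using closed mem_triangle_origin[OF hw] by (auto simp: frontier_def)
    have "u * x + v * y = v * h \<or> u' * x + v' * y = u' * w"
    proof (rule ccontr)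
      assume "\<not> ?thesis"
      then have gap: "0 < u * x + v * y - v * h" "0 < u' * x + v' * y - u' * w"
        using N[OF xy(1)] by auto
      \<comment> \<open>the largest diagonal step that keeps the point above both lines\<close>
      define e where "e = min ((u * x + v * y - v * h) / (u + v)) ((u' * x + v' * y - u' * w) / (u' + v'))"
      have e: "0 < e" using gap pos by (simp add: e_def)
      have "e \<le> (u * x + v * y - v * h) / (u + v)" "e \<le> (u' * x + v' * y - u' * w) / (u' + v')"
        by (auto simp: e_def)
      then have "e * (u + v) \<le> u * x + v * y - v * h" "e * (u' + v') \<le> u' * x + v' * y - u' * w"
        using pos by (simp_all add: pos_le_divide_eq)
      moreover have "0 \<le> e * (h + w)" using e hw by simp
      ultimately have "(x - e, y - e) \<in> ?N"
        using xy(2) by (intro inner) (auto simp: algebra_simps)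
      moreover have "fst (x - e, y - e) < fst z" "snd (x - e, y - e) < snd z"
        using e by (simp_all add: z)
      ultimately show False using min by blast
    qed
    then show "z \<in> closed_segment (0, h) (v, u') \<union> closed_segment (v, u') (w, 0)"
      using tight1[OF xy(1)] tight2[OF xy(1)] z by auto
  next
    fix z assume z: "z \<in> closed_segment (0, h) (v, u') \<union> closed_segment (v, u') (w, 0)"
    obtain \<alpha> \<beta> c where l: "0 < \<alpha>" "0 < \<beta>" "\<And>x y. (x, y) \<in> ?N \<Longrightarrow> c \<le> \<alpha> * x + \<beta> * y"
      "\<alpha> * fst z + \<beta> * snd z = c" and zN: "z \<in> ?N" "h * fst z + w * snd z \<le> w * h"
    proof (cases "z \<in> closed_segment (0, h) (v, u')")
      case True
      then show ?thesis using that[of u v "v * h"] pos N(3) seg1[OF True] by auto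
    next
      case False
      then have "z \<in> closed_segment (v, u') (w, 0)" using z by blast
      then show ?thesis using that[of u' v' "u' * w"] pos N(4) seg2 by auto
    qed
    have "z \<in> convex hull {0, (0, h), (w, 0)}"
      using mem_triangle_origin[OF hw, of "fst z" "snd z"] zN N[of "fst z" "snd z"] by simp
    then show "z \<in> lower_left_corner ?N (0, h) (w, 0)"
      using supported_point_in_corner[OF zN(1) _ l(3,4,1,2)] by blast
  qed
  moreover have "closed_segment (0, h) (v, u') edge_of ?N"
    by (rule segment_edge_of[of _ "v * h" u v])
      (use N vert tight1 pos in \<open>auto simp: h_def algebra_simps\<close>)
  moreover have "closed_segment (v, u') (w, 0) edge_of ?N"
    by (rule segment_edge_of[of _ "u' * w" u' v'])
      (use N vert tight2 pos in \<open>auto simp: w_def algebra_simps\<close>)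
  ultimately show ?thesis by (simp add: h_def w_def)
qed

text \<open>The family of half planes in which the resultant puts its Newton polygon: \<open>\<gamma>\<close> and \<open>\<gamma>'\<close> are the
  slopes chosen at the two ends \<open>t = 0\<close> and \<open>t = \<infinity>\<close>.\<close>

definition end_bounds :: "(real \<times> real) set \<Rightarrow> real \<Rightarrow> real \<Rightarrow> real \<Rightarrow> real \<Rightarrow> bool" where
  "end_bounds P U0 V0 U1 V1 \<longleftrightarrow> (\<forall>(x, y)\<in>P. 0 \<le> x \<and> 0 \<le> y \<and> (\<forall>\<alpha> \<beta> \<gamma> \<gamma>'.
     0 \<le> \<alpha> \<and> 0 \<le> \<beta> \<and> 0 \<le> \<gamma> \<and> 0 \<le> \<gamma>' \<and>
     \<gamma> * U0 \<le> \<alpha> \<and> \<gamma> * V0 \<le> \<beta> \<and> \<gamma>' * U1 \<le> \<alpha> \<and> \<gamma>' * V1 \<le> \<beta> \<longrightarrow>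
     \<gamma> * U0 * V0 + \<gamma>' * U1 * V1 \<le> \<alpha> * x + \<beta> * y))"

lemma end_boundsD:
  assumes "end_bounds P U0 V0 U1 V1" "(x, y) \<in> P"
  shows "0 \<le> x \<and> 0 \<le> y"
    and "0 \<le> \<alpha> \<Longrightarrow> 0 \<le> \<beta> \<Longrightarrow> 0 \<le> \<gamma> \<Longrightarrow> 0 \<le> \<gamma>' \<Longrightarrow>
      \<gamma> * U0 \<le> \<alpha> \<Longrightarrow> \<gamma> * V0 \<le> \<beta> \<Longrightarrow> \<gamma>' * U1 \<le> \<alpha> \<Longrightarrow> \<gamma>' * V1 \<le> \<beta> \<Longrightarrow>
      \<gamma> * U0 * V0 + \<gamma>' * U1 * V1 \<le> \<alpha> * x + \<beta> * y"
  using assms unfolding end_bounds_def by blast+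

lemma end_bounds_swap:
  assumes B: "end_bounds P U0 V0 U1 V1"
  shows "end_bounds P U1 V1 U0 V0"
  unfolding end_bounds_def
proof (intro ballI, clarify, intro conjI allI impI)
  fix x y assume xy: "(x, y) \<in> P"
  show "0 \<le> x" "0 \<le> y" using end_boundsD(1)[OF B xy] by auto
  fix \<alpha> \<beta> \<gamma> \<gamma>' :: real
  assume *: "0 \<le> \<alpha> \<and> 0 \<le> \<beta> \<and> 0 \<le> \<gamma> \<and> 0 \<le> \<gamma>' \<and> \<gamma> * U1 \<le> \<alpha> \<and> \<gamma> * V1 \<le> \<beta> \<and>
    \<gamma>' * U0 \<le> \<alpha> \<and> \<gamma>' * V0 \<le> \<beta>"
  have "\<gamma>' * U0 * V0 + \<gamma> * U1 * V1 \<le> \<alpha> * x + \<beta> * y"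
    by (rule end_boundsD(2)[OF B xy]) (use * in blast)+
  then show "\<gamma> * U1 * V1 + \<gamma>' * U0 * V0 \<le> \<alpha> * x + \<beta> * y" by (simp only: add.commute)
qed

text \<open>An end that does not contribute is encoded by \<open>U = V = 0\<close>, which makes the case of a single
  contributing end and that of two parallel vectors the same computation.\<close>

lemma one_edge_of_bounds:
  fixes U0 U1 V0 V1 :: real
  assumes fin: "finite P" and end_bounds: "end_bounds P U0 V0 U1 V1"
    and nonneg: "0 \<le> U0" "0 \<le> U1" "0 \<le> V0" "0 \<le> V1"
    and pos: "0 < U0 \<longleftrightarrow> 0 < V0" "0 < U1 \<longleftrightarrow> 0 < V1" "0 < U0 + U1"
    and parallel: "U1 * V0 = U0 * V1"
    and ends: "(0, U0 + U1) \<in> P" "(V0 + V1, 0) \<in> P"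
  shows "closed_segment (0, U0 + U1) (V0 + V1, 0) edge_of convex hull P \<and>
    lower_left_corner (convex hull P) (0, U0 + U1) (V0 + V1, 0) = closed_segment (0, U0 + U1) (V0 + V1, 0)"
proof (rule one_edge_corner[OF fin pos(3) _ _ ends])
  define H where "H = U0 + U1"
  define W where "W = V0 + V1"
  have H: "0 < H" using pos(3) by (simp add: H_def)
  show W: "0 < V0 + V1"
  proof (cases "0 < U0")
    case True
    then show ?thesis using pos(1) nonneg(4) by linarith
  next
    case False
    then have "0 < V1" using pos(2,3) nonneg by linarith
    then show ?thesis using nonneg(3) by linarith
  qed
  have slope: "H / U * V \<le> W \<and> H / U * U = H"
    if "0 < U" "H * V = U * W" for U V
    using that by (simp add: field_simps)
  define \<gamma> where "\<gamma> = (if 0 < U0 then H / U0 else 0)"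
  define \<gamma>' where "\<gamma>' = (if 0 < U1 then H / U1 else 0)"
  have "H * V0 = U0 * W" "H * V1 = U1 * W" using parallel by (simp_all add: H_def W_def algebra_simps)
  then have g: "0 \<le> \<gamma>" "\<gamma> * U0 \<le> H" "\<gamma> * V0 \<le> W" "\<gamma> * U0 * V0 = H * V0"
    and g': "0 \<le> \<gamma>'" "\<gamma>' * U1 \<le> H" "\<gamma>' * V1 \<le> W" "\<gamma>' * U1 * V1 = H * V1"
    using slope[of U0 V0] slope[of U1 V1] H W nonneg pos(1,2) by (auto simp: \<gamma>_def \<gamma>'_def W_def)
  fix x y assume xy: "(x, y) \<in> P"
  have "\<gamma> * U0 * V0 + \<gamma>' * U1 * V1 \<le> H * x + W * y"
    using g g' H W xy by (intro end_boundsD(2)[OF end_bounds xy]) (auto simp: W_def)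
  then have "(V0 + V1) * (U0 + U1) \<le> (U0 + U1) * x + (V0 + V1) * y"
    unfolding g(4) g'(4) by (simp add: H_def W_def algebra_simps)
  then show "0 \<le> x \<and> 0 \<le> y \<and> (V0 + V1) * (U0 + U1) \<le> (U0 + U1) * x + (V0 + V1) * y"
    using end_boundsD(1)[OF end_bounds xy] by simp
qed

text \<open>Each supporting line is normal to one of the two vectors; its slope parameter is \<open>1\<close> for its own
  end and the largest admissible one for the other end.\<close>

lemma two_edges_of_bounds:
  fixes U0 U1 V0 V1 :: real
  assumes fin: "finite P" and end_bounds: "end_bounds P U0 V0 U1 V1"
    and pos: "0 < U0" "0 < U1" "0 < V0" "0 < V1" and steep: "U1 * V0 < U0 * V1"
    and vertices: "(0, U0 + U1) \<in> P" "(V0, U1) \<in> P" "(V0 + V1, 0) \<in> P"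
  shows "closed_segment (0, U0 + U1) (V0, U1) edge_of convex hull P \<and>
    closed_segment (V0, U1) (V0 + V1, 0) edge_of convex hull P \<and>
    lower_left_corner (convex hull P) (0, U0 + U1) (V0 + V1, 0) =
      closed_segment (0, U0 + U1) (V0, U1) \<union> closed_segment (V0, U1) (V0 + V1, 0)"
proof (rule two_edge_corner[OF fin pos(1,3,2,4) steep _ vertices])
  fix x y assume xy: "(x, y) \<in> P"
  have "1 * U0 * V0 + V0 / V1 * U1 * V1 \<le> U0 * x + V0 * y"
    by (rule end_boundsD(2)[OF end_bounds xy]) (use pos steep in \<open>auto simp: field_simps\<close>)
  moreover have "U1 / U0 * U0 * V0 + 1 * U1 * V1 \<le> U1 * x + V1 * y"
    by (rule end_boundsD(2)[OF end_bounds xy]) (use pos steep in \<open>auto simp: field_simps\<close>)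
  ultimately show "0 \<le> x \<and> 0 \<le> y \<and> V0 * (U0 + U1) \<le> U0 * x + V0 * y \<and>
      U1 * (V0 + V1) \<le> U1 * x + V1 * y"
    using end_boundsD(1)[OF end_bounds xy] pos by (simp add: algebra_simps)
qed

section \<open>Triangles between the two rows\<close>

locale finite_supports =
  fixes S :: supports
  assumes fin: "\<And>s. finite (S s)" and ne: "\<And>s. S s \<noteq> {}"

text \<open>The two rows play symmetric roles.  A row is named by its height \<open>h\<close>, which is \<open>0\<close> or \<open>1\<close>, so that
  \<open>1 - h\<close> is the opposite row and both quantities of the problem are instances of one.\<close>

definition row_points :: "supports \<Rightarrow> real \<Rightarrow> nat set" where
  "row_points S h = (if h = 0 then A0 S else A1 S)"

definition nonselected :: "supports \<Rightarrow> real \<Rightarrow> nat set" where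
  "nonselected S h = (if h = 0 then S NumX else S NumY)"

definition tri :: "real \<Rightarrow> nat \<Rightarrow> nat \<Rightarrow> nat \<Rightarrow> (real \<times> real) set" where
  "tri h a b b' = convex hull {(real a, h), (real b, 1 - h), (real b', 1 - h)}"

definition weighted_triples :: "supports \<Rightarrow> real \<Rightarrow> (real \<times> real) set set \<Rightarrow> (nat \<times> nat \<times> nat) set" where
  "weighted_triples S h \<T> = {(a, b, b'). a \<in> row_points S h - nonselected S h \<and>
     b \<in> row_points S (1 - h) \<and> b' \<in> row_points S (1 - h) \<and> b < b' \<and> tri h a b b' \<in> \<T>}"

definition energy :: "supports \<Rightarrow> real \<Rightarrow> (real \<times> real) set set \<Rightarrow> nat" where
  "energy S h \<T> = (\<Sum>(a, b, b') \<in> weighted_triples S h \<T>. b' - b)"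

lemma selected_eq: "selected0 S = row_points S 0 - nonselected S 0" "selected1 S = row_points S 1 - nonselected S 1"
  by (auto simp: selected0_def selected1_def row_points_def nonselected_def A0_def A1_def)

lemma e_eq_energy: "e0 S = energy S 0" "e1 S = energy S 1"
  by (auto simp: fun_eq_iff e0_def e1_def energy_def weighted_triples_def selected_eq tri_def row_points_def
      intro!: sum.cong)

lemma (in finite_supports) finite_row_points: "finite (row_points S h)"
  by (simp add: fin row_points_def A0_def A1_def)

lemma cayley_points_eq: "h = 0 \<or> h = 1 \<Longrightarrow>
  cayley_points S = (\<lambda>a. (real a, h)) ` row_points S h \<union> (\<lambda>a. (real a, 1 - h)) ` row_points S (1 - h)"
  by (auto simp: cayley_points_def row_points_def)

lemma (in finite_supports) finite_weighted_triples: "finite (weighted_triples S h \<T>)"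
  by (rule finite_subset[of _ "row_points S h \<times> row_points S (1 - h) \<times> row_points S (1 - h)"])
    (auto simp: weighted_triples_def finite_row_points)

lemma tri_apex_row:
  assumes "(x, h) \<in> tri h a b b'" "h = 0 \<or> h = 1"
  shows "x = real a"
proof -
  obtain u v w :: real where uvw: "0 \<le> u" "0 \<le> v" "0 \<le> w" "u + v + w = 1"
    and "x = u * a + v * b + w * b'" and h: "h = u * h + v * (1 - h) + w * (1 - h)"
    using assms(1) by (auto simp: tri_def convex_hull_3)
  moreover have "v + w = 0" using assms(2) h uvw(4) by (auto simp: algebra_simps)
  then have "v = 0" "w = 0" using uvw by auto
  ultimately show ?thesis by simp
qed

lemma tri_base_row:
  assumes "(x, 1 - h) \<in> tri h a b b'" "h = 0 \<or> h = 1" "b < b'"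
  shows "real b \<le> x \<and> x \<le> real b'"
proof -
  obtain u v w :: real where uvw: "0 \<le> u" "0 \<le> v" "0 \<le> w" "u + v + w = 1"
    and x: "x = u * a + v * b + w * b'" and h: "1 - h = u * h + v * (1 - h) + w * (1 - h)"
    using assms(1) by (auto simp: tri_def convex_hull_3)
  have "u = 0" using assms(2) h uvw by (auto simp: algebra_simps)
  then have v: "v = 1 - w" using uvw(4) by simp
  have "x = real b + w * (real b' - real b)" "x = real b' - v * (real b' - real b)"
    unfolding x \<open>u = 0\<close> v by (simp_all add: algebra_simps)
  moreover have "0 \<le> w * (real b' - real b)" "0 \<le> v * (real b' - real b)" using uvw assms(3) by auto
  ultimately show ?thesis by linarith
qed

lemma tri_vertices: "(real a, h) \<in> tri h a b b'" "(real b, 1 - h) \<in> tri h a b b'" "(real b', 1 - h) \<in> tri h a b b'"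
  unfolding tri_def by (rule hull_inc; simp)+

lemma tri_inject:
  assumes "tri h a b b' = tri h c d d'" "h = 0 \<or> h = 1" "b < b'" "d < d'"
  shows "a = c \<and> b = d \<and> b' = d'"
proof -
  note T = assms(1)
  have "(real a, h) \<in> tri h c d d'" unfolding T[symmetric] by (rule tri_vertices)
  then have "real a = real c" by (rule tri_apex_row[OF _ assms(2)])
  moreover have "(real b, 1 - h) \<in> tri h c d d'" "(real b', 1 - h) \<in> tri h c d d'"
    unfolding T[symmetric] by (rule tri_vertices)+
  then have "real d \<le> real b" "real b' \<le> real d'"
    using tri_base_row[OF _ assms(2,4)] by blast+
  moreover have "(real d, 1 - h) \<in> tri h a b b'" "(real d', 1 - h) \<in> tri h a b b'"
    unfolding T by (rule tri_vertices)+
  then have "real b \<le> real d" "real d' \<le> real b'"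
    using tri_base_row[OF _ assms(2,3)] by blast+
  ultimately show ?thesis by simp
qed

lemma tri_distinct:
  assumes "tri h a b b' = tri (1 - h) c d d'" "h = 0 \<or> h = 1" "b < b'"
  shows False
proof -
  have "(real b, 1 - h) \<in> tri (1 - h) c d d'" "(real b', 1 - h) \<in> tri (1 - h) c d d'"
    using tri_vertices(2,3)[of _ h] assms(1) by metis+
  then have "real b = real c" "real b' = real c"
    using tri_apex_row[of "real b" "1 - h" c d d'] tri_apex_row[of "real b'" "1 - h" c d d'] assms(2)
    by auto
  then show False using assms(3) by simp
qed

lemma not_collinear_two_rows:
  assumes "p \<noteq> p'" "h \<noteq> (g::real)"
  shows "\<not> affine_dependent {(q::real, h), (p, g), (p', g)}"
proof
  assume dep: "affine_dependent {(q, h), (p, g), (p', g)}"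
  then have "collinear {(q, h), (p, g), (p', g)}" by (simp add: collinear_3_eq_affine_dependent)
  then obtain u where u: "\<forall>x\<in>{(q, h), (p, g), (p', g)}. \<forall>y\<in>{(q, h), (p, g), (p', g)}. \<exists>c. x - y = c *\<^sub>R u"
    unfolding collinear_def by blast
  have "\<exists>c. (p, g) - (p', g) = c *\<^sub>R u" "\<exists>c. (q, h) - (p, g) = c *\<^sub>R u"
    by (rule u[rule_format]; simp)+
  then obtain c d where cd: "(p, g) - (p', g) = c *\<^sub>R u" "(q, h) - (p, g) = d *\<^sub>R u" by (elim exE)
  have "c * fst u = p - p'" using arg_cong[OF cd(1), of fst] by simp
  moreover have "c * snd u = 0" using arg_cong[OF cd(1), of snd] by simp
  moreover have "d * snd u = h - g" using arg_cong[OF cd(2), of snd] by simp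
  ultimately show False using assms by (cases "c = 0") simp_all
qed

lemma collinear_one_row: "collinear {(p::real, h::real), (q, h), (r, h)}"
  unfolding collinear_def
proof (intro exI[of _ "(1, 0)"] ballI)
  fix x y assume "x \<in> {(p, h), (q, h), (r, h)}" "y \<in> {(p, h), (q, h), (r, h)}"
  then show "\<exists>c. x - y = c *\<^sub>R (1, 0)" by (intro exI[of _ "fst x - fst y"]) (auto simp: zero_prod_def)
qed

text \<open>Affine independence forbids three vertices in one row, so one row contains the apex and the other
  one the base.\<close>

lemma triangle_cases:
  assumes \<T>: "\<T> \<in> triangulations S" and T: "T \<in> \<T>"
  shows "\<exists>h a b b'. (h = 0 \<or> h = 1) \<and> a \<in> row_points S h \<and> b \<in> row_points S (1 - h) \<and>
    b' \<in> row_points S (1 - h) \<and> b < b' \<and> T = tri h a b b'"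
proof -
  have "2 simplex T" and ext: "{v. v extreme_point_of T} \<subseteq> cayley_points S"
    using \<T> T by (auto simp: triangulations_def)
  then obtain C where C: "\<not> affine_dependent C" "int (card C) = 2 + 1" "T = convex hull C"
    unfolding simplex_def by blast
  have sub: "C \<subseteq> cayley_points S"
    using ext C extreme_point_of_convex_hull_affine_independent[OF C(1)] by auto
  have "card C = 3" using C(2) by simp
  then obtain p q r where pqr: "C = {p, q, r}" "p \<noteq> q" "q \<noteq> r" "p \<noteq> r"
    unfolding card_3_iff by blast
  have two: ?thesis
    if xyz: "C = {x, y, z}" "snd x = h" "snd y = 1 - h" "snd z = 1 - h" "y \<noteq> z" and h: "h = 0 \<or> h = 1"
    for x y z h
  proof -
    have vert: "\<exists>a\<in>row_points S (snd v). v = (real a, snd v)" if "v \<in> C" for v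
      using sub that by (auto simp: cayley_points_def row_points_def)
    have "x \<in> C" "y \<in> C" "z \<in> C" using xyz(1) by simp_all
    from vert[OF this(1)] vert[OF this(2)] vert[OF this(3)]
    obtain a b c where abc: "x = (real a, h)" "a \<in> row_points S h" "y = (real b, 1 - h)"
      "b \<in> row_points S (1 - h)" "z = (real c, 1 - h)" "c \<in> row_points S (1 - h)"
      unfolding xyz(2-4) by (elim bexE)
    have "C = {x, z, y}" using xyz(1) by blast
    then have T': "T = tri h a b c" "T = tri h a c b"
      using C(3) xyz(1) abc(1,3,5) by (simp_all add: tri_def)
    have "b \<noteq> c" using xyz(5) abc by auto
    then consider "b < c" | "c < b" by linarith
    then show ?thesis
    proof cases
      case 1
      show ?thesis
        by (rule exI[of _ h], rule exI[of _ a], rule exI[of _ b], rule exI[of _ c])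
          (simp add: h 1 abc(2,4,6) T'(1)[symmetric])
    next
      case 2
      show ?thesis
        by (rule exI[of _ h], rule exI[of _ a], rule exI[of _ c], rule exI[of _ b])
          (simp add: h 2 abc(2,4,6) T'(2)[symmetric])
    qed
  qed
  have rows: "snd v = 0 \<or> snd v = 1" if "v \<in> C" for v
    using sub that by (auto simp: cayley_points_def)
  have "\<not> (snd p = snd q \<and> snd q = snd r)"
  proof
    assume "snd p = snd q \<and> snd q = snd r"
    then have "p = (fst p, snd p)" "q = (fst q, snd p)" "r = (fst r, snd p)" by (simp_all add: prod_eq_iff)
    then have "collinear {p, q, r}" using collinear_one_row[of "fst p" "snd p" "fst q" "fst r"] by metis
    then show False using C(1) pqr by (simp add: collinear_3_eq_affine_dependent)
  qed
  then consider "snd p = 1 - snd q" "snd r = snd q" | "snd q = 1 - snd p" "snd r = snd p"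
    | "snd r = 1 - snd p" "snd q = snd p"
    using rows[of p] rows[of q] rows[of r] pqr(1) by auto
  then show ?thesis
  proof cases
    case 1
    then have "snd q = 1 - snd p" "snd r = 1 - snd p" by linarith+
    with two[OF pqr(1) refl] show ?thesis using rows[of p] pqr by blast
  next
    case 2
    then have "snd p = 1 - snd q" "snd r = 1 - snd q" by linarith+
    moreover have "C = {q, p, r}" using pqr(1) by blast
    note two[OF this refl]
    ultimately show ?thesis using rows[of q] pqr by blast
  next
    case 3
    then have "snd p = 1 - snd r" "snd q = 1 - snd r" by linarith+
    moreover have "C = {r, p, q}" using pqr(1) by blast
    note two[OF this refl]
    ultimately show ?thesis using rows[of r] pqr by blast
  qed
qed

text \<open>The edge from \<open>b\<close> to \<open>c\<close> and the edge from \<open>a\<close> to \<open>d\<close> join the two rows in opposite orders, so they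
  cross in interior points.  The crossing point lies in the common face, which then contains
  both end points of the first edge; but the only point of the second triangle in row \<open>h\<close> is its apex.\<close>

lemma crossing_triangles:
  assumes \<T>: "triangulation \<T>" and T: "tri (1 - h) c b x \<in> \<T>" "tri h a d y \<in> \<T>"
    and h: "h = 0 \<or> h = 1" and cross: "0 < (real a - real b) * (real c - real d)"
  shows False
proof -
  let ?T = "tri (1 - h) c b x" and ?T' = "tri h a d y"
  define s where "s = (real a - real b) / ((real a - real b) + (real c - real d))"
  have "0 < s \<and> s < 1 \<and> real a - real b + (real c - real d) \<noteq> 0"
    using cross unfolding s_def zero_less_mult_iff
    by (elim disjE conjE) (simp_all add: zero_less_divide_iff divide_less_eq)
  then have s: "0 < s" "s < 1" "s * ((real a - real b) + (real c - real d)) = real a - real b"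
    by (simp_all add: s_def)
  define z where "z = ((1 - s) * real b + s * real c, (1 - s) * h + s * (1 - h))"
  have z': "z = ((1 - s) * real a + s * real d, (1 - s) * h + s * (1 - h))"
    using s(3) by (simp add: z_def algebra_simps)
  have zz: "z = (1 - s) *\<^sub>R (real b, h) + s *\<^sub>R (real c, 1 - h)"
    "z = (1 - s) *\<^sub>R (real a, h) + s *\<^sub>R (real d, 1 - h)"
    using z' by (auto simp: z_def)
  have v: "(real c, 1 - h) \<in> ?T" "(real b, h) \<in> ?T" "(real a, h) \<in> ?T'" "(real d, 1 - h) \<in> ?T'"
    using tri_vertices(1)[of c "1 - h" b x] tri_vertices(2)[where h = "1 - h" and a = c and b = b and b' = x]
      tri_vertices(1)[of a h d y] tri_vertices(2)[where h = h and a = a and b = d and b' = y] by auto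
  have "convex ?T" "convex ?T'" by (simp_all add: tri_def)
  then have "z \<in> ?T" unfolding zz(1) by (intro convexD_alt) (use v s in auto)
  moreover have "z \<in> ?T'" unfolding zz(2) by (rule convexD_alt[OF \<open>convex ?T'\<close>]) (use v s in auto)
  moreover have "?T \<inter> ?T' face_of ?T" using \<T> T by (auto simp: triangulation_def)
  moreover have "z \<in> open_segment (real b, h) (real c, 1 - h)"
    using s zz(1) h unfolding in_segment by auto
  ultimately have "(real b, h) \<in> ?T'" using v by (meson face_ofD IntI IntD2)
  then have "real b = real a" by (rule tri_apex_row[OF _ h])
  then show False using cross by simp
qed

text \<open>Apply the covering property to the midpoint of the unit cell from \<open>k\<close> to \<open>k + 1\<close>: not
  being a lattice point it is no apex, so it lies in the base of some triangle.\<close>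

lemma row_point_covered:
  assumes \<T>: "\<T> \<in> triangulations S" and h: "h = 0 \<or> h = 1"
    and pq: "p \<in> row_points S (1 - h)" "q \<in> row_points S (1 - h)" "p \<le> k" "k < q"
  shows "\<exists>a b b'. a \<in> row_points S h \<and> b \<in> row_points S (1 - h) \<and> b' \<in> row_points S (1 - h) \<and>
    b \<le> k \<and> k < b' \<and> tri h a b b' \<in> \<T>"
proof -
  define x where "x = real k + 1 / 2"
  have nonint: "x \<noteq> real l" for l
  proof
    assume "x = real l"
    then have "2 * k + 1 = 2 * l" unfolding x_def by linarith
    then show False by presburger
  qed
  have "(x, 1 - h) \<in> closed_segment (real p, 1 - h) (real q, 1 - h)"
  proof -
    have "x \<in> closed_segment (real p) (real q)"
      using pq by (auto simp: closed_segment_eq_real_ivl x_def)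
    then obtain s where "0 \<le> s" "s \<le> 1" "x = (1 - s) *\<^sub>R real p + s *\<^sub>R real q"
      by (auto simp: in_segment)
    then show ?thesis unfolding in_segment by (intro exI[of _ s]) (auto simp: algebra_simps)
  qed
  moreover have "closed_segment (real p, 1 - h) (real q, 1 - h) \<subseteq> convex hull cayley_points S"
    by (rule closed_segment_subset)
      (use pq h in \<open>auto intro!: hull_inc simp: cayley_points_eq[OF h]\<close>)
  ultimately have "(x, 1 - h) \<in> \<Union>\<T>" using \<T> by (auto simp: triangulations_def)
  then obtain T where T: "T \<in> \<T>" "(x, 1 - h) \<in> T" by blast
  obtain h' a b b' where T': "h' = 0 \<or> h' = 1" "a \<in> row_points S h'" "b \<in> row_points S (1 - h')"
    "b' \<in> row_points S (1 - h')" "b < b'" "T = tri h' a b b'"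
    using triangle_cases[OF \<T> T(1)] by blast
  show ?thesis
  proof (cases "h' = h")
    case True
    then have "real b \<le> x" "x \<le> real b'" using tri_base_row[of x h a b b'] T' T(2) by auto
    then have "b \<le> k" "k < b'" using nonint[of b] nonint[of b'] by (auto simp: x_def)
    then show ?thesis using T' T True by auto
  next
    case False
    then have "h' = 1 - h" using h T'(1) by auto
    then have "x = real a" using tri_apex_row[of x h' a b b'] T' T(2) by simp
    then show ?thesis using nonint by blast
  qed
qed

section \<open>Extremal triangulations\<close>

text \<open>For \<open>h = 0\<close> this is the height of the corner on the vertical axis, for \<open>h = 1\<close> its width on the
  horizontal one.  An end of the opposite row counts only if it is selected.\<close>

definition corner_cost :: "supports \<Rightarrow> real \<Rightarrow> nat" where
  "corner_cost S h =
     (if Min (row_points S (1 - h)) \<notin> nonselected S (1 - h) then Min (nonselected S h) - Min (row_points S h) else 0) +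
     (if Max (row_points S (1 - h)) \<notin> nonselected S (1 - h) then Max (row_points S h) - Max (nonselected S h) else 0)"

text \<open>If no triangle with a selected apex in row \<open>h\<close> has its base in the opposite row, the apexes over
  the opposite row lie between the extreme non-selected points of row \<open>h\<close>.  A triangle whose base
  covers a cell of row \<open>h\<close> outside that range and whose apex is not the corresponding
  extreme point would therefore cross one of them.  Counting unit cells
  avoids having to know that bases of different triangles do not overlap.\<close>

theorem (in finite_supports) corner_cost_lower_bound:
  assumes h: "h = 0 \<or> h = 1" and two: "Min (row_points S (1 - h)) < Max (row_points S (1 - h))"
    and \<T>: "\<T> \<in> triangulations S" and zero: "energy S h \<T> = 0"
  shows "corner_cost S h \<le> energy S (1 - h) \<T>"
proof -
  define lo where "lo = Min (row_points S h)"
  define hi where "hi = Max (row_points S h)"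
  define l where "l = Min (nonselected S h)"
  define r where "r = Max (nonselected S h)"
  define lo' where "lo' = Min (row_points S (1 - h))"
  define hi' where "hi' = Max (row_points S (1 - h))"
  have frow: "finite (row_points S g)" for g by (rule finite_row_points)
  have nrow: "row_points S g \<noteq> {}" for g using ne by (simp add: row_points_def A0_def A1_def)
  have nons: "finite (nonselected S h)" "nonselected S h \<noteq> {}" "nonselected S h \<subseteq> row_points S h"
    using fin ne h by (auto simp: nonselected_def row_points_def A0_def A1_def)
  have lr: "l \<le> r" "l \<in> row_points S h" "r \<in> row_points S h"
    using nons Min_in Max_in by (auto simp: l_def r_def intro: order.trans[OF Min_le Max_ge])
  have lohi: "lo \<in> row_points S h" "hi \<in> row_points S h" "lo \<le> l" "r \<le> hi"
    using frow nrow lr by (auto simp: lo_def hi_def)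
  have lohi': "lo' \<in> row_points S (1 - h)" "hi' \<in> row_points S (1 - h)" "lo' < hi'"
    using frow nrow two by (auto simp: lo'_def hi'_def)
  have range: "lo' \<le> c \<and> c \<le> hi'" if "c \<in> row_points S (1 - h)" for c
    using frow that by (simp add: lo'_def hi'_def)
  have tg: "triangulation \<T>" using \<T> by (simp add: triangulations_def)
  have apex: "a \<in> nonselected S h"
    if "tri h a d d' \<in> \<T>" "a \<in> row_points S h" "d \<in> row_points S (1 - h)" "d' \<in> row_points S (1 - h)" "d < d'"
    for a d d'
  proof (rule ccontr)
    assume "a \<notin> nonselected S h"
    then have mem: "(a, d, d') \<in> weighted_triples S h \<T>" using that by (simp add: weighted_triples_def)
    have "\<forall>t\<in>weighted_triples S h \<T>. (case t of (a, b, b') \<Rightarrow> b' - b) = 0"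
      using zero finite_weighted_triples unfolding energy_def by (simp add: sum_eq_0_iff)
    then show False using mem that(5) by fastforce
  qed
  have apex_range: "l \<le> a \<and> a \<le> r" if "a \<in> nonselected S h" for a
    using nons that by (simp add: l_def r_def)
  have h': "1 - h = 0 \<or> 1 - h = 1" using h by auto
  define Z where "Z = weighted_triples S (1 - h) \<T>"
  \<comment> \<open>every cell outside the range of the non-selected points is covered by a counted base\<close>
  have cell: "\<exists>(a, b, b')\<in>Z. b \<le> k \<and> k < b'"
    if k: "lo \<le> k \<and> k < l \<and> lo' \<notin> nonselected S (1 - h) \<or> r \<le> k \<and> k < hi \<and> hi' \<notin> nonselected S (1 - h)"
    for k
  proof -
    have "lo \<le> k" "k < hi" using k lohi lr by auto
    then obtain c b b' where T: "c \<in> row_points S (1 - h)" "b \<in> row_points S h" "b' \<in> row_points S h"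
      "b \<le> k" "k < b'" "tri (1 - h) c b b' \<in> \<T>"
      using row_point_covered[OF \<T> h', of lo hi k] lohi by auto
    have "c \<notin> nonselected S (1 - h)"
      using k
    proof (elim disjE conjE)
      assume kl: "k < l" and sel: "lo' \<notin> nonselected S (1 - h)"
      have "c = lo'"
      proof (rule ccontr)
        assume "c \<noteq> lo'"
        then have "lo' < c" using range T(1) by (simp add: order.strict_iff_order)
        obtain a d d' where T': "a \<in> row_points S h" "d \<in> row_points S (1 - h)" "d' \<in> row_points S (1 - h)"
          "d \<le> lo'" "lo' < d'" "tri h a d d' \<in> \<T>"
          using row_point_covered[OF \<T> h, of lo' hi' lo'] lohi' by auto
        have "l \<le> a" using apex[OF T'(6,1,2,3)] apex_range T'(4,5) by auto
        then have "real b < real a" "real d < real c" using T(4) kl T'(4) \<open>lo' < c\<close> by auto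
        then have "0 < (real a - real b) * (real c - real d)" by simp
        then show False by (rule crossing_triangles[OF tg T(6) T'(6) h])
      qed
      then show ?thesis using sel by simp
    next
      assume kr: "r \<le> k" and sel: "hi' \<notin> nonselected S (1 - h)"
      have "c = hi'"
      proof (rule ccontr)
        assume "c \<noteq> hi'"
        then have "c < hi'" using range T(1) by (simp add: order.strict_iff_order)
        have "lo' \<le> hi' - 1" "hi' - 1 < hi'" using lohi'(3) by simp_all
        from row_point_covered[OF \<T> h lohi'(1,2) this]
        obtain a d d' where T': "a \<in> row_points S h" "d \<in> row_points S (1 - h)" "d' \<in> row_points S (1 - h)"
          "d \<le> hi' - 1" "hi' - 1 < d'" "tri h a d d' \<in> \<T>" by blast
        have "a \<le> r" using apex[OF T'(6,1,2,3)] apex_range T'(4,5) by auto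
        then have "real a < real b'" "real c < real d'" using T(5) kr T'(5) \<open>c < hi'\<close> by auto
        then have "0 < (real a - real b') * (real c - real d')" by (simp add: mult_neg_neg)
        moreover have "tri (1 - h) c b' b \<in> \<T>" "tri h a d' d \<in> \<T>"
          using T(6) T'(6) by (simp_all add: tri_def insert_commute)
        ultimately show False using crossing_triangles[OF tg _ _ h] by blast
      qed
      then show ?thesis using sel by simp
    qed
    then have "(c, b, b') \<in> Z" using T by (simp add: Z_def weighted_triples_def)
    then show ?thesis using T by blast
  qed
  define D where "D = (if lo' \<notin> nonselected S (1 - h) then {lo..<l} else {}) \<union>
    (if hi' \<notin> nonselected S (1 - h) then {r..<hi} else {})"
  have "corner_cost S h = card D"
    unfolding D_def corner_cost_def lo_def[symmetric] hi_def[symmetric] l_def[symmetric] r_def[symmetric]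
      lo'_def[symmetric] hi'_def[symmetric]
    using lr by (subst card_Un_disjoint) auto
  also have "D \<subseteq> (\<Union>t\<in>Z. case t of (a, b, b') \<Rightarrow> {b..<b'})"
  proof
    fix k assume "k \<in> D"
    then obtain a b b' where "(a, b, b') \<in> Z" "b \<le> k" "k < b'"
      using cell[of k] by (auto simp: D_def split: if_splits)
    then show "k \<in> (\<Union>t\<in>Z. case t of (a, b, b') \<Rightarrow> {b..<b'})" by force
  qed
  then have "card D \<le> card (\<Union>t\<in>Z. case t of (a, b, b') \<Rightarrow> {b..<b'})"
    using finite_weighted_triples by (intro card_mono) (auto simp: Z_def)
  also have "\<dots> \<le> (\<Sum>t\<in>Z. card (case t of (a, b, b') \<Rightarrow> {b..<b'}))"
    using finite_weighted_triples by (intro card_UN_le) (simp add: Z_def)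
  also have "\<dots> = energy S (1 - h) \<T>"
    unfolding energy_def Z_def by (intro sum.cong) auto
  finally show ?thesis .
qed

text \<open>The trapezoid between the segments that join the two rows from \<open>p\<close> to \<open>q\<close> and from \<open>p'\<close> to \<open>q'\<close>.
  It is a triangle if one of these end points does not move.\<close>

definition strip :: "nat \<Rightarrow> nat \<Rightarrow> nat \<Rightarrow> nat \<Rightarrow> (real \<times> real) set" where
  "strip p q p' q' = convex hull {(real p, 0), (real q, 1), (real p', 0), (real q', 1)}"

lemma mem_strip:
  assumes "p \<le> p'" "q \<le> q'"
  shows "(x, y) \<in> strip p q p' q' \<longleftrightarrow> 0 \<le> y \<and> y \<le> 1 \<and>
    (1 - y) * real p + y * real q \<le> x \<and> x \<le> (1 - y) * real p' + y * real q'"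
    (is "_ \<longleftrightarrow> ?R x y")
proof
  have le: "real p \<le> real p'" "real q \<le> real q'" using assms by auto
  have "strip p q p' q' \<subseteq> {z. 0 \<le> 0 * fst z + 1 * snd z} \<inter> {z. 0 * fst z + 1 * snd z \<le> 1} \<inter>
      {z. real p \<le> 1 * fst z + (real p - real q) * snd z} \<inter>
      {z. 1 * fst z + (real p' - real q') * snd z \<le> real p'}"
    unfolding strip_def by (intro hull_minimal convex_Int convex_half_planes) (use le in auto)
  moreover assume "(x, y) \<in> strip p q p' q'"
  ultimately show "?R x y" by (auto simp: algebra_simps)
next
  assume R: "?R x y"
  let ?H = "strip p q p' q'"
  define L where "L = (1 - y) * real p + y * real q"
  define U where "U = (1 - y) * real p' + y * real q'"
  have conv: "convex ?H" by (simp add: strip_def)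
  have v: "(real p, 0) \<in> ?H" "(real q, 1) \<in> ?H" "(real p', 0) \<in> ?H" "(real q', 1) \<in> ?H"
    unfolding strip_def by (rule hull_inc; simp)+
  have "(1 - y) *\<^sub>R (real p, 0) + y *\<^sub>R (real q, 1) \<in> ?H" "(1 - y) *\<^sub>R (real p', 0) + y *\<^sub>R (real q', 1) \<in> ?H"
    using R by (auto intro: convexD_alt[OF conv v(1,2)] convexD_alt[OF conv v(3,4)] simp del: scaleR_Pair)
  then have LU: "(L, y) \<in> ?H" "(U, y) \<in> ?H" by (simp_all add: L_def U_def)
  have "x \<in> closed_segment L U" using R by (auto simp: closed_segment_eq_real_ivl L_def U_def)
  then obtain s where s: "0 \<le> s" "s \<le> 1" "x = (1 - s) * L + s * U" by (auto simp: in_segment)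
  have "(1 - s) *\<^sub>R (L, y) + s *\<^sub>R (U, y) \<in> ?H" using s LU by (intro convexD_alt[OF conv]) auto
  moreover have "(1 - s) *\<^sub>R (L, y) + s *\<^sub>R (U, y) = (x, y)" by (simp add: s(3) algebra_simps)
  ultimately show "(x, y) \<in> ?H" by simp
qed

text \<open>Triangulations are built from left to right: \<open>p\<close> and \<open>q\<close> are the current points on the two rows, and
  everything to the left of the segment joining them is triangulated.  At the beginning there are no
  triangles while the strip is a segment, which accounts for the alternative in the covering condition.\<close>

definition sweep :: "supports \<Rightarrow> nat \<Rightarrow> nat \<Rightarrow> nat \<Rightarrow> nat \<Rightarrow> bool" where
  "sweep S p q E0 E1 \<longleftrightarrow> p \<in> A0 S \<and> q \<in> A1 S \<and> (\<exists>\<T>. finite \<T> \<and>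
     (\<forall>T\<in>\<T>. \<exists>C\<subseteq>cayley_points S. \<not> affine_dependent C \<and> card C = 3 \<and> T = convex hull C) \<and>
     (\<forall>T\<in>\<T>. \<forall>T'\<in>\<T>. T \<inter> T' face_of T) \<and>
     \<Union>\<T> \<subseteq> strip (Min (A0 S)) (Min (A1 S)) p q \<and>
     (p = Min (A0 S) \<and> q = Min (A1 S) \<or> strip (Min (A0 S)) (Min (A1 S)) p q \<subseteq> \<Union>\<T>) \<and>
     energy S 0 \<T> \<le> E0 \<and> energy S 1 \<T> \<le> E1)"

text \<open>A triangle determines its row, apex and base, so a new one contributes at most one summand.\<close>

lemma (in finite_supports) energy_insert:
  assumes h: "h = 0 \<or> h = 1" and bb: "b < b'"
  shows "energy S h (insert (tri h a b b') \<T>) \<le>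
      energy S h \<T> + (if a \<notin> nonselected S h then b' - b else 0)" (is ?A)
    and "energy S (1 - h) (insert (tri h a b b') \<T>) \<le> energy S (1 - h) \<T>" (is ?B)
proof -
  let ?X = "if a \<notin> nonselected S h then {(a, b, b')} else {}"
  have sub: "weighted_triples S h (insert (tri h a b b') \<T>) \<subseteq> weighted_triples S h \<T> \<union> ?X"
  proof
    fix t assume t: "t \<in> weighted_triples S h (insert (tri h a b b') \<T>)"
    obtain c d d' where cd: "t = (c, d, d')" by (cases t)
    have "c = a \<and> d = b \<and> d' = b'" if "tri h c d d' = tri h a b b'"
      using tri_inject[OF that h _ bb] t by (simp add: weighted_triples_def cd)
    then show "t \<in> weighted_triples S h \<T> \<union> ?X" using t by (auto simp: weighted_triples_def cd)
  qed
  have "energy S h (insert (tri h a b b') \<T>) \<le> (\<Sum>(a, b, b')\<in>weighted_triples S h \<T> \<union> ?X. b' - b)"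
    unfolding energy_def using finite_weighted_triples by (intro sum_mono2 sub) auto
  also have "\<dots> \<le> energy S h \<T> + (\<Sum>(a, b, b')\<in>?X. b' - b)"
  proof -
    have "finite (weighted_triples S h \<T>)" "finite ?X"
      using finite_weighted_triples by auto
    from sum.union_inter[OF this, of "\<lambda>(a, b, b'). b' - b"] show ?thesis
      unfolding energy_def by linarith
  qed
  finally show ?A by (auto split: if_splits)
  have "weighted_triples S (1 - h) (insert (tri h a b b') \<T>) \<subseteq> weighted_triples S (1 - h) \<T>"
  proof
    fix t assume t: "t \<in> weighted_triples S (1 - h) (insert (tri h a b b') \<T>)"
    obtain c d d' where cd: "t = (c, d, d')" by (cases t)
    have "tri (1 - h) c d d' \<noteq> tri h a b b'" using tri_distinct[OF _ h bb] by metis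
    then show "t \<in> weighted_triples S (1 - h) \<T>" using t by (auto simp: weighted_triples_def cd)
  qed
  then show ?B unfolding energy_def using finite_weighted_triples by (intro sum_mono2) auto
qed

lemma strip_mono:
  assumes "p0 \<le> p" "q0 \<le> q" "p \<le> p'" "q \<le> q'"
  shows "strip p0 q0 p' q' = strip p0 q0 p q \<union> strip p q p' q'"
proof (intro Set.set_eqI)
  fix z :: "real \<times> real"
  obtain x y where z: "z = (x, y)" by (cases z)
  have le: "real p0 \<le> real p" "real q0 \<le> real q" "real p \<le> real p'" "real q \<le> real q'" using assms by auto
  have "(1 - y) * real p0 + y * real q0 \<le> (1 - y) * real p + y * real q"
    "(1 - y) * real p + y * real q \<le> (1 - y) * real p' + y * real q'" if "0 \<le> y" "y \<le> 1"
    using le that by (auto intro!: add_mono mult_left_mono)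
  then show "z \<in> strip p0 q0 p' q' \<longleftrightarrow> z \<in> strip p0 q0 p q \<union> strip p q p' q'"
    unfolding z Un_iff using assms by (subst (1 2 3) mem_strip) auto
qed

text \<open>The old triangles lie on one side of the segment from \<open>p\<close> to \<open>q\<close> and the new one on the other, so
  they meet in this line.  The intersection is thus a face of the old triangle; its vertices are
  points of the rows on the line, that is, end points of the segment and hence vertices of the new one.\<close>

lemma glued_faces:
  fixes C :: "(real \<times> real) set"
  assumes C: "C = {(real p, 0), (real q, 1), (real p', 0), (real q', 1)}" "\<not> affine_dependent C"
    and le: "p0 \<le> p" "q0 \<le> q" "p \<le> p'" "q \<le> q'"
    and T: "C' \<subseteq> cayley_points S" "\<not> affine_dependent C'" "T = convex hull C'" "T \<subseteq> strip p0 q0 p q"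
  shows "T \<inter> strip p q p' q' face_of T" "T \<inter> strip p q p' q' face_of strip p q p' q'"
proof -
  let ?f = "\<lambda>z. 1 * fst z + (real p - real q) * snd z"
  have left: "?f z \<le> real p \<and> 0 \<le> snd z \<and> snd z \<le> 1" if "z \<in> T" for z
  proof -
    have "(fst z, snd z) \<in> strip p0 q0 p q" using T(4) that by auto
    then show ?thesis using le by (subst (asm) mem_strip) (auto simp: algebra_simps)
  qed
  have meet: "T \<inter> strip p q p' q' = T \<inter> {z. ?f z = real p}"
  proof (intro Set.set_eqI iffI)
    fix z assume z: "z \<in> T \<inter> strip p q p' q'"
    then have "(fst z, snd z) \<in> strip p q p' q'" by simp
    then have "real p \<le> ?f z" using le by (subst (asm) mem_strip) (auto simp: algebra_simps)
    then show "z \<in> T \<inter> {z. ?f z = real p}" using left[of z] z by auto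
  next
    fix z assume z: "z \<in> T \<inter> {z. ?f z = real p}"
    have "0 \<le> (1 - snd z) * (real p' - real p) + snd z * (real q' - real q)"
      using left[of z] z le by (intro add_nonneg_nonneg mult_nonneg_nonneg) auto
    then have "(fst z, snd z) \<in> strip p q p' q'"
      using left[of z] z le by (subst mem_strip) (auto simp: algebra_simps)
    then show "z \<in> T \<inter> strip p q p' q'" using z by simp
  qed
  have "T \<inter> {z. (1, real p - real q) \<bullet> z = real p} face_of T"
    by (rule face_of_Int_supporting_hyperplane_le) (use left T(3) in \<open>auto simp: inner_prod_def\<close>)
  then show face: "T \<inter> strip p q p' q' face_of T" unfolding meet by (simp add: inner_prod_def)
  then obtain c where c: "c \<subseteq> C'" "T \<inter> strip p q p' q' = convex hull c"
    using face_of_convex_hull_affine_independent[OF T(2)] unfolding T(3)[symmetric] by metis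
  have "c \<subseteq> C"
  proof
    fix z assume z: "z \<in> c"
    have "z \<in> T \<inter> {z. ?f z = real p}"
      unfolding meet[symmetric] c(2) using z by (rule hull_inc)
    moreover have "snd z = 0 \<or> snd z = 1" using z c(1) T(1) by (auto simp: cayley_points_def)
    ultimately have "z = (real p, 0) \<or> z = (real q, 1)" by (cases z) auto
    then show "z \<in> C" using C(1) by auto
  qed
  then show "T \<inter> strip p q p' q' face_of strip p q p' q'"
    using face_of_convex_hull_affine_independent[OF C(2)] c(2)
    unfolding strip_def C(1)[symmetric] by metis
qed

text \<open>The two kinds of steps, along row \<open>0\<close> and along row \<open>1\<close>, share everything except the bookkeeping of
  the energies, which therefore enters through hypotheses.\<close>

lemma (in finite_supports) sweep_step:
  assumes sw: "sweep S p q E0 E1"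
    and new: "p' \<in> A0 S" "q' \<in> A1 S" "p \<le> p'" "q \<le> q'"
    and C: "\<not> affine_dependent {(real p, 0), (real q, 1), (real p', 0), (real q', 1::real)}"
      "card {(real p, 0), (real q, 1), (real p', 0), (real q', 1::real)} = 3"
    and E: "\<And>\<T>. energy S 0 (insert (strip p q p' q') \<T>) \<le> energy S 0 \<T> + d0"
      "\<And>\<T>. energy S 1 (insert (strip p q p' q') \<T>) \<le> energy S 1 \<T> + d1"
  shows "sweep S p' q' (E0 + d0) (E1 + d1)"
proof -
  let ?p0 = "Min (A0 S)" and ?q0 = "Min (A1 S)" and ?T = "strip p q p' q'"
  let ?C = "{(real p, 0), (real q, 1), (real p', 0), (real q', 1::real)}"
  obtain \<T> where pq: "p \<in> A0 S" "q \<in> A1 S" and \<T>: "finite \<T>"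
    "\<And>T. T \<in> \<T> \<Longrightarrow> \<exists>C\<subseteq>cayley_points S. \<not> affine_dependent C \<and> card C = 3 \<and> T = convex hull C"
    "\<And>T T'. T \<in> \<T> \<Longrightarrow> T' \<in> \<T> \<Longrightarrow> T \<inter> T' face_of T"
    "\<Union>\<T> \<subseteq> strip ?p0 ?q0 p q"
    "p = ?p0 \<and> q = ?q0 \<or> strip ?p0 ?q0 p q \<subseteq> \<Union>\<T>"
    "energy S 0 \<T> \<le> E0" "energy S 1 \<T> \<le> E1"
    using sw unfolding sweep_def by (elim conjE exE) (rule that; simp)
  have "finite (A0 S)" "finite (A1 S)" using fin by (simp_all add: A0_def A1_def)
  then have le: "?p0 \<le> p" "?q0 \<le> q" using pq by (simp_all add: Min_le)
  have faces: "T \<inter> ?T face_of T \<and> T \<inter> ?T face_of ?T" if T: "T \<in> \<T>" for T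
  proof -
    obtain C' where C': "C' \<subseteq> cayley_points S" "\<not> affine_dependent C'" "T = convex hull C'"
      using \<T>(2)[OF T] by blast
    have sub: "T \<subseteq> strip ?p0 ?q0 p q" using \<T>(4) T by blast
    show ?thesis
      using glued_faces[OF refl C(1) le new(3,4) C' sub] by (rule conjI)
  qed
  have union: "strip ?p0 ?q0 p' q' = strip ?p0 ?q0 p q \<union> ?T" by (rule strip_mono[OF le new(3,4)])
  have start: "strip p q p q \<subseteq> ?T"
    unfolding strip_def by (rule hull_mono) auto
  let ?\<T> = "insert ?T \<T>"
  have "finite ?\<T>" using \<T>(1) by simp
  moreover have "\<exists>C\<subseteq>cayley_points S. \<not> affine_dependent C \<and> card C = 3 \<and> T = convex hull C"
    if "T \<in> ?\<T>" for T
  proof (cases "T = ?T")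
    case True
    have "?C \<subseteq> cayley_points S" using pq new(1,2) by (auto simp: cayley_points_def)
    then show ?thesis using C True unfolding strip_def by (intro exI[of _ ?C] conjI)
  next
    case False
    then show ?thesis using \<T>(2) that by blast
  qed
  moreover have "T \<inter> T' face_of T" if TT': "T \<in> ?\<T>" "T' \<in> ?\<T>" for T T'
  proof -
    have self: "?T face_of ?T" by (rule face_of_refl) (simp add: strip_def)
    consider "T = ?T" "T' = ?T" | "T = ?T" "T' \<in> \<T>" | "T \<in> \<T>" "T' = ?T" | "T \<in> \<T>" "T' \<in> \<T>"
      using TT' by blast
    then show ?thesis
    proof cases
      case 1
      show ?thesis unfolding 1 Int_absorb by (rule self)
    next
      case 2
      show ?thesis unfolding 2(1) using faces[OF 2(2)] by (subst Int_commute) (rule conjunct2)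
    next
      case 3
      show ?thesis unfolding 3(2) using faces[OF 3(1)] by (rule conjunct1)
    next
      case 4
      then show ?thesis by (rule \<T>(3))
    qed
  qed
  moreover have "\<Union>?\<T> \<subseteq> strip ?p0 ?q0 p' q'" using union \<T>(4) by auto
  moreover have "strip ?p0 ?q0 p' q' \<subseteq> \<Union>?\<T>"
    unfolding union using \<T>(5)
  proof (elim disjE conjE)
    assume eq: "p = ?p0" "q = ?q0"
    show "strip ?p0 ?q0 p q \<union> ?T \<subseteq> \<Union>?\<T>" using start unfolding eq by blast
  qed blast
  moreover have "energy S 0 ?\<T> \<le> E0 + d0" "energy S 1 ?\<T> \<le> E1 + d1"
    using E[of \<T>] \<T>(6,7) by linarith+
  ultimately show ?thesis unfolding sweep_def using new(1,2)
    by (intro conjI exI[of _ ?\<T>] ballI disjI2)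
qed

lemma (in finite_supports) sweep_row0:
  assumes sw: "sweep S p q E0 E1" and p': "p' \<in> A0 S" "p \<le> p'"
  shows "sweep S p' q E0 (E1 + (if q \<notin> S NumY then p' - p else 0))"
proof (cases "p = p'")
  case False
  then have pp: "p < p'" using p' by simp
  have T: "strip p q p' q = tri 1 q p p'" by (simp add: strip_def tri_def insert_commute)
  have C: "{(real p, 0), (real q, 1), (real p', 0), (real q, 1::real)} = {(real q, 1), (real p, 0), (real p', 0)}"
    by auto
  have "\<not> affine_dependent {(real q, 1::real), (real p, 0), (real p', 0)}"
    using pp by (intro not_collinear_two_rows) auto
  moreover have "card {(real q, 1::real), (real p, 0), (real p', 0)} = 3" using pp by simp
  moreover have "q \<in> A1 S" using sw by (simp add: sweep_def)
  moreover have "energy S 0 (insert (tri 1 q p p') \<T>) \<le> energy S 0 \<T> + 0"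
    "energy S 1 (insert (tri 1 q p p') \<T>) \<le> energy S 1 \<T> + (if q \<notin> S NumY then p' - p else 0)" for \<T>
    using energy_insert[where h = 1 and b = p and b' = p' and a = q] pp
    by (simp_all add: nonselected_def)
  ultimately have "sweep S p' q (E0 + 0) (E1 + (if q \<notin> S NumY then p' - p else 0))"
    by (intro sweep_step[OF sw]) (simp_all only: C T p' order_refl not_False_eq_True)
  then show ?thesis by simp
qed (use sw in simp)

lemma (in finite_supports) sweep_row1:
  assumes sw: "sweep S p q E0 E1" and q': "q' \<in> A1 S" "q \<le> q'"
  shows "sweep S p q' (E0 + (if p \<notin> S NumX then q' - q else 0)) E1"
proof (cases "q = q'")
  case False
  then have qq: "q < q'" using q' by simp
  have T: "strip p q p q' = tri 0 p q q'" by (simp add: strip_def tri_def insert_commute)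
  have C: "{(real p, 0), (real q, 1), (real p, 0), (real q', 1::real)} = {(real p, 0), (real q, 1), (real q', 1)}"
    by auto
  have "\<not> affine_dependent {(real p, 0::real), (real q, 1), (real q', 1)}"
    using qq by (intro not_collinear_two_rows) auto
  moreover have "card {(real p, 0::real), (real q, 1), (real q', 1)} = 3" using qq by simp
  moreover have "p \<in> A0 S" using sw by (simp add: sweep_def)
  moreover have "energy S 0 (insert (tri 0 p q q') \<T>) \<le> energy S 0 \<T> + (if p \<notin> S NumX then q' - q else 0)"
    "energy S 1 (insert (tri 0 p q q') \<T>) \<le> energy S 1 \<T> + 0" for \<T>
    using energy_insert[where h = 0 and b = q and b' = q' and a = p] qq
    by (simp_all add: nonselected_def)
  ultimately have "sweep S p q' (E0 + (if p \<notin> S NumX then q' - q else 0)) (E1 + 0)"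
    by (intro sweep_step[OF sw]) (simp_all only: C T q' order_refl not_False_eq_True)
  then show ?thesis by simp
qed (use sw in simp)

lemma (in finite_supports) sweep_start:
  shows "sweep S (Min (A0 S)) (Min (A1 S)) 0 0"
proof -
  have "Min (A0 S) \<in> A0 S" "Min (A1 S) \<in> A1 S"
    using Min_in[of "A0 S"] Min_in[of "A1 S"] fin ne by (simp_all add: A0_def A1_def)
  moreover have "energy S h {} = 0" for h
    by (simp add: energy_def weighted_triples_def case_prod_unfold)
  ultimately show ?thesis
    unfolding sweep_def by (intro conjI exI[of _ "{}"]) simp_all
qed

lemma (in finite_supports) sweep_end:
  assumes sw: "sweep S (Max (A0 S)) (Max (A1 S)) E0 E1" and lt: "Min (A0 S) < Max (A0 S)"
  shows "\<exists>\<T>\<in>triangulations S. energy S 0 \<T> \<le> E0 \<and> energy S 1 \<T> \<le> E1"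
proof -
  let ?s = "strip (Min (A0 S)) (Min (A1 S)) (Max (A0 S)) (Max (A1 S))"
  obtain \<T> where \<T>: "finite \<T>"
    "\<And>T. T \<in> \<T> \<Longrightarrow> \<exists>C\<subseteq>cayley_points S. \<not> affine_dependent C \<and> card C = 3 \<and> T = convex hull C"
    "\<And>T T'. T \<in> \<T> \<Longrightarrow> T' \<in> \<T> \<Longrightarrow> T \<inter> T' face_of T"
    "\<Union>\<T> \<subseteq> ?s" "?s \<subseteq> \<Union>\<T>" "energy S 0 \<T> \<le> E0" "energy S 1 \<T> \<le> E1"
    using sw unfolding sweep_def by (elim conjE exE) (rule that; use lt in force)
  have fin': "finite (A0 S)" "finite (A1 S)" "A0 S \<noteq> {}" "A1 S \<noteq> {}"
    using fin ne by (auto simp: A0_def A1_def)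
  have le: "Min (A0 S) \<le> Max (A0 S)" "Min (A1 S) \<le> Max (A1 S)" using fin' by auto
  have "cayley_points S \<subseteq> ?s"
    unfolding cayley_points_def using fin' by (auto simp: mem_strip[OF le])
  then have "convex hull cayley_points S \<subseteq> ?s" by (rule hull_minimal) (simp add: strip_def)
  moreover have "?s \<subseteq> convex hull cayley_points S"
    unfolding strip_def using fin' by (intro hull_mono) (auto simp: cayley_points_def)
  ultimately have union: "\<Union>\<T> = convex hull cayley_points S" using \<T>(4,5) by blast
  have simplex: "2 simplex T \<and> {v. v extreme_point_of T} \<subseteq> cayley_points S" if T: "T \<in> \<T>" for T
  proof -
    obtain C where C: "C \<subseteq> cayley_points S" "\<not> affine_dependent C" "card C = 3" "T = convex hull C"
      using \<T>(2)[OF T] by blast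
    then have "2 simplex T" unfolding simplex_def by (intro exI[of _ C]) simp
    then show ?thesis using C extreme_point_of_convex_hull_affine_independent[OF C(2)] by auto
  qed
  have "triangulation \<T>" unfolding triangulation_def using \<T>(1,3) simplex by blast
  then have "\<T> \<in> triangulations S" using union simplex by (simp add: triangulations_def)
  then show ?thesis using \<T>(6,7) by blast
qed

lemma Inf_nat_eqI:
  fixes X :: "nat set"
  assumes "x \<in> X" "x \<le> b" "\<And>y. y \<in> X \<Longrightarrow> b \<le> y"
  shows "Inf X = b"
  using assms by (intro antisym cInf_greatest order.trans[OF cInf_lower[OF assms(1)]]) auto

context finite_supports
begin

lemma finite_rows: "finite (A0 S)" "finite (A1 S)"
  by (simp_all add: A0_def A1_def fin)

lemma row_ends:
  "Min (A0 S) \<in> A0 S" "Max (A0 S) \<in> A0 S" "Min (A1 S) \<in> A1 S" "Max (A1 S) \<in> A1 S"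
proof -
  have "A0 S \<noteq> {}" "A1 S \<noteq> {}" using ne by (simp_all add: A0_def A1_def)
  then show "Min (A0 S) \<in> A0 S" "Max (A0 S) \<in> A0 S" "Min (A1 S) \<in> A1 S" "Max (A1 S) \<in> A1 S"
    using finite_rows by simp_all
qed

lemma support_ends: "Min (S s) \<in> S s" "Max (S s) \<in> S s" "Min (S s) \<le> Max (S s)"
  using fin[of s] ne[of s] by simp_all

lemma numerator_subset: "S NumX \<subseteq> A0 S" "S NumY \<subseteq> A1 S"
  by (auto simp: A0_def A1_def)

lemma numerator_range:
  "Min (A0 S) \<le> Min (S NumX)" "Max (S NumX) \<le> Max (A0 S)"
  "Min (A1 S) \<le> Min (S NumY)" "Max (S NumY) \<le> Max (A1 S)"
  using Min_antimono[OF numerator_subset(1) ne finite_rows(1)] Max_mono[OF numerator_subset(1) ne finite_rows(1)]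
    Min_antimono[OF numerator_subset(2) ne finite_rows(2)] Max_mono[OF numerator_subset(2) ne finite_rows(2)]
  by auto

lemma rows_nondegenerate:
  assumes sel: "selected0 S \<noteq> {}" "selected1 S \<noteq> {}"
  shows "Min (A0 S) < Max (A0 S)" "Min (A1 S) < Max (A1 S)"
proof -
  have *: "Min (N \<union> D) < Max (N \<union> D)" if "finite N" "finite D" "N \<noteq> {}" "D - N \<noteq> {}" for N D :: "nat set"
  proof -
    from that(3,4) obtain a b where ab: "a \<in> N" "b \<in> D - N" by blast
    then have "a \<noteq> b" by blast
    then have "a < b \<or> b < a" by linarith
    moreover have "Min (N \<union> D) \<le> a" "a \<le> Max (N \<union> D)" "Min (N \<union> D) \<le> b" "b \<le> Max (N \<union> D)"
      using that(1,2) ab by simp_all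
    ultimately show ?thesis by linarith
  qed
  show "Min (A0 S) < Max (A0 S)" "Min (A1 S) < Max (A1 S)"
    using *[OF fin fin ne] sel by (simp_all add: A0_def A1_def selected0_def selected1_def)
qed

text \<open>The sweep moves along row \<open>0\<close> to its first non-selected point, along row \<open>1\<close> to a non-selected point,
  along row \<open>0\<close> to its last non-selected point, along row \<open>1\<close> to the end and finally along row \<open>0\<close> to
  the end.  Only the first and the last move can have a selected apex.\<close>

lemma optimal_triangulation_rows0:
  assumes lt: "Min (A0 S) < Max (A0 S)"
  shows "\<exists>\<T>\<in>triangulations S. energy S 0 \<T> \<le> 0 \<and> energy S 1 \<T> \<le> corner_cost S 0"
proof -
  have mem: "Min (S NumX) \<in> A0 S" "Max (S NumX) \<in> A0 S" "Min (S NumY) \<in> A1 S"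
    using support_ends(1,2) numerator_subset by auto
  note row0 = sweep_row0 and row1 = sweep_row1
  have cost: "corner_cost S 0 = (if Min (A1 S) \<notin> S NumY then Min (S NumX) - Min (A0 S) else 0) +
      (if Max (A1 S) \<notin> S NumY then Max (A0 S) - Max (S NumX) else 0)"
    by (simp add: corner_cost_def row_points_def nonselected_def)
  have "sweep S (Max (A0 S)) (Max (A1 S)) 0 (corner_cost S 0)"
    unfolding cost using row0[OF row1[OF row0[OF row1[OF row0[OF sweep_start]]]],
        of "Min (S NumX)" "Min (S NumY)" "Max (S NumX)" "Max (A1 S)" "Max (A0 S)"]
      row_ends(2,4) support_ends numerator_range(1,2,3) mem order.trans[OF support_ends(3)[of NumY] numerator_range(4)]
    by (simp split del: if_split)
  then show ?thesis by (rule sweep_end[OF _ lt])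
qed

lemma optimal_triangulation_rows1:
  assumes lt: "Min (A0 S) < Max (A0 S)"
  shows "\<exists>\<T>\<in>triangulations S. energy S 0 \<T> \<le> corner_cost S 1 \<and> energy S 1 \<T> \<le> 0"
proof -
  have mem: "Min (S NumY) \<in> A1 S" "Max (S NumY) \<in> A1 S" "Min (S NumX) \<in> A0 S"
    using support_ends(1,2) numerator_subset by auto
  note row0 = sweep_row0 and row1 = sweep_row1
  have cost: "corner_cost S 1 = (if Min (A0 S) \<notin> S NumX then Min (S NumY) - Min (A1 S) else 0) +
      (if Max (A0 S) \<notin> S NumX then Max (A1 S) - Max (S NumY) else 0)"
    by (simp add: corner_cost_def row_points_def nonselected_def)
  have "sweep S (Max (A0 S)) (Max (A1 S)) (corner_cost S 1) 0"
    unfolding cost using row1[OF row0[OF row1[OF row0[OF row1[OF sweep_start]]]],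
        of "Min (S NumY)" "Min (S NumX)" "Max (S NumY)" "Max (A0 S)" "Max (A1 S)"]
      row_ends(2,4) support_ends numerator_range(1,3,4) mem order.trans[OF support_ends(3)[of NumX] numerator_range(2)]
    by (simp split del: if_split)
  then show ?thesis by (rule sweep_end[OF _ lt])
qed

text \<open>Both unconstrained minima are \<open>0\<close>, so the constrained minima range over the triangulations to which
  the lower bound applies.\<close>

theorem corner_ends:
  assumes sel: "selected0 S \<noteq> {}" "selected1 S \<noteq> {}"
  shows "e1_min_at_e0_min S = corner_cost S 0" "e0_min_at_e1_min S = corner_cost S 1"
proof -
  note lt = rows_nondegenerate[OF sel]
  obtain \<T>0 where T0: "\<T>0 \<in> triangulations S" "energy S 0 \<T>0 = 0" "energy S 1 \<T>0 \<le> corner_cost S 0"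
    using optimal_triangulation_rows0[OF lt(1)] by auto
  obtain \<T>1 where T1: "\<T>1 \<in> triangulations S" "energy S 1 \<T>1 = 0" "energy S 0 \<T>1 \<le> corner_cost S 1"
    using optimal_triangulation_rows1[OF lt(1)] by auto
  have min: "e0_min S = 0" "e1_min S = 0"
    unfolding e0_min_def e1_min_def e_eq_energy
    by (rule Inf_nat_eqI[of 0]; use T0(1,2) T1(1,2) in force)+
  show "e1_min_at_e0_min S = corner_cost S 0"
    unfolding e1_min_at_e0_min_def e_eq_energy min
  proof (rule Inf_nat_eqI)
    show "energy S 1 \<T>0 \<in> energy S 1 ` {\<T> \<in> triangulations S. energy S 0 \<T> = 0}" using T0 by blast
    show "corner_cost S 0 \<le> y" if "y \<in> energy S 1 ` {\<T> \<in> triangulations S. energy S 0 \<T> = 0}" for y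
      using corner_cost_lower_bound[where h = 0] lt that by (auto simp: row_points_def)
  qed (rule T0)
  show "e0_min_at_e1_min S = corner_cost S 1"
    unfolding e0_min_at_e1_min_def e_eq_energy min
  proof (rule Inf_nat_eqI)
    show "energy S 0 \<T>1 \<in> energy S 0 ` {\<T> \<in> triangulations S. energy S 1 \<T> = 0}" using T1 by blast
    show "corner_cost S 1 \<le> y" if "y \<in> energy S 0 ` {\<T> \<in> triangulations S. energy S 1 \<T> = 0}" for y
      using corner_cost_lower_bound[where h = 1] lt that by (auto simp: row_points_def)
  qed (rule T1)
qed

end

section \<open>Genericity in the coefficient torus\<close>

lemma finite_Sigma_supports:
  fixes S :: supports
  assumes "\<And>s. finite (S s)"
  shows "finite (Sigma UNIV S)"
proof -
  have "(UNIV :: slot set) = {NumX, DenX, NumY, DenY}"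
    using slot.exhaust by auto
  then have "finite (UNIV :: slot set)" by (metis finite.emptyI finite_insert)
  then show ?thesis using assms by auto
qed

lemma polynomial_functions_on_line:
  assumes "g \<in> polynomial_functions"
  shows "\<exists>p. \<forall>s. g (\<lambda>i. a i + s * b i) = poly p s"
  using assms
proof induction
  case (const z)
  show ?case by (rule exI[of _ "[:z:]"]) simp
next
  case (coord i)
  show ?case by (rule exI[of _ "[:a i, b i:]"]) simp
next
  case (add f g)
  then obtain p q where "\<forall>s. f (\<lambda>i. a i + s * b i) = poly p s"
    "\<forall>s. g (\<lambda>i. a i + s * b i) = poly q s" by blast
  then show ?case by (intro exI[of _ "p + q"]) simp
next
  case (mult f g)
  then obtain p q where "\<forall>s. f (\<lambda>i. a i + s * b i) = poly p s"
    "\<forall>s. g (\<lambda>i. a i + s * b i) = poly q s" by blast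
  then show ?case by (intro exI[of _ "p * q"]) simp
qed

text \<open>The coefficient torus is irreducible: on the line through the two given points, each of the
  finitely many conditions excludes only finitely many parameters.\<close>

lemma torus_common_nonzero:
  fixes S :: supports
  assumes fin: "\<And>s. finite (S s)"
    and g: "g \<in> polynomial_functions" and h: "h \<in> polynomial_functions"
    and c: "c \<in> coef_space S" "g c \<noteq> 0" and d: "d \<in> coef_space S" "h d \<noteq> 0"
  shows "\<exists>z\<in>coef_space S. g z \<noteq> 0 \<and> h z \<noteq> 0"
proof -
  define b where "b i = d i - c i" for i
  define l where "l s i = c i + s * b i" for s i
  obtain p where p: "\<And>s. g (l s) = poly p s"
    using polynomial_functions_on_line[OF g, of c b] unfolding l_def by blast
  obtain q where q: "\<And>s. h (l s) = poly q s"
    using polynomial_functions_on_line[OF h, of c b] unfolding l_def by blast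
  define r where "r = p * q * (\<Prod>i\<in>Sigma UNIV S. [:c i, b i:])"
  have ends: "l 0 = c" "l 1 = d" by (auto simp: l_def b_def)
  have "p \<noteq> 0" using p[of 0] c(2) ends by auto
  moreover have "q \<noteq> 0" using q[of 1] d(2) ends by auto
  moreover have "[:c i, b i:] \<noteq> 0" if "i \<in> Sigma UNIV S" for i
    using c(1) that by (auto simp: coef_space_def)
  ultimately have "r \<noteq> 0"
    unfolding r_def using finite_Sigma_supports[OF fin] by simp
  then have "finite {s. poly r s = 0}" by (rule poly_roots_finite)
  then obtain s where "poly r s \<noteq> 0"
    using ex_new_if_finite[OF infinite_UNIV_char_0] by blast
  then have s: "poly p s \<noteq> 0" "poly q s \<noteq> 0" "(\<Prod>i\<in>Sigma UNIV S. c i + s * b i) \<noteq> 0"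
    by (auto simp: r_def poly_prod)
  have "l s \<in> coef_space S"
  proof -
    have "c i + s * b i \<noteq> 0" if "i \<in> Sigma UNIV S" for i
      using s(3) finite_Sigma_supports[of S, OF fin] that by (cases i) simp
    moreover have "c i + s * b i = 0" if "i \<notin> Sigma UNIV S" for i
    proof -
      have "c i = 0" "d i = 0"
        using c(1) d(1) that unfolding coef_space_def by (metis (mono_tags, lifting) mem_Collect_eq)+
      then show ?thesis by (simp add: b_def)
    qed
    ultimately show ?thesis unfolding coef_space_def l_def by blast
  qed
  moreover have "g (l s) \<noteq> 0" "h (l s) \<noteq> 0" using s p q by simp_all
  ultimately show ?thesis by blast
qed

lemma polynomial_functions_nonzero_dense:
  fixes S :: supports
  assumes fin: "\<And>s. finite (S s)"
    and g: "g \<in> polynomial_functions" and c: "c \<in> coef_space S" "g c \<noteq> 0"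
  shows "generically S (\<lambda>z. z \<in> coef_space S \<and> g z \<noteq> 0)"
proof -
  let ?X = "subtopology zariski_topology (coef_space S)"
  let ?U = "{z \<in> coef_space S. g z \<noteq> 0}"
  have opn: "openin ?X T \<longleftrightarrow> (\<exists>H\<subseteq>polynomial_functions. T = {z \<in> coef_space S. \<exists>h\<in>H. h z \<noteq> 0})" for T
    unfolding openin_subtopology openin_zariski_topology zariski_open_def by blast
  have "zariski_open (UNIV :: coeffs set)"
    unfolding zariski_open_def
    by (rule exI[of _ "{\<lambda>_. 1}"]) (auto intro: polynomial_functions.const)
  then have top: "topspace ?X = coef_space S"
    using openin_subset[of zariski_topology UNIV] by (auto simp: openin_zariski_topology)
  have "openin ?X ?U"
    unfolding opn using g by (intro exI[of _ "{g}"]) auto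
  moreover have "?X closure_of ?U = coef_space S"
  proof (intro equalityI subsetI)
    fix x assume x: "x \<in> coef_space S"
    show "x \<in> ?X closure_of ?U"
      unfolding in_closure_of
    proof (intro conjI allI impI)
      fix T assume T: "x \<in> T \<and> openin ?X T"
      then obtain H where H: "H \<subseteq> polynomial_functions" "T = {z \<in> coef_space S. \<exists>h\<in>H. h z \<noteq> 0}"
        unfolding opn by blast
      then obtain h where h: "h \<in> H" "h x \<noteq> 0" using T by blast
      then have "h \<in> polynomial_functions" using H by blast
      from torus_common_nonzero[OF fin g this c x h(2)]
      show "\<exists>y. y \<in> ?U \<and> y \<in> T" using h H by blast
    qed (unfold top, rule x)
  next
    fix x assume "x \<in> ?X closure_of ?U"
    then show "x \<in> coef_space S" unfolding in_closure_of top by simp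
  qed
  moreover have "\<forall>z\<in>?U. z \<in> coef_space S \<and> g z \<noteq> 0" by simp
  ultimately show ?thesis unfolding generically_def by blast
qed

lemma generically_mono:
  assumes "generically S \<Phi>" "\<And>c. \<Phi> c \<Longrightarrow> \<Psi> c"
  shows "generically S \<Psi>"
  using assms unfolding generically_def by blast

section \<open>Sylvester determinants and Newton polygons\<close>

text \<open>The Newton polygon lies in the half plane \<open>\<alpha> i + \<beta> j \<ge> w\<close>.  Negative weights are allowed;
  they express degree bounds.\<close>

definition weight_ge :: "real \<Rightarrow> real \<Rightarrow> real \<Rightarrow> complex poly poly \<Rightarrow> bool" where
  "weight_ge \<alpha> \<beta> w F \<longleftrightarrow> (\<forall>i j. coeff (coeff F j) i \<noteq> 0 \<longrightarrow> w \<le> \<alpha> * real i + \<beta> * real j)"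

lemma weight_ge_0: "weight_ge \<alpha> \<beta> w 0"
  by (simp add: weight_ge_def)

lemma weight_ge_sum:
  assumes "\<And>p. p \<in> A \<Longrightarrow> weight_ge \<alpha> \<beta> w (F p)"
  shows "weight_ge \<alpha> \<beta> w (\<Sum>p\<in>A. F p)"
  unfolding weight_ge_def
proof (intro allI impI)
  fix i j assume "coeff (coeff (\<Sum>p\<in>A. F p) j) i \<noteq> 0"
  then have "(\<Sum>p\<in>A. coeff (coeff (F p) j) i) \<noteq> 0" by (simp add: coeff_sum)
  then obtain p where "p \<in> A" "coeff (coeff (F p) j) i \<noteq> 0"
    by (rule sum.not_neutral_contains_not_neutral)
  then show "w \<le> \<alpha> * real i + \<beta> * real j" using assms by (auto simp: weight_ge_def)
qed

lemma coeff_coeff_mult: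
  "coeff (coeff (F * G) j) i =
    (\<Sum>b\<le>j. \<Sum>a\<le>i. coeff (coeff F b) a * coeff (coeff G (j - b)) (i - a))"
  by (simp add: coeff_mult coeff_sum)

lemma weight_ge_mult:
  assumes F: "weight_ge \<alpha> \<beta> v F" and G: "weight_ge \<alpha> \<beta> w G"
  shows "weight_ge \<alpha> \<beta> (v + w) (F * G)"
  unfolding weight_ge_def
proof (intro allI impI)
  fix i j assume "coeff (coeff (F * G) j) i \<noteq> 0"
  then obtain b where b: "b \<le> j" and
      "(\<Sum>a\<le>i. coeff (coeff F b) a * coeff (coeff G (j - b)) (i - a)) \<noteq> 0"
    unfolding coeff_coeff_mult using sum.not_neutral_contains_not_neutral
    by (metis (no_types, lifting) atMost_iff)
  then obtain a where a: "a \<le> i" and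
      ne: "coeff (coeff F b) a * coeff (coeff G (j - b)) (i - a) \<noteq> 0"
    using sum.not_neutral_contains_not_neutral by (metis (no_types, lifting) atMost_iff)
  have "v \<le> \<alpha> * real a + \<beta> * real b" "w \<le> \<alpha> * real (i - a) + \<beta> * real (j - b)"
    using F G ne by (auto simp: weight_ge_def)
  then show "v + w \<le> \<alpha> * real i + \<beta> * real j"
    using a b by (simp add: of_nat_diff algebra_simps)
qed

lemma weight_ge_1: "weight_ge \<alpha> \<beta> 0 1"
  by (auto simp: weight_ge_def one_pCons coeff_pCons split: nat.splits)

lemma weight_ge_prod:
  assumes "finite A" "\<And>r. r \<in> A \<Longrightarrow> weight_ge \<alpha> \<beta> (w r) (F r)"
  shows "weight_ge \<alpha> \<beta> (\<Sum>r\<in>A. w r) (\<Prod>r\<in>A. F r)"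
  using assms
proof (induction A rule: finite_induct)
  case empty then show ?case by (simp add: weight_ge_1)
next
  case (insert a A) then show ?case by (simp add: weight_ge_mult)
qed

text \<open>The first \<open>m\<close> rows are shifts of the coefficient sequence \<open>a\<close>, the remaining \<open>n\<close> rows shifts of \<open>b\<close>.
  The formal degrees are fixed, so that leading coefficients may vanish under specialization.\<close>

definition sylvester_entry ::
  "nat \<Rightarrow> (nat \<Rightarrow> 'a::zero) \<Rightarrow> (nat \<Rightarrow> 'a) \<Rightarrow> nat \<Rightarrow> nat \<Rightarrow> 'a" where
  "sylvester_entry m a b r k =
     (if r < m then (if r \<le> k then a (k - r) else 0)
      else (if r - m \<le> k then b (k - (r - m)) else 0))"

definition sylvester_det ::
  "nat \<Rightarrow> nat \<Rightarrow> (nat \<Rightarrow> 'a::comm_ring_1) \<Rightarrow> (nat \<Rightarrow> 'a) \<Rightarrow> 'a" where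
  "sylvester_det m n a b = det (mat (m + n) (m + n) (\<lambda>(r, k). sylvester_entry m a b r k))"

lemma sylvester_det_Leibniz:
  "sylvester_det m n a b = (\<Sum>p | p permutes {0..<m+n}.
     signof p * (\<Prod>r = 0..<m+n. sylvester_entry m a b r (p r)))"
proof -
  have "(\<Prod>r = 0..<m+n. mat (m + n) (m + n) (\<lambda>(r, k). sylvester_entry m a b r k) $$ (r, p r)) =
        (\<Prod>r = 0..<m+n. sylvester_entry m a b r (p r))" if "p permutes {0..<m+n}" for p
    using permutes_in_image[OF that] by (intro prod.cong) auto
  then show ?thesis
    unfolding sylvester_det_def by (subst det_def'[of _ "m + n"]) auto
qed

lemma weight_ge_signof: "weight_ge \<alpha> \<beta> 0 (signof p)"
  using weight_ge_1[of \<alpha> \<beta>] by (auto simp: weight_ge_def sign_def)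

text \<open>A term of the Leibniz expansion meets every row and every column once, so weights given as
  a row part plus a column part add up to the same total for all permutations.\<close>

lemma weight_ge_sylvester_det:
  assumes "\<And>r k. r < m + n \<Longrightarrow> k < m + n \<Longrightarrow>
    weight_ge \<alpha> \<beta> (\<rho> r + \<kappa> k) (sylvester_entry m a b r k)"
  shows "weight_ge \<alpha> \<beta> ((\<Sum>r = 0..<m+n. \<rho> r) + (\<Sum>k = 0..<m+n. \<kappa> k)) (sylvester_det m n a b)"
  unfolding sylvester_det_Leibniz
proof (rule weight_ge_sum, clarify)
  fix p assume p: "p permutes {0..<m+n}"
  have "(\<Sum>r = 0..<m+n. \<rho> r) + (\<Sum>k = 0..<m+n. \<kappa> k) = (\<Sum>r = 0..<m+n. \<rho> r + \<kappa> (p r))"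
    using sum.permute[OF p, of \<kappa>] by (simp add: sum.distrib)
  moreover have "weight_ge \<alpha> \<beta> (\<Sum>r = 0..<m+n. \<rho> r + \<kappa> (p r))
      (\<Prod>r = 0..<m+n. sylvester_entry m a b r (p r))"
    using permutes_in_image[OF p] by (intro weight_ge_prod assms) auto
  ultimately show "weight_ge \<alpha> \<beta> ((\<Sum>r = 0..<m+n. \<rho> r) + (\<Sum>k = 0..<m+n. \<kappa> k))
      (signof p * (\<Prod>r = 0..<m+n. sylvester_entry m a b r (p r)))"
    using weight_ge_mult[OF weight_ge_signof] by fastforce
qed

lemma sum_rows_split:
  fixes f g :: "nat \<Rightarrow> 'a::comm_monoid_add"
  shows "(\<Sum>r = 0..<m+n. if r < m then f r else g (r - m)) = (\<Sum>i<m. f i) + (\<Sum>j<n. g j)"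
proof -
  have "(\<Sum>r = 0..<m+n. if r < m then f r else g (r - m)) =
        (\<Sum>r = 0..<m. if r < m then f r else g (r - m)) +
        (\<Sum>r = m..<m+n. if r < m then f r else g (r - m))"
    by (rule sum.atLeastLessThan_concat[symmetric]) auto
  also have "(\<Sum>r = m..<m+n. if r < m then f r else g (r - m)) = (\<Sum>j<n. g j)"
    by (rule sum.reindex_bij_witness[where j = "\<lambda>r. r - m" and i = "\<lambda>j. j + m"]) auto
  finally show ?thesis by (simp add: atLeast0LessThan)
qed

section \<open>The resultant of the curve\<close>

text \<open>The vector of powers of the common root is in the kernel of the matrix.\<close>

lemma sylvester_det_common_root:
  fixes a b :: "nat \<Rightarrow> complex"
  assumes "m + n > 0"
    and a: "\<And>l. n < l \<Longrightarrow> a l = 0" "(\<Sum>l\<le>n. a l * t ^ l) = 0"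
    and b: "\<And>l. m < l \<Longrightarrow> b l = 0" "(\<Sum>l\<le>m. b l * t ^ l) = 0"
  shows "sylvester_det m n a b = 0"
proof -
  have shift: "(\<Sum>k = 0..<m+n. (if r \<le> k then c (k - r) else 0) * t ^ k) = 0"
    if "r + d < m + n" and c: "\<And>l. d < l \<Longrightarrow> c l = 0" "(\<Sum>l\<le>d. c l * t ^ l) = 0"
    for r d and c :: "nat \<Rightarrow> complex"
  proof -
    have "(\<Sum>k = 0..<m+n. (if r \<le> k then c (k - r) else 0) * t ^ k) =
          (\<Sum>k\<in>(\<lambda>l. l + r) ` {..d}. (if r \<le> k then c (k - r) else 0) * t ^ k)"
    proof (rule sum.mono_neutral_right)
      show "\<forall>k\<in>{0..<m + n} - (\<lambda>l. l + r) ` {..d}. (if r \<le> k then c (k - r) else 0) * t ^ k = 0"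
      proof
        fix k assume k: "k \<in> {0..<m + n} - (\<lambda>l. l + r) ` {..d}"
        show "(if r \<le> k then c (k - r) else 0) * t ^ k = 0"
        proof (cases "r \<le> k")
          case True
          then have "k = (k - r) + r" by simp
          then have "k - r \<notin> {..d}" using k by blast
          then show ?thesis using c(1) by simp
        qed simp
      qed
    qed (use that(1) in auto)
    also have "\<dots> = (\<Sum>l\<le>d. c l * t ^ (l + r))"
      by (subst sum.reindex) (auto simp: inj_on_def)
    also have "\<dots> = (\<Sum>l\<le>d. c l * t ^ l) * t ^ r"
      by (simp add: sum_distrib_right power_add mult.assoc)
    finally show ?thesis using c(2) by simp
  qed
  let ?A = "mat (m + n) (m + n) (\<lambda>(r, k). sylvester_entry m a b r k)"
  let ?v = "Matrix.vec (m + n) (\<lambda>k. t ^ k)"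
  have "?A *\<^sub>v ?v = 0\<^sub>v (m + n)"
  proof (rule eq_vecI)
    fix r assume "r < dim_vec (0\<^sub>v (m + n) :: complex Matrix.vec)"
    then have r: "r < m + n" by simp
    have "vec_index (?A *\<^sub>v ?v) r = (\<Sum>k = 0..<m+n. sylvester_entry m a b r k * t ^ k)"
      using r by (auto simp: scalar_prod_def)
    also have "\<dots> = 0"
    proof (cases "r < m")
      case True
      then show ?thesis using shift[of r n a] a by (simp add: sylvester_entry_def)
    next
      case False
      then show ?thesis using shift[of "r - m" m b] b r by (simp add: sylvester_entry_def)
    qed
    finally show "vec_index (?A *\<^sub>v ?v) r = vec_index (0\<^sub>v (m + n)) r" using r by simp
  qed simp
  moreover have "?v \<noteq> 0\<^sub>v (m + n)"
  proof
    assume "?v = 0\<^sub>v (m + n)"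
    then have "vec_index ?v 0 = vec_index (0\<^sub>v (m + n)) 0" by simp
    then show False using assms(1) by simp
  qed
  moreover have "?v \<in> carrier_vec (m + n)" by simp
  ultimately show ?thesis
    unfolding sylvester_det_def using det_0_iff_vec_prod_zero[of ?A "m + n"] mat_carrier by blast
qed

lemma (in comm_ring_hom) hom_sylvester_det:
  "hom (sylvester_det m n a b) = sylvester_det m n (\<lambda>l. hom (a l)) (\<lambda>l. hom (b l))"
proof -
  have "map_mat hom (mat (m + n) (m + n) (\<lambda>(r, k). sylvester_entry m a b r k)) =
        mat (m + n) (m + n) (\<lambda>(r, k). sylvester_entry m (\<lambda>l. hom (a l)) (\<lambda>l. hom (b l)) r k)"
    by (rule eq_matI) (auto simp: sylvester_entry_def)
  then show ?thesis unfolding sylvester_det_def by (metis hom_det)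
qed

lemma comm_ring_hom_eval_xy: "comm_ring_hom (\<lambda>F. eval_xy F x y)"
  by unfold_locales (auto simp: eval_xy_def)

text \<open>The coefficient of \<open>t\<^sup>l\<close> in \<open>x Q\<^sub>0(t) - P\<^sub>0(t)\<close>.\<close>

definition curve_poly_x :: "coeffs \<Rightarrow> nat \<Rightarrow> complex poly poly" where
  "curve_poly_x c l = [:[:- c (NumX, l), c (DenX, l):]:]"

text \<open>The coefficient of \<open>t\<^sup>l\<close> in \<open>y Q\<^sub>1(t) - P\<^sub>1(t)\<close>.\<close>

definition curve_poly_y :: "coeffs \<Rightarrow> nat \<Rightarrow> complex poly poly" where
  "curve_poly_y c l = [:[:- c (NumY, l):], [:c (DenY, l):]:]"

definition curve_resultant :: "nat \<Rightarrow> nat \<Rightarrow> coeffs \<Rightarrow> complex poly poly" where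
  "curve_resultant m n c = sylvester_det m n (curve_poly_x c) (curve_poly_y c)"

lemma coef_space_zero_iff: "c \<in> coef_space S \<Longrightarrow> c (s, k) = 0 \<longleftrightarrow> k \<notin> S s"
  unfolding coef_space_def by (auto simp: set_eq_iff)

lemma coeff_slot_poly:
  assumes "finite (S s)" "c \<in> coef_space S"
  shows "coeff (slot_poly S c s) k = c (s, k)"
  using assms by (simp add: slot_poly_def coeff_sum coef_space_zero_iff)

lemma degree_slot_poly:
  assumes fin: "finite (S s)" and "S s \<noteq> {}" and c: "c \<in> coef_space S"
  shows "degree (slot_poly S c s) = Max (S s)"
proof (rule antisym)
  show "degree (slot_poly S c s) \<le> Max (S s)"
    by (rule degree_le) (use fin c in \<open>auto simp: coeff_slot_poly coef_space_zero_iff dest: Max_ge\<close>)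
  show "Max (S s) \<le> degree (slot_poly S c s)"
    by (rule le_degree) (use assms in \<open>simp add: coeff_slot_poly coef_space_zero_iff\<close>)
qed

lemma poly_slot_poly:
  assumes "finite (S s)" "c \<in> coef_space S" "\<And>k. k \<in> S s \<Longrightarrow> k \<le> d"
  shows "poly (slot_poly S c s) t = (\<Sum>k\<le>d. c (s, k) * t ^ k)"
proof -
  have "poly (slot_poly S c s) t = (\<Sum>k\<in>S s. c (s, k) * t ^ k)"
    by (simp add: slot_poly_def poly_sum poly_monom)
  also have "\<dots> = (\<Sum>k\<le>d. c (s, k) * t ^ k)"
    using assms by (intro sum.mono_neutral_left) (auto simp: coef_space_zero_iff)
  finally show ?thesis .
qed

lemma pencil_root:
  assumes fin: "\<And>s. finite (S s)" and c: "c \<in> coef_space S"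
    and z: "z = poly (slot_poly S c N) t / poly (slot_poly S c D) t" "poly (slot_poly S c D) t \<noteq> 0"
  shows "Max (S N \<union> S D) < l \<Longrightarrow> z * c (D, l) - c (N, l) = 0"
    and "(\<Sum>l\<le>Max (S N \<union> S D). (z * c (D, l) - c (N, l)) * t ^ l) = 0"
proof -
  have le: "k \<le> Max (S N \<union> S D)" if "k \<in> S N \<union> S D" for k using fin that by (intro Max_ge) auto
  show "z * c (D, l) - c (N, l) = 0" if "Max (S N \<union> S D) < l"
    using le[of l] that coef_space_zero_iff[OF c, of N l] coef_space_zero_iff[OF c, of D l] by auto
  have "(\<Sum>l\<le>Max (S N \<union> S D). (z * c (D, l) - c (N, l)) * t ^ l) =
      z * poly (slot_poly S c D) t - poly (slot_poly S c N) t"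
    using poly_slot_poly[of S N c _ t, OF fin c le] poly_slot_poly[of S D c _ t, OF fin c le]
    by (simp add: algebra_simps sum_subtractf sum_distrib_left)
  then show "(\<Sum>l\<le>Max (S N \<union> S D). (z * c (D, l) - c (N, l)) * t ^ l) = 0" using z by simp
qed

lemma curve_resultant_in_vanishing_ideal:
  assumes fin: "\<And>s. finite (S s)" and c: "c \<in> coef_space S"
    and n: "n = Max (A0 S)" and m: "m = Max (A1 S)" and pos: "m + n > 0"
  shows "curve_resultant m n c \<in> vanishing_ideal
    (slot_poly S c NumX) (slot_poly S c DenX) (slot_poly S c NumY) (slot_poly S c DenY)"
  unfolding vanishing_ideal_def
proof (intro CollectI ballI)
  fix t assume t: "t \<in> param_dom (slot_poly S c DenX) (slot_poly S c DenY)"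
  define x where "x = poly (slot_poly S c NumX) t / poly (slot_poly S c DenX) t"
  define y where "y = poly (slot_poly S c NumY) t / poly (slot_poly S c DenY) t"
  interpret comm_ring_hom "\<lambda>F. eval_xy F x y" by (rule comm_ring_hom_eval_xy)
  have "eval_xy (curve_poly_x c l) x y = x * c (DenX, l) - c (NumX, l)"
    "eval_xy (curve_poly_y c l) x y = y * c (DenY, l) - c (NumY, l)" for l
    by (simp_all add: eval_xy_def curve_poly_x_def curve_poly_y_def)
  then have "eval_xy (curve_resultant m n c) x y = 0"
    unfolding curve_resultant_def hom_sylvester_det n m A0_def A1_def
    using pencil_root[of S c x NumX t DenX, OF fin c x_def] pencil_root[of S c y NumY t DenY, OF fin c y_def]
      t pos[unfolded n m A0_def A1_def]
    by (intro sylvester_det_common_root) (simp_all add: param_dom_def)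
  then show "eval_xy (curve_resultant m n c)
     (poly (slot_poly S c NumX) t / poly (slot_poly S c DenX) t)
     (poly (slot_poly S c NumY) t / poly (slot_poly S c DenY) t) = 0"
    by (simp add: x_def y_def)
qed

lemma weight_ge_curve_poly_x:
  assumes "c (NumX, l) \<noteq> 0 \<Longrightarrow> w \<le> 0" "c (DenX, l) \<noteq> 0 \<Longrightarrow> w \<le> \<alpha>"
  shows "weight_ge \<alpha> \<beta> w (curve_poly_x c l)"
  using assms by (auto simp: weight_ge_def curve_poly_x_def coeff_pCons split: nat.splits)

lemma weight_ge_curve_poly_y:
  assumes "c (NumY, l) \<noteq> 0 \<Longrightarrow> w \<le> 0" "c (DenY, l) \<noteq> 0 \<Longrightarrow> w \<le> \<beta>"
  shows "weight_ge \<alpha> \<beta> w (curve_poly_y c l)"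
  using assms by (auto simp: weight_ge_def curve_poly_y_def coeff_pCons split: nat.splits)

text \<open>The weight bound with \<open>\<alpha> = 0\<close>, \<open>\<beta> = -1\<close>: the \<open>n\<close> rows of the second polynomial have degree one in \<open>y\<close>.\<close>

lemma curve_resultant_degree_y: "degree (curve_resultant m n c) \<le> n"
proof (rule degree_le, intro allI impI)
  fix j assume j: "n < j"
  let ?\<rho> = "\<lambda>r. if r < m then 0 else - 1 :: real"
  have "weight_ge 0 (- 1) ((\<Sum>r = 0..<m+n. ?\<rho> r) + (\<Sum>k = 0..<m+n. 0)) (curve_resultant m n c)"
    unfolding curve_resultant_def
    by (rule weight_ge_sylvester_det)
      (auto simp: sylvester_entry_def weight_ge_0 intro: weight_ge_curve_poly_x weight_ge_curve_poly_y)
  moreover have "(\<Sum>r = 0..<m+n. ?\<rho> r) = - real n"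
    using sum_rows_split[where f = "\<lambda>_. 0" and g = "\<lambda>_. - 1 :: real"] by simp
  ultimately have "weight_ge 0 (- 1) (- real n) (curve_resultant m n c)" by simp
  then have "coeff (coeff (curve_resultant m n c) j) i = 0" for i
    using j unfolding weight_ge_def by fastforce
  then show "coeff (curve_resultant m n c) j = 0" by (simp add: poly_eq_iff)
qed

lemma curve_resultant_degree_x: "degree (coeff (curve_resultant m n c) j) \<le> m"
proof (rule degree_le, intro allI impI)
  fix i assume i: "m < i"
  let ?\<rho> = "\<lambda>r. if r < m then - 1 else 0 :: real"
  have "weight_ge (- 1) 0 ((\<Sum>r = 0..<m+n. ?\<rho> r) + (\<Sum>k = 0..<m+n. 0)) (curve_resultant m n c)"
    unfolding curve_resultant_def
    by (rule weight_ge_sylvester_det)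
      (auto simp: sylvester_entry_def weight_ge_0 intro: weight_ge_curve_poly_x weight_ge_curve_poly_y)
  moreover have "(\<Sum>r = 0..<m+n. ?\<rho> r) = - real m"
    using sum_rows_split[where f = "\<lambda>_. - 1 :: real" and g = "\<lambda>_. 0"] by simp
  ultimately have "weight_ge (- 1) 0 (- real m) (curve_resultant m n c)" by simp
  then show "coeff (coeff (curve_resultant m n c) j) i = 0"
    using i unfolding weight_ge_def by fastforce
qed

definition polynomial_coeffs :: "(coeffs \<Rightarrow> complex poly poly) \<Rightarrow> bool" where
  "polynomial_coeffs F \<longleftrightarrow> (\<forall>i j. (\<lambda>c. coeff (coeff (F c) j) i) \<in> polynomial_functions)"

lemma polynomial_functions_sum:
  assumes "\<And>a. a \<in> A \<Longrightarrow> f a \<in> polynomial_functions"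
  shows "(\<lambda>c. \<Sum>a\<in>A. f a c) \<in> polynomial_functions"
  using assms
proof (induction A rule: infinite_finite_induct)
  case (insert a A)
  then have "(\<lambda>c. f a c + (\<Sum>a\<in>A. f a c)) \<in> polynomial_functions"
    by (intro polynomial_functions.add) auto
  then show ?case using insert.hyps by simp
qed (auto intro: polynomial_functions.const)

lemma polynomial_coeffs_const: "polynomial_coeffs (\<lambda>_. G)"
  by (simp add: polynomial_coeffs_def polynomial_functions.const)

lemma polynomial_coeffs_sum:
  assumes "\<And>p. p \<in> A \<Longrightarrow> polynomial_coeffs (F p)"
  shows "polynomial_coeffs (\<lambda>c. \<Sum>p\<in>A. F p c)"
  using assms unfolding polynomial_coeffs_def coeff_sum
  by (intro allI polynomial_functions_sum) blast

lemma polynomial_coeffs_mult: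
  assumes "polynomial_coeffs F" "polynomial_coeffs G"
  shows "polynomial_coeffs (\<lambda>c. F c * G c)"
  using assms unfolding polynomial_coeffs_def coeff_coeff_mult
  by (intro allI polynomial_functions_sum polynomial_functions.mult) auto

lemma polynomial_coeffs_prod:
  assumes "\<And>r. r \<in> A \<Longrightarrow> polynomial_coeffs (F r)"
  shows "polynomial_coeffs (\<lambda>c. \<Prod>r\<in>A. F r c)"
  using assms
proof (induction A rule: infinite_finite_induct)
  case (insert a A)
  then have "polynomial_coeffs (\<lambda>c. F a c * (\<Prod>r\<in>A. F r c))"
    by (intro polynomial_coeffs_mult) auto
  then show ?case using insert.hyps by simp
qed (auto intro: polynomial_coeffs_const)

lemma polynomial_functions_uminus_coord: "(\<lambda>c. - c i) \<in> polynomial_functions"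
  using polynomial_functions.mult[OF polynomial_functions.const[of "- 1"] polynomial_functions.coord[of i]]
  by simp

lemma polynomial_coeffs_curve_poly:
  "polynomial_coeffs (\<lambda>c. curve_poly_x c l)" "polynomial_coeffs (\<lambda>c. curve_poly_y c l)"
proof -
  note simps = polynomial_functions.const polynomial_functions.coord polynomial_functions_uminus_coord
  have "(\<lambda>c. coeff (coeff (curve_poly_x c l) j) i) \<in> polynomial_functions" for i j
    unfolding curve_poly_x_def by (cases j; cases i; cases "i - 1") (simp_all add: simps)
  then show "polynomial_coeffs (\<lambda>c. curve_poly_x c l)" by (simp add: polynomial_coeffs_def)
  have "(\<lambda>c. coeff (coeff (curve_poly_y c l) j) i) \<in> polynomial_functions" for i j
    unfolding curve_poly_y_def by (cases j; cases "j - 1"; cases i) (simp_all add: simps)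
  then show "polynomial_coeffs (\<lambda>c. curve_poly_y c l)" by (simp add: polynomial_coeffs_def)
qed

lemma polynomial_coeffs_curve_resultant: "polynomial_coeffs (curve_resultant m n)"
proof -
  have "polynomial_coeffs (\<lambda>c. sylvester_entry m (curve_poly_x c) (curve_poly_y c) r k)" for r k
    unfolding sylvester_entry_def
    by (cases "r < m"; cases "r \<le> k"; cases "r - m \<le> k")
      (simp_all add: polynomial_coeffs_curve_poly polynomial_coeffs_const)
  then have "polynomial_coeffs (\<lambda>c. curve_resultant m n c)"
    unfolding curve_resultant_def sylvester_det_Leibniz
    by (intro polynomial_coeffs_sum polynomial_coeffs_mult polynomial_coeffs_const polynomial_coeffs_prod)
  then show ?thesis .
qed

section \<open>Half planes containing the Newton polygon of the resultant\<close>

lemma sum_nat_diff_triangle: "v \<le> N \<Longrightarrow> 2 * (\<Sum>k<N. real (v - k)) = real v * (real v + 1)"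
proof (induction N arbitrary: v)
  case (Suc N)
  show ?case
  proof (cases v)
    case (Suc w)
    then have "2 * (\<Sum>k<N. real (w - k)) = real w * (real w + 1)" using Suc.IH Suc.prems by simp
    then show ?thesis unfolding sum.lessThan_Suc_shift Suc by (simp add: algebra_simps)
  qed simp
qed simp

text \<open>The sum of the row and column weights at one entry: the differences of positive parts telescope to the
  order of the coefficient of \<open>t\<^sup>l\<close>.  Since \<open>u + u' \<le> N\<close>, at most one of the two ends contributes to it.\<close>

lemma weight_potential:
  fixes \<gamma> \<gamma>' \<alpha> :: real
  assumes nonneg: "0 \<le> \<gamma>" "0 \<le> \<gamma>'" and le: "\<gamma> * real u \<le> \<alpha>" "\<gamma>' * real u' \<le> \<alpha>"
    and size: "u + u' \<le> N" "i < M" "l \<le> N"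
  defines "w \<equiv> \<gamma> * real (u - l) + \<gamma>' * real (u' - (N - l))"
  shows "\<gamma> * real (u + v - (i + l)) + \<gamma>' * real (u' + v' - (M + N - Suc (i + l)))
      - \<gamma> * real (v - i) - \<gamma>' * real (v' - (M - Suc i)) \<le> w" and "w \<le> \<alpha>"
proof -
  have "real (u + v - (i + l)) - real (v - i) \<le> real (u - l)"
    "real (u' + v' - (M + N - Suc (i + l))) - real (v' - (M - Suc i)) \<le> real (u' - (N - l))"
    using size by linarith+
  then have "\<gamma> * (real (u + v - (i + l)) - real (v - i)) \<le> \<gamma> * real (u - l)"
    "\<gamma>' * (real (u' + v' - (M + N - Suc (i + l))) - real (v' - (M - Suc i))) \<le> \<gamma>' * real (u' - (N - l))"
    using nonneg by (auto intro: mult_left_mono)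
  then show "\<gamma> * real (u + v - (i + l)) + \<gamma>' * real (u' + v' - (M + N - Suc (i + l)))
      - \<gamma> * real (v - i) - \<gamma>' * real (v' - (M - Suc i)) \<le> w"
    unfolding w_def by (simp add: right_diff_distrib)
  show "w \<le> \<alpha>"
  proof (cases "l < u")
    case True
    then have "u' - (N - l) = 0" using size by simp
    moreover have "\<gamma> * real (u - l) \<le> \<gamma> * real u" using nonneg by (intro mult_left_mono) auto
    ultimately show ?thesis using le by (simp add: w_def)
  next
    case False
    moreover have "\<gamma>' * real (u' - (N - l)) \<le> \<gamma>' * real u'" using nonneg by (intro mult_left_mono) auto
    ultimately show ?thesis using le by (simp add: w_def)
  qed
qed

text \<open>Substitute \<open>s\<^sup>\<alpha> x\<close> and \<open>s\<^sup>\<beta> y\<close> for \<open>x\<close> and \<open>y\<close>, and \<open>s\<^sup>\<gamma> t\<close> for \<open>t\<close>.  The coefficients of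
  \<open>t\<^sup>l\<close> with \<open>l < u\<^sub>0\<close> in the first polynomial are multiples of \<open>x\<close> and acquire order at least
  \<open>\<alpha> \<ge> \<gamma> u\<^sub>0\<close>, hence at least \<open>\<gamma> (u\<^sub>0 - l)\<close>, and similarly for the second.  As weights of rows and columns, the positive
  parts \<open>u\<^sub>0 + v\<^sub>0 - k\<close>, \<open>v\<^sub>0 - i\<close> and \<open>u\<^sub>0 - j\<close> sum to triangular numbers whose combination is \<open>u\<^sub>0 v\<^sub>0\<close>.
  The end \<open>t = \<infinity>\<close> is treated in the same way with the exponents reversed.\<close>

theorem curve_resultant_weight:
  assumes nonneg: "0 \<le> \<alpha>" "0 \<le> \<beta>" "0 \<le> \<gamma>" "0 \<le> \<gamma>'"
    and left: "\<gamma> * real u0 \<le> \<alpha>" "\<gamma> * real v0 \<le> \<beta>"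
    and right: "\<gamma>' * real u1 \<le> \<alpha>" "\<gamma>' * real v1 \<le> \<beta>"
    and size: "u0 + u1 \<le> n" "v0 + v1 \<le> m"
    and zero: "\<And>l. n < l \<Longrightarrow> c (NumX, l) = 0" "\<And>l. n < l \<Longrightarrow> c (DenX, l) = 0"
      "\<And>l. m < l \<Longrightarrow> c (NumY, l) = 0" "\<And>l. m < l \<Longrightarrow> c (DenY, l) = 0"
    and zx: "\<And>l. c (NumX, l) \<noteq> 0 \<Longrightarrow> u0 \<le> l \<and> l + u1 \<le> n"
    and zy: "\<And>l. c (NumY, l) \<noteq> 0 \<Longrightarrow> v0 \<le> l \<and> l + v1 \<le> m"
  shows "weight_ge \<alpha> \<beta> (\<gamma> * real u0 * real v0 + \<gamma>' * real u1 * real v1) (curve_resultant m n c)"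
proof -
  \<comment> \<open>columns carry the weight \<open>\<kappa>\<close>, the two kinds of rows carry \<open>f\<close> and \<open>g\<close>\<close>
  define \<kappa> where "\<kappa> k = \<gamma> * real (u0 + v0 - k) + \<gamma>' * real (u1 + v1 - (m + n - Suc k))" for k
  define f where "f i = - \<gamma> * real (v0 - i) - \<gamma>' * real (v1 - (m - Suc i))" for i
  define g where "g j = - \<gamma> * real (u0 - j) - \<gamma>' * real (u1 - (n - Suc j))" for j
  define \<rho> where "\<rho> r = (if r < m then f r else g (r - m))" for r
  have entry: "weight_ge \<alpha> \<beta> (\<rho> r + \<kappa> k) (sylvester_entry m (curve_poly_x c) (curve_poly_y c) r k)"
    if r: "r < m + n" and k: "k < m + n" for r k
  proof (cases "r < m")
    case True
    show ?thesis
    proof (cases "r \<le> k \<and> k - r \<le> n")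
      case rk: True
      define l where "l = k - r"
      have k: "k = r + l" "l \<le> n" using rk by (auto simp: l_def)
      have 1: "\<rho> r + \<kappa> k \<le> \<gamma> * real (u0 - l) + \<gamma>' * real (u1 - (n - l))"
        using weight_potential(1)[where i = r and v = v0 and v' = v1, OF nonneg(3,4) left(1) right(1) size(1) True k(2)] True
        unfolding \<rho>_def \<kappa>_def f_def k(1) by simp
      have 2: "\<gamma> * real (u0 - l) + \<gamma>' * real (u1 - (n - l)) \<le> \<alpha>"
        by (rule weight_potential(2)[OF nonneg(3,4) left(1) right(1) size(1) True k(2)])
      have "weight_ge \<alpha> \<beta> (\<rho> r + \<kappa> k) (curve_poly_x c l)"
      proof (rule weight_ge_curve_poly_x)
        assume "c (NumX, l) \<noteq> 0"
        then have "u0 - l = 0" "u1 - (n - l) = 0" using zx[of l] by auto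
        then show "\<rho> r + \<kappa> k \<le> 0" using 1 by simp
      qed (use 1 2 in linarith)
      then show ?thesis using True rk by (simp add: sylvester_entry_def l_def)
    next
      case False
      then have "sylvester_entry m (curve_poly_x c) (curve_poly_y c) r k = 0"
        using True zero by (auto simp: sylvester_entry_def curve_poly_x_def)
      then show ?thesis by (simp add: weight_ge_0)
    qed
  next
    case False
    define j where "j = r - m"
    have jn: "j < n" using r False by (auto simp: j_def)
    show ?thesis
    proof (cases "j \<le> k \<and> k - j \<le> m")
      case rk: True
      define l where "l = k - j"
      have k: "k = j + l" "l \<le> m" using rk by (auto simp: l_def)
      have 1: "\<rho> r + \<kappa> k \<le> \<gamma> * real (v0 - l) + \<gamma>' * real (v1 - (m - l))"
        using weight_potential(1)[where i = j and v = u0 and v' = u1, OF nonneg(3,4) left(2) right(2) size(2) jn k(2)] False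
        unfolding \<rho>_def \<kappa>_def g_def k(1) by (simp add: j_def[symmetric] add.commute)
      have 2: "\<gamma> * real (v0 - l) + \<gamma>' * real (v1 - (m - l)) \<le> \<beta>"
        by (rule weight_potential(2)[OF nonneg(3,4) left(2) right(2) size(2) jn k(2)])
      have "weight_ge \<alpha> \<beta> (\<rho> r + \<kappa> k) (curve_poly_y c l)"
      proof (rule weight_ge_curve_poly_y)
        assume "c (NumY, l) \<noteq> 0"
        then have "v0 - l = 0" "v1 - (m - l) = 0" using zy[of l] by auto
        then show "\<rho> r + \<kappa> k \<le> 0" using 1 by simp
      qed (use 1 2 in linarith)
      then show ?thesis using False rk by (simp add: sylvester_entry_def l_def j_def)
    next
      case F: False
      then have "sylvester_entry m (curve_poly_x c) (curve_poly_y c) r k = 0"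
        using False zero by (auto simp: sylvester_entry_def curve_poly_y_def j_def)
      then show ?thesis by (simp add: weight_ge_0)
    qed
  qed
  have "(\<Sum>r = 0..<m+n. \<rho> r) = (\<Sum>i<m. f i) + (\<Sum>j<n. g j)"
    unfolding \<rho>_def by (rule sum_rows_split)
  moreover have "(\<Sum>i<m. f i) = - \<gamma> * (\<Sum>i<m. real (v0 - i)) - \<gamma>' * (\<Sum>i<m. real (v1 - i))"
    unfolding f_def sum_subtractf sum_distrib_left
    using sum.nat_diff_reindex[of "\<lambda>i. \<gamma>' * real (v1 - i)" m] by simp
  moreover have "(\<Sum>j<n. g j) = - \<gamma> * (\<Sum>j<n. real (u0 - j)) - \<gamma>' * (\<Sum>j<n. real (u1 - j))"
    unfolding g_def sum_subtractf sum_distrib_left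
    using sum.nat_diff_reindex[of "\<lambda>i. \<gamma>' * real (u1 - i)" n] by simp
  moreover have "(\<Sum>k = 0..<m+n. \<kappa> k) =
      \<gamma> * (\<Sum>k<m+n. real (u0 + v0 - k)) + \<gamma>' * (\<Sum>k<m+n. real (u1 + v1 - k))"
    unfolding \<kappa>_def sum.distrib sum_distrib_left atLeast0LessThan
    using sum.nat_diff_reindex[of "\<lambda>i. \<gamma>' * real (u1 + v1 - i)" "m + n"] by simp
  ultimately have "2 * ((\<Sum>r = 0..<m+n. \<rho> r) + (\<Sum>k = 0..<m+n. \<kappa> k)) =
      \<gamma> * (2 * (\<Sum>k<m+n. real (u0 + v0 - k)) - 2 * (\<Sum>i<m. real (v0 - i)) - 2 * (\<Sum>j<n. real (u0 - j))) +
      \<gamma>' * (2 * (\<Sum>k<m+n. real (u1 + v1 - k)) - 2 * (\<Sum>i<m. real (v1 - i)) - 2 * (\<Sum>j<n. real (u1 - j)))"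
    by (simp add: algebra_simps)
  also have "\<dots> = 2 * (\<gamma> * real u0 * real v0 + \<gamma>' * real u1 * real v1)"
    using size by (subst sum_nat_diff_triangle, simp)+ (simp add: algebra_simps)
  finally have total: "(\<Sum>r = 0..<m+n. \<rho> r) + (\<Sum>k = 0..<m+n. \<kappa> k) =
      \<gamma> * real u0 * real v0 + \<gamma>' * real u1 * real v1" by simp
  have "weight_ge \<alpha> \<beta> ((\<Sum>r = 0..<m+n. \<rho> r) + (\<Sum>k = 0..<m+n. \<kappa> k)) (curve_resultant m n c)"
    unfolding curve_resultant_def by (rule weight_ge_sylvester_det) (rule entry)
  then show ?thesis by (simp only: total)
qed

section \<open>Extreme monomials from lattice paths\<close>

text \<open>An extremal principle; its equality case serves to recognize initial segments of a path.\<close>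

lemma sum_of_distinct_naturals:
  fixes X :: "nat set"
  assumes "finite X"
  shows "\<Sum>{..<card X} \<le> \<Sum>X" and "\<Sum>X = \<Sum>{..<card X} \<Longrightarrow> X = {..<card X}"
proof -
  have "\<Sum>{..<card X} \<le> \<Sum>X \<and> (\<Sum>X = \<Sum>{..<card X} \<longrightarrow> X = {..<card X})"
    using assms
  proof (induction "card X" arbitrary: X)
    case (Suc k)
    define M where "M = Max X"
    have ne: "X \<noteq> {}" using Suc.hyps(2) by auto
    have M: "M \<in> X" "\<And>x. x \<in> X \<Longrightarrow> x \<le> M" using Suc.prems ne by (auto simp: M_def)
    define Y where "Y = X - {M}"
    have Y: "card Y = k" "finite Y" using Suc.hyps(2) Suc.prems M(1) by (auto simp: Y_def)
    have sX: "\<Sum>X = M + \<Sum>Y" using Suc.prems M(1) by (simp add: Y_def sum.remove)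
    have "X \<subseteq> {..M}" using M(2) by auto
    then have "card X \<le> Suc M" by (metis card_mono finite_atMost card_atMost)
    then have kM: "k \<le> M" using Suc.hyps(2) by simp
    have IH: "\<Sum>{..<k} \<le> \<Sum>Y" "\<Sum>Y = \<Sum>{..<k} \<Longrightarrow> Y = {..<k}"
      using Suc.hyps(1)[of Y] Y by auto
    show ?case
    proof (intro conjI impI)
      show "\<Sum>{..<card X} \<le> \<Sum>X" unfolding Suc.hyps(2)[symmetric] sX using IH(1) kM by simp
      assume "\<Sum>X = \<Sum>{..<card X}"
      then have "M + \<Sum>Y = k + \<Sum>{..<k}" unfolding Suc.hyps(2)[symmetric] sX by simp
      then have "M = k" "\<Sum>Y = \<Sum>{..<k}" using IH(1) kM by auto
      moreover have "X = insert M Y" using M(1) by (auto simp: Y_def)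
      ultimately show "X = {..<card X}"
        unfolding Suc.hyps(2)[symmetric] using IH(2) by (simp add: lessThan_Suc)
    qed
  qed auto
  then show "\<Sum>{..<card X} \<le> \<Sum>X" "\<Sum>X = \<Sum>{..<card X} \<Longrightarrow> X = {..<card X}" by auto
qed

text \<open>A monotone lattice path from \<open>(0, 0)\<close> to \<open>(n, m)\<close>: its vertical unit step at height \<open>i\<close> is taken
  at abscissa \<open>\<rho> i\<close>, its horizontal unit step at abscissa \<open>j\<close> at height \<open>\<sigma> j\<close>.  The two
  descriptions agree by \<open>dual\<close>.  The vertical step is the step number \<open>i + \<rho> i\<close> of the path and
  the horizontal one the step number \<open>j + \<sigma> j\<close>, counting from \<open>0\<close>.\<close>

locale staircase =
  fixes m n :: nat and \<rho> \<sigma> :: "nat \<Rightarrow> nat"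
  assumes mono_\<rho>: "\<And>i i'. i \<le> i' \<Longrightarrow> i' < m \<Longrightarrow> \<rho> i \<le> \<rho> i'"
    and mono_\<sigma>: "\<And>j j'. j \<le> j' \<Longrightarrow> j' < n \<Longrightarrow> \<sigma> j \<le> \<sigma> j'"
    and \<rho>_le: "\<And>i. i < m \<Longrightarrow> \<rho> i \<le> n" and \<sigma>_le: "\<And>j. j < n \<Longrightarrow> \<sigma> j \<le> m"
    and dual: "\<And>i j. i < m \<Longrightarrow> j < n \<Longrightarrow> j < \<rho> i \<longleftrightarrow> \<sigma> j \<le> i"
begin

definition lift_x :: "nat \<Rightarrow> nat" where "lift_x p = (\<Sum>j<p. j + \<sigma> j)"
definition lift_y :: "nat \<Rightarrow> nat" where "lift_y q = (\<Sum>i<q. i + \<rho> i)"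

lemma step_x_less: "j < j' \<Longrightarrow> j' < n \<Longrightarrow> j + \<sigma> j < j' + \<sigma> j'"
  using mono_\<sigma>[of j j'] by simp

lemma step_y_less: "i < i' \<Longrightarrow> i' < m \<Longrightarrow> i + \<rho> i < i' + \<rho> i'"
  using mono_\<rho>[of i i'] by simp

lemma steps_disjoint: "i < m \<Longrightarrow> j < n \<Longrightarrow> i + \<rho> i \<noteq> j + \<sigma> j"
  using dual[of i j] by linarith

lemma inj_steps_x: "p \<le> n \<Longrightarrow> inj_on (\<lambda>j. j + \<sigma> j) {..<p}"
proof (rule linorder_inj_onI)
  fix x y assume "p \<le> n" "x < y" "y \<in> {..<p}"
  then show "x + \<sigma> x \<noteq> y + \<sigma> y" using step_x_less[of x y] by simp
qed auto

lemma inj_steps_y: "q \<le> m \<Longrightarrow> inj_on (\<lambda>i. i + \<rho> i) {..<q}"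
proof (rule linorder_inj_onI)
  fix x y assume "q \<le> m" "x < y" "y \<in> {..<q}"
  then show "x + \<rho> x \<noteq> y + \<rho> y" using step_y_less[of x y] by simp
qed auto

definition steps :: "nat \<Rightarrow> nat \<Rightarrow> nat set" where
  "steps p q = (\<lambda>j. j + \<sigma> j) ` {..<p} \<union> (\<lambda>i. i + \<rho> i) ` {..<q}"

lemma steps_properties:
  assumes "p \<le> n" "q \<le> m"
  shows "finite (steps p q)" "card (steps p q) = p + q" "\<Sum>(steps p q) = lift_x p + lift_y q"
proof -
  have dis: "(\<lambda>j. j + \<sigma> j) ` {..<p} \<inter> (\<lambda>i. i + \<rho> i) ` {..<q} = {}"
  proof (intro equals0I, elim IntE imageE)
    fix x j i assume "x = j + \<sigma> j" "j \<in> {..<p}" "x = i + \<rho> i" "i \<in> {..<q}"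
    then show False using steps_disjoint[of i j] assms by simp
  qed
  show "finite (steps p q)" by (simp add: steps_def)
  show "card (steps p q) = p + q"
    unfolding steps_def using dis inj_steps_x inj_steps_y assms
    by (simp add: card_Un_disjoint card_image)
  show "\<Sum>(steps p q) = lift_x p + lift_y q"
    unfolding steps_def using dis inj_steps_x inj_steps_y assms
    by (simp add: sum.union_disjoint sum.reindex lift_x_def lift_y_def)
qed

lemma double_sum_lessThan: "2 * \<Sum>{..<k} + k = k ^ 2" for k :: nat
  by (induction k) (auto simp: power2_eq_square)

text \<open>The numbers of the first \<open>p\<close> horizontal and the first \<open>i\<close> vertical steps are \<open>i + p\<close> distinct naturals
  with sum \<open>lift_x p + lift_y i\<close>, and one more vertical step gives \<open>i + p + 1\<close> of them.  Adding the
  two extremal bounds gives the square.  Equality means that both sets are initial segments, so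
  that the next step of the path after the first \<open>i + p\<close> is the vertical one at height \<open>i\<close>.\<close>

lemma lift_row_x:
  assumes i: "i < m" and p: "p \<le> n"
  shows "(i + p) ^ 2 \<le> 2 * lift_x p + lift_y i + lift_y (Suc i)"
    and "(i + p) ^ 2 = 2 * lift_x p + lift_y i + lift_y (Suc i) \<longleftrightarrow> p = \<rho> i"
proof -
  let ?X = "steps p i" and ?Y = "steps p (Suc i)"
  have X: "finite ?X" "card ?X = i + p" "\<Sum>?X = lift_x p + lift_y i"
    using steps_properties[of p i] i p by auto
  have Y: "finite ?Y" "card ?Y = Suc (i + p)" "\<Sum>?Y = lift_x p + lift_y (Suc i)"
    using steps_properties[of p "Suc i"] i p by auto
  have sq: "(i + p)\<^sup>2 = \<Sum>{..<i + p} + \<Sum>{..<Suc (i + p)}"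
    using double_sum_lessThan[of "i + p"] by simp
  have le: "\<Sum>{..<i + p} \<le> \<Sum>?X" "\<Sum>{..<Suc (i + p)} \<le> \<Sum>?Y"
    using sum_of_distinct_naturals(1)[OF X(1)] sum_of_distinct_naturals(1)[OF Y(1)] X Y by auto
  show "(i + p) ^ 2 \<le> 2 * lift_x p + lift_y i + lift_y (Suc i)"
    using le X(3) Y(3) sq by linarith
  show "(i + p) ^ 2 = 2 * lift_x p + lift_y i + lift_y (Suc i) \<longleftrightarrow> p = \<rho> i"
  proof
    assume "(i + p) ^ 2 = 2 * lift_x p + lift_y i + lift_y (Suc i)"
    then have "\<Sum>?X = \<Sum>{..<card ?X}" "\<Sum>?Y = \<Sum>{..<card ?Y}"
      using le sq unfolding X(2,3) Y(2,3) by linarith+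
    then have "?X = {..<card ?X}" "?Y = {..<card ?Y}"
      using sum_of_distinct_naturals(2)[OF X(1)] sum_of_distinct_naturals(2)[OF Y(1)] by blast+
    then have "?X = {..<i + p}" "?Y = {..<Suc (i + p)}"
      unfolding X(2) Y(2) .
    moreover have "?Y = insert (i + \<rho> i) ?X" by (auto simp: steps_def lessThan_Suc)
    ultimately have "{..<Suc (i + p)} = insert (i + \<rho> i) {..<i + p}" by simp
    then have "i + p \<in> insert (i + \<rho> i) {..<i + p}" by blast
    then show "p = \<rho> i" by simp
  next
    assume p: "p = \<rho> i"
    have "?X \<subseteq> {..<i + p}"
    proof
      fix x assume "x \<in> ?X"
      then consider j where "j < p" "x = j + \<sigma> j" | i' where "i' < i" "x = i' + \<rho> i'"
        by (auto simp: steps_def)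
      then show "x \<in> {..<i + p}"
      proof cases
        case 1
        then have "\<sigma> j \<le> i" using dual[of i j] i p assms(2) by auto
        then show ?thesis using 1 by simp
      next
        case 2
        then show ?thesis using step_y_less[of i' i] i p by simp
      qed
    qed
    then have eq: "?X = {..<i + p}" using X(2) by (intro card_subset_eq) auto
    have "?Y = insert (i + \<rho> i) ?X" by (auto simp: steps_def lessThan_Suc)
    also have "\<dots> = {..<Suc (i + p)}" unfolding eq unfolding p lessThan_Suc add_Suc_right by (rule refl)
    finally have eq': "?Y = {..<Suc (i + p)}" .
    then show "(i + p) ^ 2 = 2 * lift_x p + lift_y i + lift_y (Suc i)"
      using X(3) Y(3) unfolding eq eq' sq by linarith
  qed
qed

lemma dual_staircase: "staircase n m \<sigma> \<rho>"
proof
  fix j i assume "j < n" "i < m"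
  then show "i < \<sigma> j \<longleftrightarrow> \<rho> i \<le> j" using dual[of i j] by auto
qed (use mono_\<rho> mono_\<sigma> \<rho>_le \<sigma>_le in auto)

lemma lift_row_y:
  assumes "j < n" "q \<le> m"
  shows "(j + q) ^ 2 \<le> 2 * lift_y q + lift_x j + lift_x (Suc j)"
    and "(j + q) ^ 2 = 2 * lift_y q + lift_x j + lift_x (Suc j) \<longleftrightarrow> q = \<sigma> j"
proof -
  interpret d: staircase n m \<sigma> \<rho> by (rule dual_staircase)
  have [simp]: "d.lift_x = lift_y" "d.lift_y = lift_x"
    by (auto simp: fun_eq_iff d.lift_x_def d.lift_y_def lift_x_def lift_y_def)
  show "(j + q) ^ 2 \<le> 2 * lift_y q + lift_x j + lift_x (Suc j)"
    "(j + q) ^ 2 = 2 * lift_y q + lift_x j + lift_x (Suc j) \<longleftrightarrow> q = \<sigma> j"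
    using d.lift_row_x[OF assms] by simp_all
qed

definition path :: "nat \<Rightarrow> nat" where
  "path r = (if r < m then r + \<rho> r else if r < m + n then r - m + \<sigma> (r - m) else r)"

lemma path_permutes: "path permutes {0..<m+n}"
proof (rule bij_imp_permutes)
  have "inj_on path {0..<m+n}"
  proof (rule linorder_inj_onI)
    fix r s assume rs: "r < s" "r \<in> {0..<m+n}" "s \<in> {0..<m+n}"
    consider "s < m" | "r < m" "m \<le> s" | "m \<le> r" by linarith
    then show "path r \<noteq> path s"
    proof cases
      case 1
      then show ?thesis using rs step_y_less[of r s] by (simp add: path_def)
    next
      case 2
      then show ?thesis using rs steps_disjoint[of r "s - m"] by (simp add: path_def)
    next
      case 3
      then have "r - m < s - m" "s - m < n" using rs by auto
      from step_x_less[OF this] show ?thesis using 3 rs by (simp add: path_def)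
    qed
  qed auto
  moreover have "path ` {0..<m+n} \<subseteq> {0..<m+n}"
  proof (clarify)
    fix r assume r: "r \<in> {0..<m+n}"
    show "path r \<in> {0..<m+n}"
    proof (cases "r < m")
      case True
      then show ?thesis using \<rho>_le[of r] by (simp add: path_def)
    next
      case False
      then have "path r = r - m + \<sigma> (r - m)" "r - m < n" using r by (auto simp: path_def)
      moreover from this have "\<sigma> (r - m) \<le> m" using \<sigma>_le by blast
      ultimately show ?thesis by simp
    qed
  qed
  ultimately show "bij_betw path {0..<m+n} {0..<m+n}"
    by (metis bij_betw_def card_image card_subset_eq finite_atLeastLessThan)
qed (auto simp: path_def)

end

text \<open>The monomial \<open>x\<^sup>i y\<^sup>j\<close> divides \<open>F\<close> and occurs in it.\<close>

definition lowest_monomial :: "complex poly poly \<Rightarrow> nat \<Rightarrow> nat \<Rightarrow> bool" where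
  "lowest_monomial F i j \<longleftrightarrow> (\<exists>G. F = monom (monom 1 i) j * G \<and> coeff (coeff G 0) 0 \<noteq> 0)"

lemma lowest_monomial_mult:
  assumes "lowest_monomial F i j" "lowest_monomial G i' j'"
  shows "lowest_monomial (F * G) (i + i') (j + j')"
proof -
  obtain F' G' where F': "F = monom (monom 1 i) j * F'" "coeff (coeff F' 0) 0 \<noteq> 0"
    and G': "G = monom (monom 1 i') j' * G'" "coeff (coeff G' 0) 0 \<noteq> 0"
    using assms unfolding lowest_monomial_def by blast
  have "monom (monom (1::complex) (i + i')) (j + j') = monom (monom 1 i) j * monom (monom 1 i') j'"
    by (simp add: mult_monom)
  then have "F * G = monom (monom 1 (i + i')) (j + j') * (F' * G')"
    by (simp only: F' G' ac_simps)
  moreover have "coeff (coeff (F' * G') 0) 0 \<noteq> 0"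
    using F' G' by (simp add: coeff_mult_0)
  ultimately show ?thesis unfolding lowest_monomial_def by blast
qed

lemma lowest_monomial_prod:
  assumes "finite A" "\<And>r. r \<in> A \<Longrightarrow> lowest_monomial (F r) (i r) (j r)"
  shows "lowest_monomial (\<Prod>r\<in>A. F r) (\<Sum>r\<in>A. i r) (\<Sum>r\<in>A. j r)"
  using assms
proof (induction A rule: finite_induct)
  case empty
  show ?case unfolding lowest_monomial_def
    by (rule exI[of _ 1]) (simp add: monom_0 one_pCons[symmetric])
next
  case (insert a A)
  then show ?case by (simp add: lowest_monomial_mult)
qed

lemma lowest_monomial_nonzero: "lowest_monomial F i j \<Longrightarrow> coeff (coeff F j) i \<noteq> 0"
  unfolding lowest_monomial_def by (auto simp: coeff_monom_mult)

text \<open>The one-parameter family along which the coefficients degenerate: powers of \<open>s\<close> with prescribed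
  exponents.\<close>

definition torus_point :: "supports \<Rightarrow> (nat \<Rightarrow> nat) \<Rightarrow> (nat \<Rightarrow> nat) \<Rightarrow> complex \<Rightarrow> coeffs" where
  "torus_point S \<omega>x \<omega>y s = (\<lambda>(q, l). if l \<notin> S q then 0
     else s ^ (if q = NumX \<or> q = DenX then \<omega>x l else \<omega>y l))"

lemma torus_point_in_coef_space: "s \<noteq> 0 \<Longrightarrow> torus_point S \<omega>x \<omega>y s \<in> coef_space S"
  by (auto simp: coef_space_def torus_point_def split: if_splits)

lemma curve_poly_torus_point:
  "curve_poly_x (torus_point S \<omega>x \<omega>y s) l =
     Polynomial.smult [:s ^ \<omega>x l:] (curve_poly_x (torus_point S \<omega>x \<omega>y 1) l)"
  "curve_poly_y (torus_point S \<omega>x \<omega>y s) l =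
     Polynomial.smult [:s ^ \<omega>y l:] (curve_poly_y (torus_point S \<omega>x \<omega>y 1) l)"
  by (auto simp: curve_poly_x_def curve_poly_y_def torus_point_def)

lemma lowest_monomial_curve_poly_x:
  assumes "l \<in> S NumX \<union> S DenX"
  shows "lowest_monomial (curve_poly_x (torus_point S \<omega>x \<omega>y 1) l) (of_bool (l \<notin> S NumX)) 0"
proof (cases "l \<in> S NumX")
  case True
  then show ?thesis unfolding lowest_monomial_def
    by (intro exI[of _ "curve_poly_x (torus_point S \<omega>x \<omega>y 1) l"])
      (auto simp: curve_poly_x_def torus_point_def monom_0)
next
  case False
  then show ?thesis unfolding lowest_monomial_def using assms
    by (intro exI[of _ 1])
      (auto simp: curve_poly_x_def torus_point_def monom_0 monom_Suc)
qed

lemma lowest_monomial_curve_poly_y: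
  assumes "l \<in> S NumY \<union> S DenY"
  shows "lowest_monomial (curve_poly_y (torus_point S \<omega>x \<omega>y 1) l) 0 (of_bool (l \<notin> S NumY))"
proof (cases "l \<in> S NumY")
  case True
  then show ?thesis unfolding lowest_monomial_def
    by (intro exI[of _ "curve_poly_y (torus_point S \<omega>x \<omega>y 1) l"])
      (auto simp: curve_poly_y_def torus_point_def monom_0 one_pCons[symmetric])
next
  case False
  then show ?thesis unfolding lowest_monomial_def using assms
    by (intro exI[of _ 1])
      (auto simp: curve_poly_y_def torus_point_def monom_0 monom_Suc one_pCons)
qed

text \<open>Along the family with exponents \<open>lift_x\<close> and \<open>lift_y\<close>, the term of a permutation in the Leibniz
  expansion is a power of \<open>s\<close> times its value at \<open>s = 1\<close>.  By the two bounds on the liftings, the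
  permutation of the path has the strictly smallest exponent.  Its entries lie on the
  path, so its lowest monomial has one factor \<open>x\<close> or \<open>y\<close> for each selected exponent; the coefficient of
  this monomial cannot be cancelled.\<close>

lemma (in staircase) curve_resultant_vertex:
  assumes S: "\<And>l. l \<in> S NumX \<union> S DenX \<Longrightarrow> l \<le> n" "\<And>l. l \<in> S NumY \<union> S DenY \<Longrightarrow> l \<le> m"
    and \<rho>: "\<And>i. i < m \<Longrightarrow> \<rho> i \<in> S NumX \<union> S DenX"
    and \<sigma>: "\<And>j. j < n \<Longrightarrow> \<sigma> j \<in> S NumY \<union> S DenY"
  shows "\<exists>c\<in>coef_space S. coeff (coeff (curve_resultant m n c)
           (\<Sum>j<n. of_bool (\<sigma> j \<notin> S NumY))) (\<Sum>i<m. of_bool (\<rho> i \<notin> S NumX)) \<noteq> 0"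
proof -
  define i0 :: nat where "i0 = (\<Sum>i<m. of_bool (\<rho> i \<notin> S NumX))"
  define j0 :: nat where "j0 = (\<Sum>j<n. of_bool (\<sigma> j \<notin> S NumY))"
  define c where "c = torus_point S lift_x lift_y"
  define entry where "entry s = sylvester_entry m (curve_poly_x (c s)) (curve_poly_y (c s))" for s
  \<comment> \<open>exponent of \<open>s\<close> in an entry, and the row part of the quadratic lower bound for it\<close>
  define wt where "wt r k = (if r < m then lift_x (k - r) else lift_y (k - (r - m)))" for r k
  define pot where "pot r = (if r < m then lift_y r + lift_y (Suc r)
     else lift_x (r - m) + lift_x (Suc (r - m)))" for r
  define E where "E p = (\<Sum>r = 0..<m+n. wt r (p r))" for p
  define K where "K p = coeff (coeff (signof p * (\<Prod>r = 0..<m+n. entry 1 r (p r))) j0) i0" for p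
  have entry_scale: "entry s r k = Polynomial.smult [:s ^ wt r k:] (entry 1 r k)" for s r k
    unfolding entry_def wt_def c_def sylvester_entry_def
    using curve_poly_torus_point[of S lift_x lift_y s] by auto
  have summand: "coeff (coeff (signof p * (\<Prod>r = 0..<m+n. entry s r (p r))) j0) i0 = K p * s ^ E p" for p s
  proof -
    have "(\<Prod>r = 0..<m+n. entry s r (p r)) =
        (\<Prod>r = 0..<m+n. [:[:s ^ wt r (p r):]:] * entry 1 r (p r))"
      by (subst entry_scale) simp
    also have "\<dots> = (\<Prod>r = 0..<m+n. [:[:s ^ wt r (p r):]:]) * (\<Prod>r = 0..<m+n. entry 1 r (p r))"
      by (rule prod.distrib)
    also have "(\<Prod>r\<in>A. [:[:s ^ wt r (p r):]:]) = [:[:s ^ (\<Sum>r\<in>A. wt r (p r)):]:]" if "finite A" for A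
      using that by (induction A rule: finite_induct) (auto simp: one_pCons power_add)
    finally have "(\<Prod>r = 0..<m+n. entry s r (p r)) =
        Polynomial.smult [:s ^ E p:] (\<Prod>r = 0..<m+n. entry 1 r (p r))"
      by (simp add: E_def)
    then show ?thesis by (simp add: K_def)
  qed
  \<comment> \<open>the coefficient under consideration, as a polynomial in \<open>s\<close>\<close>
  define Q where "Q = (\<Sum>p | p permutes {0..<m+n}. monom (K p) (E p))"
  have Q: "coeff (coeff (curve_resultant m n (c s)) j0) i0 = poly Q s" for s
    unfolding curve_resultant_def sylvester_det_Leibniz Q_def
    using summand[of _ s] by (simp add: coeff_sum poly_sum poly_monom entry_def)
  have zero: "c 1 (q, l) = 0" if "l \<notin> S q" for q l using that by (simp add: c_def torus_point_def)
  have row: "(p r)\<^sup>2 \<le> 2 * wt r (p r) + pot r \<and>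
      ((p r)\<^sup>2 = 2 * wt r (p r) + pot r \<longleftrightarrow> p r = path r)"
    if r: "r < m + n" and ne: "entry 1 r (p r) \<noteq> 0" for p r
  proof (cases "r < m")
    case True
    with ne have rp: "r \<le> p r" and "curve_poly_x (c 1) (p r - r) \<noteq> 0"
      by (auto simp: entry_def sylvester_entry_def split: if_splits)
    then have "p r - r \<le> n"
      using S(1)[of "p r - r"] zero by (auto simp: curve_poly_x_def)
    from lift_row_x[OF True this] rp True show ?thesis
      by (auto simp: wt_def pot_def path_def)
  next
    case False
    define j where "j = r - m"
    have j: "j < n" "r = m + j" using r False by (auto simp: j_def)
    from ne False have rp: "j \<le> p r" and "curve_poly_y (c 1) (p r - j) \<noteq> 0"
      by (auto simp: entry_def sylvester_entry_def j_def split: if_splits)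
    then have "p r - j \<le> m"
      using S(2)[of "p r - j"] zero by (auto simp: curve_poly_y_def)
    from lift_row_y[OF j(1) this] rp False j show ?thesis
      by (auto simp: wt_def pot_def path_def j_def[symmetric])
  qed
  \<comment> \<open>the squares of the column indices have the same sum for every permutation\<close>
  have sq: "(\<Sum>r = 0..<m+n. (p r)\<^sup>2) = (\<Sum>r = 0..<m+n. r\<^sup>2)" if "p permutes {0..<m+n}" for p
    using sum.permute[OF that, of "\<lambda>r. r\<^sup>2"] by (simp add: o_def)
  have low: "lowest_monomial (entry 1 r (path r))
      (if r < m then of_bool (\<rho> r \<notin> S NumX) else 0)
      (if r < m then 0 else of_bool (\<sigma> (r - m) \<notin> S NumY))" if r: "r \<in> {0..<m+n}" for r
  proof (cases "r < m")
    case True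
    then show ?thesis
      using lowest_monomial_curve_poly_x[OF \<rho>[OF True], where \<omega>x = lift_x and \<omega>y = lift_y]
      by (simp add: entry_def sylvester_entry_def path_def c_def)
  next
    case False
    then obtain j where j: "r = m + j" "j < n" using r by (auto simp: not_less le_iff_add)
    show ?thesis
      using lowest_monomial_curve_poly_y[OF \<sigma>[OF j(2)], where \<omega>x = lift_x and \<omega>y = lift_y] j
      by (simp add: entry_def sylvester_entry_def path_def c_def)
  qed
  have "lowest_monomial (\<Prod>r = 0..<m+n. entry 1 r (path r))
      (\<Sum>r = 0..<m+n. if r < m then of_bool (\<rho> r \<notin> S NumX) else 0)
      (\<Sum>r = 0..<m+n. if r < m then 0 else of_bool (\<sigma> (r - m) \<notin> S NumY))"
    by (rule lowest_monomial_prod[OF _ low]) auto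
  then have "lowest_monomial (\<Prod>r = 0..<m+n. entry 1 r (path r)) i0 j0"
    by (simp add: sum_rows_split[where f = "\<lambda>_. 0" and g = "\<lambda>j. of_bool (\<sigma> j \<notin> S NumY)"] sum_rows_split[where g = "\<lambda>_. 0"] i0_def j0_def)
  then have nz: "coeff (coeff (\<Prod>r = 0..<m+n. entry 1 r (path r)) j0) i0 \<noteq> 0"
    by (rule lowest_monomial_nonzero)
  have Kp: "K path \<noteq> 0" using nz by (auto simp: K_def sign_def)
  have entry_path: "entry 1 r (path r) \<noteq> 0" if "r \<in> {0..<m+n}" for r
    using nz that by (metis coeff_0 finite_atLeastLessThan prod_zero)
  have "2 * E path + (\<Sum>r = 0..<m+n. pot r) = (\<Sum>r = 0..<m+n. r\<^sup>2)"
    unfolding E_def sum_distrib_left sum.distrib[symmetric] sq[OF path_permutes, symmetric]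
    using row[of _ path] entry_path by (intro sum.cong) auto
  moreover have "2 * E p + (\<Sum>r = 0..<m+n. pot r) > (\<Sum>r = 0..<m+n. r\<^sup>2)"
    if p: "p permutes {0..<m+n}" "K p \<noteq> 0" "p \<noteq> path" for p
  proof -
    have "(\<Prod>r = 0..<m+n. entry 1 r (p r)) \<noteq> 0"
      using p(2) unfolding K_def by (metis mult_zero_right coeff_0)
    then have e: "entry 1 r (p r) \<noteq> 0" if "r \<in> {0..<m+n}" for r
      using that by (metis finite_atLeastLessThan prod_zero)
    obtain r where "p r \<noteq> path r" using p(3) by blast
    moreover from this have "r \<in> {0..<m+n}"
      using p(1) path_permutes unfolding permutes_def by metis
    ultimately show ?thesis
      unfolding E_def sum_distrib_left sum.distrib[symmetric] sq[OF p(1), symmetric]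
      using row[of _ p] e by (intro sum_strict_mono_ex1) (auto simp: order.strict_iff_order)
  qed
  ultimately have only: "K p = 0 \<or> p = path" if "p permutes {0..<m+n}" "E p = E path" for p
    using that by fastforce
  have "coeff Q (E path) = (\<Sum>p | p permutes {0..<m+n}. if E p = E path then K p else 0)"
    by (simp add: Q_def coeff_sum)
  also have "\<dots> = (\<Sum>p\<in>{path}. if E p = E path then K p else 0)"
    using path_permutes only by (intro sum.mono_neutral_right) (auto simp: finite_permutations)
  also have "\<dots> \<noteq> 0" using Kp by simp
  finally have "Q \<noteq> 0" by auto
  then have "finite (insert 0 {s. poly Q s = 0})" by (simp add: poly_roots_finite)
  then obtain s where "s \<notin> insert 0 {s. poly Q s = 0}"
    using ex_new_if_finite[OF infinite_UNIV_char_0] by blast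
  then have "coeff (coeff (curve_resultant m n (c s)) j0) i0 \<noteq> 0" "c s \<in> coef_space S"
    using Q torus_point_in_coef_space by (auto simp: c_def)
  then show ?thesis unfolding i0_def j0_def by blast
qed

section \<open>The implicit equation is the resultant\<close>

text \<open>A multiple root of \<open>P - x Q\<close> is a zero of the Wronskian of \<open>P\<close> and \<open>Q\<close>, which does not vanish
  identically because \<open>P\<close> and \<open>Q\<close> are coprime and not both constant.  So only finitely many \<open>x\<close> have
  a fibre with multiple roots, with fewer roots for reasons of degree, or with a root in \<open>B\<close>.\<close>

lemma generic_fibre:
  fixes P Q :: "complex poly"
  assumes co: "coprime P Q" and d: "d = max (degree P) (degree Q)" "0 < d" and B: "finite B"
  shows "\<exists>X. finite X \<and> (\<forall>x. x \<notin> X \<longrightarrow>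
    card {t. poly P t = x * poly Q t} = d \<and>
    {t. poly P t = x * poly Q t} \<inter> B = {} \<and> (\<forall>t. poly P t = x * poly Q t \<longrightarrow> poly Q t \<noteq> 0))"
proof -
  define W where "W = pderiv P * Q - P * pderiv Q"
  have W: "W \<noteq> 0"
  proof
    assume "W = 0"
    then have eq: "pderiv P * Q = P * pderiv Q" by (simp add: W_def)
    then have "Q dvd P * pderiv Q" by (metis dvd_triv_right)
    then have "Q dvd pderiv Q" using co coprime_dvd_mult_right_iff coprime_commute by metis
    moreover have "P dvd pderiv P * Q" using eq by (metis dvd_triv_left)
    then have "P dvd pderiv P" using co coprime_dvd_mult_left_iff by metis
    ultimately show False using d by simp
  qed
  have noroot: "poly Q t \<noteq> 0" if "poly P t = x * poly Q t" for x t
  proof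
    assume "poly Q t = 0"
    then have "[:- t, 1:] dvd P" "[:- t, 1:] dvd Q" using that by (auto simp: poly_eq_0_iff_dvd)
    then have "is_unit [:- t, 1:]" using co by (metis coprime_common_divisor)
    then show False by (simp add: is_unit_pCons_iff)
  qed
  define X where "X = {x. coeff P d = x * coeff Q d} \<union>
    (\<lambda>t. poly P t / poly Q t) ` ({t. poly W t = 0} \<union> B)"
  have "finite {x. coeff P d = x * coeff Q d}"
  proof (cases "coeff Q d = 0")
    case True
    then have "coeff P d \<noteq> 0" using d by (metis leading_coeff_0_iff max_def degree_0 less_numeral_extra(3))
    then show ?thesis using True by simp
  next
    case False
    then have "{x. coeff P d = x * coeff Q d} \<subseteq> {coeff P d / coeff Q d}" by auto
    then show ?thesis by (rule finite_subset) simp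
  qed
  then have "finite X" unfolding X_def using B W by (simp add: poly_roots_finite)
  moreover have "card {t. poly P t = x * poly Q t} = d \<and> {t. poly P t = x * poly Q t} \<inter> B = {}"
    if x: "x \<notin> X" for x
  proof -
    define p where "p = P - Polynomial.smult x Q"
    have roots: "{t. poly P t = x * poly Q t} = {t. poly p t = 0}" by (auto simp: p_def)
    have img: "x = poly P t / poly Q t" if "poly p t = 0" for t
      using noroot[of t x] that by (auto simp: p_def field_simps)
    have "coeff p d \<noteq> 0" using x by (auto simp: p_def X_def)
    moreover have "degree p \<le> d" unfolding p_def d(1)
      by (intro degree_diff_le) (auto intro: order.trans[OF degree_smult_le])
    ultimately have deg: "degree p = d" "p \<noteq> 0" using le_degree by (auto intro: antisym)
    have "rsquarefree p"
      unfolding rsquarefree_roots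
    proof (intro allI notI, elim conjE)
      fix t assume t: "poly p t = 0" "poly (pderiv p) t = 0"
      then have "poly P t = x * poly Q t" "poly (pderiv P) t = x * poly (pderiv Q) t"
        by (auto simp: p_def pderiv_diff pderiv_smult)
      then have "poly W t = 0" by (simp add: W_def)
      then show False using x img[OF t(1)] by (auto simp: X_def)
    qed
    then have "card {t. poly p t = 0} = d" using deg rsquarefree_card_degree by metis
    moreover have "{t. poly p t = 0} \<inter> B = {}" using x img by (auto simp: X_def)
    ultimately show ?thesis unfolding roots by simp
  qed
  ultimately show ?thesis using noroot by blast
qed

lemma poly_poly_eval: "poly (poly F [:y:]) x = poly (map_poly (\<lambda>p. poly p x) F) y"
  by (induction F) (simp_all add: map_poly_pCons)

text \<open>On each of the vertical lines every coefficient of \<open>F\<close>, as a polynomial in \<open>y\<close>, has a zero.\<close>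

lemma eval_xy_infinitely_often_0:
  assumes "infinite X" "\<And>x y. x \<in> X \<Longrightarrow> eval_xy F x y = 0"
  shows "F = 0"
proof -
  have "coeff F j = 0" for j
  proof (rule ccontr)
    assume j: "coeff F j \<noteq> 0"
    have "X \<subseteq> {x. poly (coeff F j) x = 0}"
    proof
      fix x assume x: "x \<in> X"
      then have "poly (map_poly (\<lambda>p. poly p x) F) y = 0" for y
        using assms(2) by (simp add: eval_xy_def poly_poly_eval)
      then have "map_poly (\<lambda>p. poly p x) F = 0" using poly_all_0_iff_0 by blast
      then have "coeff (map_poly (\<lambda>p. poly p x) F) j = 0" by simp
      then show "x \<in> {x. poly (coeff F j) x = 0}" by (simp add: coeff_map_poly)
    qed
    then show False using assms(1) poly_roots_finite[OF j] finite_subset by blast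
  qed
  then show ?thesis by (simp add: poly_eq_iff)
qed

lemma eval_xy_infinitely_often_0':
  assumes "infinite Y" "\<And>x y. y \<in> Y \<Longrightarrow> eval_xy F x y = 0"
  shows "F = 0"
proof (rule eval_xy_infinitely_often_0[OF infinite_UNIV_char_0])
  fix x y :: complex
  have "infinite {y. poly (map_poly (\<lambda>p. poly p x) F) y = 0}"
    by (rule infinite_super[OF _ assms(1)]) (use assms(2) in \<open>auto simp: eval_xy_def poly_poly_eval\<close>)
  then have "map_poly (\<lambda>p. poly p x) F = 0" using poly_roots_finite by blast
  then show "eval_xy F x y = 0" by (simp add: eval_xy_def poly_poly_eval)
qed

lemma degree_poly_const_le:
  fixes F :: "complex poly poly"
  assumes "\<And>j. degree (coeff F j) \<le> d"
  shows "degree (poly F [:y:]) \<le> d"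
proof -
  have "poly F [:y:] = (\<Sum>j\<le>degree F. coeff F j * [:y:] ^ j)" by (rule poly_altdef)
  also have "degree \<dots> \<le> d"
  proof (rule degree_sum_le)
    fix j
    have "[:y:] ^ j = [:y ^ j:]" by (simp add: poly_const_pow)
    then have "coeff F j * [:y:] ^ j = Polynomial.smult (y ^ j) (coeff F j)" by simp
    then show "degree (coeff F j * [:y:] ^ j) \<le> d"
      using assms order.trans[OF degree_smult_le] by metis
  qed simp
  finally show ?thesis .
qed

lemma has_param_degree_swap:
  "has_param_degree P0 Q0 P1 Q1 d \<Longrightarrow> has_param_degree P1 Q1 P0 Q0 d"
  unfolding has_param_degree_def param_dom_def by (simp add: conj_commute conj_left_commute)

text \<open>Degree one of the parameterization separates the points of a general fibre of \<open>x\<close> by their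
  values of \<open>y\<close>.\<close>

lemma proper_fibre:
  assumes co: "coprime P0 Q0" and Q1: "Q1 \<noteq> 0" and deg1: "has_param_degree P0 Q0 P1 Q1 1"
    and d: "d = max (degree P0) (degree Q0)" "0 < d"
  shows "\<exists>X. finite X \<and> (\<forall>x. x \<notin> X \<longrightarrow> (\<exists>T \<subseteq> param_dom Q0 Q1. card T = d \<and>
    (\<forall>t\<in>T. poly P0 t / poly Q0 t = x) \<and> inj_on (\<lambda>t. poly P1 t / poly Q1 t) T))"
proof -
  define bad where "bad = {t \<in> param_dom Q0 Q1.
     card {u \<in> param_dom Q0 Q1. poly P0 u / poly Q0 u = poly P0 t / poly Q0 t \<and>
       poly P1 u / poly Q1 u = poly P1 t / poly Q1 t} \<noteq> 1}"
  have "finite (bad \<union> {t. poly Q1 t = 0})"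
    using deg1 Q1 by (simp add: has_param_degree_def bad_def poly_roots_finite)
  from generic_fibre[OF co d this] obtain X where X: "finite X"
    and fib: "\<And>x. x \<notin> X \<Longrightarrow> card {t. poly P0 t = x * poly Q0 t} = d \<and>
      {t. poly P0 t = x * poly Q0 t} \<inter> (bad \<union> {t. poly Q1 t = 0}) = {} \<and>
      (\<forall>t. poly P0 t = x * poly Q0 t \<longrightarrow> poly Q0 t \<noteq> 0)" by blast
  have "\<exists>T \<subseteq> param_dom Q0 Q1. card T = d \<and>
    (\<forall>t\<in>T. poly P0 t / poly Q0 t = x) \<and> inj_on (\<lambda>t. poly P1 t / poly Q1 t) T" if x: "x \<notin> X" for x
  proof (intro exI conjI)
    let ?T = "{t. poly P0 t = x * poly Q0 t}"
    show dom: "?T \<subseteq> param_dom Q0 Q1" using fib[OF x] by (auto simp: param_dom_def)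
    show "card ?T = d" using fib[OF x] by simp
    show val: "\<forall>t\<in>?T. poly P0 t / poly Q0 t = x" using fib[OF x] by simp
    show "inj_on (\<lambda>t. poly P1 t / poly Q1 t) ?T"
    proof (rule inj_onI)
      fix t u assume t: "t \<in> ?T" and u: "u \<in> ?T" and eq: "poly P1 t / poly Q1 t = poly P1 u / poly Q1 u"
      have "t \<in> param_dom Q0 Q1" "t \<notin> bad" using t dom fib[OF x] by auto
      then have "card {u \<in> param_dom Q0 Q1. poly P0 u / poly Q0 u = poly P0 t / poly Q0 t \<and>
        poly P1 u / poly Q1 u = poly P1 t / poly Q1 t} = 1" (is "card ?U = 1")
        by (auto simp: bad_def)
      then obtain v where v: "?U = {v}" by (rule card_1_singletonE)
      have "t \<in> ?U" using t dom by auto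
      then have "t = v" unfolding v by simp
      have "u \<in> ?U" using u t dom val eq by auto
      then have "u = v" unfolding v by simp
      then show "t = u" using \<open>t = v\<close> by simp
    qed
  qed
  then show ?thesis using X by blast
qed

lemma infinite_Compl: "finite X \<Longrightarrow> infinite (- X)" for X :: "complex set"
  using infinite_UNIV_char_0 by (metis Compl_partition finite_Un)

lemma poly_eq_0_of_many_values:
  fixes G :: "complex poly"
  assumes "inj_on v T" "card T = n" "\<And>t. t \<in> T \<Longrightarrow> poly G (v t) = 0" "degree G < n"
  shows "G = 0"
proof (rule ccontr)
  assume G: "G \<noteq> 0"
  have "n = card (v ` T)" using assms(1,2) by (simp add: card_image)
  also have "\<dots> \<le> card {x. poly G x = 0}"
    using assms(3) by (intro card_mono poly_roots_finite G) auto
  also have "\<dots> \<le> degree G" by (rule card_poly_roots_bound[OF G])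
  finally show False using assms(4) by simp
qed

text \<open>On a general vertical line \<open>F\<close> has \<open>n\<close> distinct zeros.  If its degree were smaller, \<open>F\<close> would vanish on
  infinitely many lines.  The same argument applies to horizontal lines.\<close>

lemma implicit_equation_degrees:
  assumes co: "coprime P0 Q0" "coprime P1 Q1" and Q: "Q0 \<noteq> 0" "Q1 \<noteq> 0"
    and deg1: "has_param_degree P0 Q0 P1 Q1 1"
    and n: "n = max (degree P0) (degree Q0)" "0 < n" and m: "m = max (degree P1) (degree Q1)" "0 < m"
    and F: "F \<in> vanishing_ideal P0 Q0 P1 Q1" "F \<noteq> 0"
  shows "n \<le> degree F" and "\<exists>j. m \<le> degree (coeff F j)"
proof -
  have F0: "eval_xy F (poly P0 t / poly Q0 t) (poly P1 t / poly Q1 t) = 0"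
    if "t \<in> param_dom Q0 Q1" for t using F that by (simp add: vanishing_ideal_def)
  show "n \<le> degree F"
  proof (rule ccontr)
    assume small: "\<not> n \<le> degree F"
    from proper_fibre[OF co(1) Q(2) deg1 n] obtain X where X: "finite X"
      and fib: "\<And>x. x \<notin> X \<Longrightarrow> \<exists>T \<subseteq> param_dom Q0 Q1. card T = n \<and>
        (\<forall>t\<in>T. poly P0 t / poly Q0 t = x) \<and> inj_on (\<lambda>t. poly P1 t / poly Q1 t) T" by blast
    have "eval_xy F x y = 0" if x: "x \<in> - X" for x y
    proof -
      let ?G = "map_poly (\<lambda>p. poly p x) F"
      obtain T where T: "T \<subseteq> param_dom Q0 Q1" "card T = n" "\<forall>t\<in>T. poly P0 t / poly Q0 t = x"
        "inj_on (\<lambda>t. poly P1 t / poly Q1 t) T" using fib[of x] x by blast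
      have "?G = 0"
      proof (rule poly_eq_0_of_many_values[OF T(4,2)])
        show "poly ?G (poly P1 t / poly Q1 t) = 0" if "t \<in> T" for t
          using F0[of t] T(1,3) that by (auto simp: eval_xy_def poly_poly_eval)
        show "degree ?G < n" using small degree_map_poly_le[of "\<lambda>p. poly p x" F] by linarith
      qed
      then show ?thesis by (simp add: eval_xy_def poly_poly_eval)
    qed
    from eval_xy_infinitely_often_0[OF infinite_Compl[OF X] this] show False using F(2) by blast
  qed
  show "\<exists>j. m \<le> degree (coeff F j)"
  proof (rule ccontr)
    assume "\<nexists>j. m \<le> degree (coeff F j)"
    then have small: "degree (coeff F j) \<le> m - 1" for j by (metis Suc_pred' m(2) not_le less_Suc_eq_le)
    from proper_fibre[OF co(2) Q(1) has_param_degree_swap[OF deg1] m] obtain Y where Y: "finite Y"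
      and fib: "\<And>y. y \<notin> Y \<Longrightarrow> \<exists>T \<subseteq> param_dom Q1 Q0. card T = m \<and>
        (\<forall>t\<in>T. poly P1 t / poly Q1 t = y) \<and> inj_on (\<lambda>t. poly P0 t / poly Q0 t) T" by blast
    have dom: "param_dom Q1 Q0 = param_dom Q0 Q1" by (auto simp: param_dom_def)
    have "eval_xy F x y = 0" if y: "y \<in> - Y" for x y
    proof -
      let ?G = "poly F [:y:]"
      obtain T where T: "T \<subseteq> param_dom Q0 Q1" "card T = m" "\<forall>t\<in>T. poly P1 t / poly Q1 t = y"
        "inj_on (\<lambda>t. poly P0 t / poly Q0 t) T" using fib[of y] y unfolding dom by blast
      have "?G = 0"
      proof (rule poly_eq_0_of_many_values[OF T(4,2)])
        show "poly ?G (poly P0 t / poly Q0 t) = 0" if "t \<in> T" for t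
          using F0[of t] T(1,3) that by (auto simp: eval_xy_def)
        show "degree ?G < m" using degree_poly_const_le[OF small, of y] m(2) by linarith
      qed
      then show ?thesis by (simp add: eval_xy_def)
    qed
    from eval_xy_infinitely_often_0'[OF infinite_Compl[OF Y] this] show False using F(2) by blast
  qed
qed

text \<open>The implicit equation divides the resultant and, by the degree bounds, has at least
  its degree in both variables, so that the quotient is a constant.\<close>

theorem implicit_equation_support:
  assumes fin: "\<And>s. finite (S s)" and ne: "\<And>s. S s \<noteq> {}" and c: "c \<in> coef_space S"
    and n: "n = Max (A0 S)" "0 < n" and m: "m = Max (A1 S)" "0 < m"
    and co: "coprime (slot_poly S c NumX) (slot_poly S c DenX)"
      "coprime (slot_poly S c NumY) (slot_poly S c DenY)"
    and deg1: "has_param_degree (slot_poly S c NumX) (slot_poly S c DenX)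
      (slot_poly S c NumY) (slot_poly S c DenY) 1"
    and \<phi>: "implicit_equation (slot_poly S c NumX) (slot_poly S c DenX)
      (slot_poly S c NumY) (slot_poly S c DenY) \<phi>"
    and R: "curve_resultant m n c \<noteq> 0"
  shows "coeff (coeff \<phi> j) i = 0 \<longleftrightarrow> coeff (coeff (curve_resultant m n c) j) i = 0"
proof -
  let ?R = "curve_resultant m n c"
  let ?I = "vanishing_ideal (slot_poly S c NumX) (slot_poly S c DenX)
      (slot_poly S c NumY) (slot_poly S c DenY)"
  have I: "F \<in> ?I \<longleftrightarrow> \<phi> dvd F" for F using \<phi> by (simp add: implicit_equation_def)
  have "?R \<in> ?I" using curve_resultant_in_vanishing_ideal[where S = S, OF fin c n(1) m(1)] n by simp
  then obtain k where k: "?R = \<phi> * k" using I by (auto elim: dvdE)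
  have nz: "\<phi> \<noteq> 0" "k \<noteq> 0" using k R by auto
  have slot_nz: "slot_poly S c s \<noteq> 0" for s
  proof -
    obtain l where "l \<in> S s" using ne[of s] by blast
    then have "coeff (slot_poly S c s) l \<noteq> 0"
      using fin c by (simp add: coeff_slot_poly coef_space_zero_iff)
    then show ?thesis by auto
  qed
  have n': "n = max (degree (slot_poly S c NumX)) (degree (slot_poly S c DenX))"
    unfolding n(1) A0_def using fin ne c by (simp add: degree_slot_poly Max_Un)
  have m': "m = max (degree (slot_poly S c NumY)) (degree (slot_poly S c DenY))"
    unfolding m(1) A1_def using fin ne c by (simp add: degree_slot_poly Max_Un)
  note degs = implicit_equation_degrees[OF co slot_nz slot_nz deg1 n' n(2) m' m(2) _ nz(1)]
  have "\<phi> \<in> ?I" using I by simp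
  note degs = degs[OF this]
  have "degree \<phi> + degree k = degree ?R" using k nz by (simp add: degree_mult_eq)
  then have "degree k = 0" using degs(1) curve_resultant_degree_y[of m n c] by linarith
  then obtain q where q: "k = [:q:]" by (rule degree_eq_zeroE)
  then have R_eq: "coeff ?R j = q * coeff \<phi> j" for j using k by simp
  obtain j where j: "m \<le> degree (coeff \<phi> j)" using degs(2) by blast
  have "coeff \<phi> j \<noteq> 0" "q \<noteq> 0" using j m(2) nz q by auto
  then have "degree q + degree (coeff \<phi> j) = degree (coeff ?R j)"
    unfolding R_eq by (simp add: degree_mult_eq)
  then have "degree q = 0" using j curve_resultant_degree_x[of m n c j] by linarith
  then obtain a where "q = [:a:]" by (rule degree_eq_zeroE)
  then show ?thesis using R_eq[of "_"] \<open>q \<noteq> 0\<close> by simp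
qed

section \<open>The vertices of the lower left corner\<close>

lemma (in finite_supports) torus_prod_nonzero:
  assumes "finite M"
    and "\<And>\<mu>. \<mu> \<in> M \<Longrightarrow> g \<mu> \<in> polynomial_functions \<and> (\<exists>c\<in>coef_space S. g \<mu> c \<noteq> 0)"
  shows "(\<lambda>c. \<Prod>\<mu>\<in>M. g \<mu> c) \<in> polynomial_functions \<and> (\<exists>c\<in>coef_space S. (\<Prod>\<mu>\<in>M. g \<mu> c) \<noteq> 0)"
  using assms
proof (induction M rule: finite_induct)
  case empty
  have "torus_point S id id 1 \<in> coef_space S" by (rule torus_point_in_coef_space) simp
  then show ?case by (auto intro: polynomial_functions.const)
next
  case (insert \<mu> M)
  then have g: "g \<mu> \<in> polynomial_functions" "\<exists>c\<in>coef_space S. g \<mu> c \<noteq> 0"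
    and P: "(\<lambda>c. \<Prod>\<mu>\<in>M. g \<mu> c) \<in> polynomial_functions" "\<exists>c\<in>coef_space S. (\<Prod>\<mu>\<in>M. g \<mu> c) \<noteq> 0"
    by auto
  have "\<exists>c\<in>coef_space S. g \<mu> c \<noteq> 0 \<and> (\<Prod>\<mu>\<in>M. g \<mu> c) \<noteq> 0"
    using g(2) P(2) torus_common_nonzero[where S = S, OF fin g(1) P(1)] by blast
  moreover have "(\<lambda>c. g \<mu> c * (\<Prod>\<mu>\<in>M. g \<mu> c)) \<in> polynomial_functions"
    using g(1) P(1) by (rule polynomial_functions.mult)
  ultimately show ?case using insert.hyps by simp
qed

lemma (in finite_supports) generically_monomials:
  assumes M: "finite M"
    and nz: "\<And>i j. (i, j) \<in> M \<Longrightarrow> \<exists>c\<in>coef_space S. coeff (coeff (curve_resultant m n c) j) i \<noteq> 0"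
  shows "generically S (\<lambda>c. c \<in> coef_space S \<and>
    (\<forall>(i, j)\<in>M. coeff (coeff (curve_resultant m n c) j) i \<noteq> 0))"
proof -
  let ?g = "\<lambda>\<mu> c. coeff (coeff (curve_resultant m n c) (snd \<mu>)) (fst \<mu>)"
  have "?g \<mu> \<in> polynomial_functions \<and> (\<exists>c\<in>coef_space S. ?g \<mu> c \<noteq> 0)" if "\<mu> \<in> M" for \<mu>
    using polynomial_coeffs_curve_resultant nz[of "fst \<mu>" "snd \<mu>"] that
    by (simp add: polynomial_coeffs_def)
  from torus_prod_nonzero[OF M, of ?g, OF this] obtain c where
    "(\<lambda>c. \<Prod>\<mu>\<in>M. ?g \<mu> c) \<in> polynomial_functions" "c \<in> coef_space S" "(\<Prod>\<mu>\<in>M. ?g \<mu> c) \<noteq> 0" by blast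
  from polynomial_functions_nonzero_dense[where S = S, OF fin this] show ?thesis
    by (rule generically_mono) (use M in auto)
qed

lemma sum_three_steps:
  fixes f :: "nat \<Rightarrow> nat"
  assumes "a \<le> b" "b \<le> n"
  shows "(\<Sum>j<n. f (if j < a then x else if j < b then y else z)) = a * f x + (b - a) * f y + (n - b) * f z"
proof -
  have "(\<Sum>j<n. f (if j < a then x else if j < b then y else z)) =
      (\<Sum>j\<in>{0..<a}. f x) + (\<Sum>j\<in>{a..<b}. f y) + (\<Sum>j\<in>{b..<n}. f z)"
  proof -
    let ?h = "\<lambda>j. f (if j < a then x else if j < b then y else z)"
    have "sum ?h {..<n} = sum ?h {0..<a} + sum ?h {a..<b} + sum ?h {b..<n}"
      using sum.atLeastLessThan_concat[of 0 a b ?h] sum.atLeastLessThan_concat[of 0 b n ?h] assms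
      unfolding lessThan_atLeast0 by linarith
    moreover have "sum ?h {0..<a} = (\<Sum>j\<in>{0..<a}. f x)" by (rule sum.cong) auto
    moreover have "sum ?h {a..<b} = (\<Sum>j\<in>{a..<b}. f y)" by (rule sum.cong) auto
    moreover have "sum ?h {b..<n} = (\<Sum>j\<in>{b..<n}. f z)" using assms by (intro sum.cong) auto
    ultimately show ?thesis by simp
  qed
  then show ?thesis by simp
qed

lemma (in finite_supports) lattice_path_vertex:
  assumes path: "staircase (Max (A1 S)) (Max (A0 S)) \<rho> \<sigma>"
    and mem: "\<And>i. i < Max (A1 S) \<Longrightarrow> \<rho> i \<in> A0 S" "\<And>j. j < Max (A0 S) \<Longrightarrow> \<sigma> j \<in> A1 S"
  shows "\<exists>c\<in>coef_space S. coeff (coeff (curve_resultant (Max (A1 S)) (Max (A0 S)) c)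
    (\<Sum>j<Max (A0 S). of_bool (\<sigma> j \<notin> S NumY))) (\<Sum>i<Max (A1 S). of_bool (\<rho> i \<notin> S NumX)) \<noteq> 0"
proof (rule staircase.curve_resultant_vertex[OF path])
  show "l \<le> Max (A0 S)" if "l \<in> S NumX \<union> S DenX" for l
    using that finite_rows(1) by (simp add: A0_def)
  show "l \<le> Max (A1 S)" if "l \<in> S NumY \<union> S DenY" for l
    using that finite_rows(2) by (simp add: A1_def)
qed (use mem in \<open>simp_all add: A0_def A1_def\<close>)

text \<open>The lattice path that corresponds to the optimal triangulation: all its vertical steps are taken at
  non-selected abscissae, and its horizontal steps at the heights \<open>0\<close>, \<open>Min (S NumY)\<close> and \<open>m\<close>.\<close>

lemma (in finite_supports) vertex_on_y_axis:
  assumes min0: "Min (A0 S) = 0" "Min (A1 S) = 0"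
  shows "\<exists>c\<in>coef_space S. coeff (coeff (curve_resultant (Max (A1 S)) (Max (A0 S)) c) (corner_cost S 0)) 0 \<noteq> 0"
proof -
  define m where "m = Max (A1 S)"
  define n where "n = Max (A0 S)"
  define \<rho> where "\<rho> i = (if i < Min (S NumY) then Min (S NumX) else Max (S NumX))" for i
  define \<sigma> where "\<sigma> j = (if j < Min (S NumX) then 0 else if j < Max (S NumX) then Min (S NumY) else m)" for j
  have path: "staircase m n \<rho> \<sigma>"
  proof
    show "\<rho> i \<le> \<rho> i'" if "i \<le> i'" "i' < m" for i i' using support_ends(3)[of NumX] that by (simp add: \<rho>_def)
    show "\<sigma> j \<le> \<sigma> j'" if "j \<le> j'" "j' < n" for j j'
      using support_ends(3)[of NumY] numerator_range(4) that by (auto simp: \<sigma>_def m_def)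
    show "\<rho> i \<le> n" for i using support_ends(3)[of NumX] numerator_range(2) by (simp add: \<rho>_def n_def)
    show "\<sigma> j \<le> m" for j using support_ends(3)[of NumY] numerator_range(4) by (simp add: \<sigma>_def m_def)
    show "j < \<rho> i \<longleftrightarrow> \<sigma> j \<le> i" if "i < m" "j < n" for i j
      using support_ends(3)[of NumX] that by (auto simp: \<rho>_def \<sigma>_def)
  qed
  have "\<rho> i \<in> S NumX" for i using support_ends(1,2) by (simp add: \<rho>_def)
  moreover have "\<sigma> j \<in> A1 S" for j
    using row_ends(3,4) support_ends(1)[of NumY] numerator_subset(2) min0 by (auto simp: \<sigma>_def m_def)
  ultimately have "\<exists>c\<in>coef_space S. coeff (coeff (curve_resultant m n c)
      (\<Sum>j<n. of_bool (\<sigma> j \<notin> S NumY))) (\<Sum>i<m. of_bool (\<rho> i \<notin> S NumX)) \<noteq> 0"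
    using path numerator_subset unfolding m_def n_def by (intro lattice_path_vertex) auto
  moreover have "(\<Sum>i<m. of_bool (\<rho> i \<notin> S NumX)) = (0::nat)" using \<open>\<And>i. \<rho> i \<in> S NumX\<close> by simp
  moreover have "(\<Sum>j<n. of_bool (\<sigma> j \<notin> S NumY)) = corner_cost S 0"
    unfolding \<sigma>_def
    using sum_three_steps[of "Min (S NumX)" "Max (S NumX)" n "\<lambda>l. of_bool (l \<notin> S NumY)"] support_ends(1)[of NumY] support_ends(3)[of NumX] numerator_range(2) min0
    by (simp add: corner_cost_def row_points_def nonselected_def n_def m_def)
  ultimately show ?thesis unfolding m_def n_def by simp
qed

lemma (in finite_supports) vertex_on_x_axis:
  assumes min0: "Min (A0 S) = 0" "Min (A1 S) = 0"
  shows "\<exists>c\<in>coef_space S. coeff (coeff (curve_resultant (Max (A1 S)) (Max (A0 S)) c) 0) (corner_cost S 1) \<noteq> 0"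
proof -
  define m where "m = Max (A1 S)"
  define n where "n = Max (A0 S)"
  define \<rho> where "\<rho> i = (if i < Min (S NumY) then 0 else if i < Max (S NumY) then Min (S NumX) else n)" for i
  define \<sigma> where "\<sigma> j = (if j < Min (S NumX) then Min (S NumY) else Max (S NumY))" for j
  have path: "staircase m n \<rho> \<sigma>"
  proof
    show "\<rho> i \<le> \<rho> i'" if "i \<le> i'" "i' < m" for i i'
      using support_ends(3)[of NumX] numerator_range(2) that by (auto simp: \<rho>_def n_def)
    show "\<sigma> j \<le> \<sigma> j'" if "j \<le> j'" "j' < n" for j j' using support_ends(3)[of NumY] that by (simp add: \<sigma>_def)
    show "\<rho> i \<le> n" for i using support_ends(3)[of NumX] numerator_range(2) by (simp add: \<rho>_def n_def)
    show "\<sigma> j \<le> m" for j using support_ends(3)[of NumY] numerator_range(4) by (simp add: \<sigma>_def m_def)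
    show "j < \<rho> i \<longleftrightarrow> \<sigma> j \<le> i" if "i < m" "j < n" for i j
      using support_ends(3)[of NumY] that by (auto simp: \<rho>_def \<sigma>_def)
  qed
  have "\<sigma> j \<in> S NumY" for j using support_ends(1,2) by (simp add: \<sigma>_def)
  moreover have "\<rho> i \<in> A0 S" for i
    using row_ends(1,2) support_ends(1)[of NumX] numerator_subset(1) min0 by (auto simp: \<rho>_def n_def)
  ultimately have "\<exists>c\<in>coef_space S. coeff (coeff (curve_resultant m n c)
      (\<Sum>j<n. of_bool (\<sigma> j \<notin> S NumY))) (\<Sum>i<m. of_bool (\<rho> i \<notin> S NumX)) \<noteq> 0"
    using path numerator_subset unfolding m_def n_def by (intro lattice_path_vertex) auto
  moreover have "(\<Sum>j<n. of_bool (\<sigma> j \<notin> S NumY)) = (0::nat)" using \<open>\<And>i. \<sigma> i \<in> S NumY\<close> by simp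
  moreover have "(\<Sum>i<m. of_bool (\<rho> i \<notin> S NumX)) = corner_cost S 1"
    unfolding \<rho>_def
    using sum_three_steps[of "Min (S NumY)" "Max (S NumY)" m "\<lambda>l. of_bool (l \<notin> S NumX)"] support_ends(1)[of NumX] support_ends(3)[of NumY] numerator_range(4) min0
    by (simp add: corner_cost_def row_points_def nonselected_def n_def m_def)
  ultimately show ?thesis unfolding m_def n_def by simp
qed

text \<open>The paths have four sides.  For the first one, the vertical sides are at abscissa \<open>0\<close>, which is
  selected, and at the last non-selected abscissa; the horizontal sides are at the first
  non-selected height and at height \<open>m\<close>, which is selected.  The second one is its mirror image.\<close>

lemma (in finite_supports) inner_vertices:
  assumes min0: "Min (A0 S) = 0" "Min (A1 S) = 0"
    and sel: "0 \<notin> S NumX" "0 \<notin> S NumY" "Max (A0 S) \<notin> S NumX" "Max (A1 S) \<notin> S NumY"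
  shows "\<exists>c\<in>coef_space S. coeff (coeff (curve_resultant (Max (A1 S)) (Max (A0 S)) c)
      (Max (A0 S) - Max (S NumX))) (Min (S NumY)) \<noteq> 0"
    and "\<exists>c\<in>coef_space S. coeff (coeff (curve_resultant (Max (A1 S)) (Max (A0 S)) c)
      (Min (S NumX))) (Max (A1 S) - Max (S NumY)) \<noteq> 0"
proof -
  define m where "m = Max (A1 S)"
  define n where "n = Max (A0 S)"
  have ends: "0 \<in> A0 S" "n \<in> A0 S" "0 \<in> A1 S" "m \<in> A1 S" using row_ends min0 by (simp_all add: m_def n_def)
  have sum2: "(\<Sum>j<N. of_bool ((if j < a then x else y) \<notin> B)) = a * of_bool (x \<notin> B) + (N - a) * (of_bool (y \<notin> B) :: nat)"
    if "a \<le> N" for a N x y and B :: "nat set"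
  proof -
    have "(if j < a then x else if j < a then x else y) = (if j < a then x else y)" for j by simp
    then show ?thesis
      using sum_three_steps[of a a N "\<lambda>l. of_bool (l \<notin> B)" x x y] that
      by (simp only: order_refl diff_self_eq_0 mult_0 add_0_right)
  qed
  define \<rho> where "\<rho> i = (if i < Min (S NumY) then 0 else Max (S NumX))" for i
  define \<sigma> where "\<sigma> j = (if j < Max (S NumX) then Min (S NumY) else m)" for j
  have path: "staircase m n \<rho> \<sigma>"
    by unfold_locales (use support_ends(3)[of NumY] numerator_range(2,4) in \<open>auto simp: \<rho>_def \<sigma>_def m_def n_def\<close>)
  have "\<exists>c\<in>coef_space S. coeff (coeff (curve_resultant m n c)
      (\<Sum>j<n. of_bool (\<sigma> j \<notin> S NumY))) (\<Sum>i<m. of_bool (\<rho> i \<notin> S NumX)) \<noteq> 0"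
    unfolding m_def n_def
    by (rule lattice_path_vertex[OF path[unfolded m_def n_def]])
      (use ends support_ends(1)[of NumY] support_ends(2)[of NumX] numerator_subset in \<open>auto simp: \<rho>_def \<sigma>_def A0_def A1_def\<close>)
  moreover have "(\<Sum>i<m. of_bool (\<rho> i \<notin> S NumX)) = Min (S NumY)"
    unfolding \<rho>_def using support_ends(2)[of NumX] support_ends(3)[of NumY] numerator_range(4) sel by (subst sum2) (auto simp: m_def)
  moreover have "(\<Sum>j<n. of_bool (\<sigma> j \<notin> S NumY)) = n - Max (S NumX)"
    unfolding \<sigma>_def using support_ends(1)[of NumY] numerator_range(2) sel by (subst sum2) (auto simp: m_def n_def)
  ultimately show "\<exists>c\<in>coef_space S. coeff (coeff (curve_resultant (Max (A1 S)) (Max (A0 S)) c)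
      (Max (A0 S) - Max (S NumX))) (Min (S NumY)) \<noteq> 0"
    unfolding m_def n_def by simp
  define \<rho>' where "\<rho>' i = (if i < Max (S NumY) then Min (S NumX) else n)" for i
  define \<sigma>' where "\<sigma>' j = (if j < Min (S NumX) then 0 else Max (S NumY))" for j
  have path': "staircase m n \<rho>' \<sigma>'"
    by unfold_locales (use support_ends(3)[of NumX] numerator_range(2,4) in \<open>auto simp: \<rho>'_def \<sigma>'_def m_def n_def\<close>)
  have "\<exists>c\<in>coef_space S. coeff (coeff (curve_resultant m n c)
      (\<Sum>j<n. of_bool (\<sigma>' j \<notin> S NumY))) (\<Sum>i<m. of_bool (\<rho>' i \<notin> S NumX)) \<noteq> 0"
    unfolding m_def n_def
    by (rule lattice_path_vertex[OF path'[unfolded m_def n_def]])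
      (use ends support_ends(1)[of NumX] support_ends(2)[of NumY] numerator_subset in \<open>auto simp: \<rho>'_def \<sigma>'_def A0_def A1_def\<close>)
  moreover have "(\<Sum>i<m. of_bool (\<rho>' i \<notin> S NumX)) = m - Max (S NumY)"
    unfolding \<rho>'_def using support_ends(1)[of NumX] numerator_range(4) sel by (subst sum2) (auto simp: m_def n_def)
  moreover have "(\<Sum>j<n. of_bool (\<sigma>' j \<notin> S NumY)) = Min (S NumX)"
    unfolding \<sigma>'_def using support_ends(2)[of NumY] support_ends(3)[of NumX] numerator_range(2) sel by (subst sum2) (auto simp: n_def)
  ultimately show "\<exists>c\<in>coef_space S. coeff (coeff (curve_resultant (Max (A1 S)) (Max (A0 S)) c)
      (Min (S NumX))) (Max (A1 S) - Max (S NumY)) \<noteq> 0"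
    unfolding m_def n_def by simp
qed

text \<open>Both polynomials are divisible by \<open>t\<close>.\<close>

lemma (in finite_supports) not_coprime_slot_polys:
  assumes c: "c \<in> coef_space S"
    and no0: "0 \<notin> S s" "0 \<notin> S s'"
  shows "\<not> coprime (slot_poly S c s) (slot_poly S c s')"
proof
  assume co: "coprime (slot_poly S c s) (slot_poly S c s')"
  have "[:0, 1:] dvd slot_poly S c q" if "0 \<notin> S q" for q
  proof -
    have "poly (slot_poly S c q) 0 = 0"
      using that fin c by (simp add: poly_0_coeff_0 coeff_slot_poly coef_space_zero_iff)
    then show ?thesis by (simp add: poly_eq_0_iff_dvd)
  qed
  then have "is_unit [:0, 1 :: complex:]" using co no0 by (metis coprime_common_divisor)
  then show False by (simp add: is_unit_pCons_iff)
qed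

section \<open>The corner theorem\<close>

lemma extremes_of_union:
  fixes N D :: "nat set"
  assumes "finite N" "finite D" "N \<noteq> {}"
  shows "Min (N \<union> D) \<in> N \<longleftrightarrow> Min N - Min (N \<union> D) = 0" "Max (N \<union> D) \<in> N \<longleftrightarrow> Max (N \<union> D) - Max N = 0"
    "Min (N \<union> D) \<in> D - N \<longleftrightarrow> 0 < Min N - Min (N \<union> D)" "Max (N \<union> D) \<in> D - N \<longleftrightarrow> 0 < Max (N \<union> D) - Max N"
proof -
  have fin: "finite (N \<union> D)" "N \<union> D \<noteq> {}" using assms by auto
  have le: "Min (N \<union> D) \<le> Min N" "Max N \<le> Max (N \<union> D)"
    using Min_antimono[OF Un_upper1 assms(3) fin(1)] Max_mono[OF Un_upper1 assms(3) fin(1)] .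
  have ran: "Min N \<le> x \<and> x \<le> Max N" if "x \<in> N" for x using assms that by simp
  show eq: "Min (N \<union> D) \<in> N \<longleftrightarrow> Min N - Min (N \<union> D) = 0" "Max (N \<union> D) \<in> N \<longleftrightarrow> Max (N \<union> D) - Max N = 0"
    using le ran Min_in[OF assms(1,3)] Max_in[OF assms(1,3)] by (metis diff_is_0_eq antisym)+
  show "Min (N \<union> D) \<in> D - N \<longleftrightarrow> 0 < Min N - Min (N \<union> D)" "Max (N \<union> D) \<in> D - N \<longleftrightarrow> 0 < Max (N \<union> D) - Max N"
    using eq Min_in[OF fin] Max_in[OF fin] by auto
qed

theorem theorem29:
  fixes S :: supports
  assumes "\<And>s. finite (S s)" and "\<And>s. S s \<noteq> {}"
    and "selected0 S \<noteq> {}" and "selected1 S \<noteq> {}"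
    and "e1_min_at_e0_min S \<noteq> 0"
  shows
    "((Min (A0 S) \<in> selected0 S \<and> Min (A1 S) \<in> selected1 S \<or>
       Max (A0 S) \<in> selected0 S \<and> Max (A1 S) \<in> selected1 S) \<and>
      e0_min_at_e1_min S \<noteq> 0) \<and>
     generically S (\<lambda>c.
       let P0 = slot_poly S c NumX; Q0 = slot_poly S c DenX;
           P1 = slot_poly S c NumY; Q1 = slot_poly S c DenY
       in coprime P0 Q0 \<and> coprime P1 Q1 \<and> has_param_degree P0 Q0 P1 Q1 1 \<longrightarrow>
          (\<forall>\<phi>. implicit_equation P0 Q0 P1 Q1 \<phi> \<longrightarrow>
             (let N = newton_polygon \<phi>;
                  a = (0, real (e1_min_at_e0_min S));
                  b = (real (e0_min_at_e1_min S), 0);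
                  p = corner_vertex S
              in if Min (A0 S) \<in> selected0 S \<and> Min (A1 S) \<in> selected1 S \<and>
                    Max (A0 S) \<in> selected0 S \<and> Max (A1 S) \<in> selected1 S \<and> delta S \<noteq> 0
                 then closed_segment a p edge_of N \<and> closed_segment p b edge_of N \<and>
                      lower_left_corner N a b = closed_segment a p \<union> closed_segment p b
                 else closed_segment a b edge_of N \<and>
                      lower_left_corner N a b = closed_segment a b)))"
proof -
  interpret finite_supports S by unfold_locales (rule assms(1,2))+
  note lt = rows_nondegenerate[OF assms(3,4)]
  note ends = corner_ends[OF assms(3,4)]
  define m where "m = Max (A1 S)"
  define n where "n = Max (A0 S)"
  define u0 where "u0 = Min (S NumX) - Min (A0 S)"
  define u1 where "u1 = Max (A0 S) - Max (S NumX)"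
  define v0 where "v0 = Min (S NumY) - Min (A1 S)"
  define v1 where "v1 = Max (A1 S) - Max (S NumY)"
  note ext0 = extremes_of_union[OF assms(1,1,2), of NumX DenX, folded A0_def selected0_def, folded u0_def u1_def]
    and ext1 = extremes_of_union[OF assms(1,1,2), of NumY DenY, folded A1_def selected1_def, folded v0_def v1_def]
  note non0 = ext0(1,2) and sel0 = ext0(3,4) and non1 = ext1(1,2) and sel1 = ext1(3,4)
  \<comment> \<open>orders at the two ends, set to zero unless both coordinates vanish there\<close>
  define U0 where "U0 = (if 0 < v0 then u0 else 0)"
  define U1 where "U1 = (if 0 < v1 then u1 else 0)"
  define V0 where "V0 = (if 0 < u0 then v0 else 0)"
  define V1 where "V1 = (if 0 < u1 then v1 else 0)"
  have H: "e1_min_at_e0_min S = U0 + U1" and W: "e0_min_at_e1_min S = V0 + V1"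
    unfolding ends corner_cost_def row_points_def nonselected_def U0_def U1_def V0_def V1_def
    using non0 non1 by (simp_all add: u0_def u1_def v0_def v1_def)
  have UV: "0 < U0 \<longleftrightarrow> 0 < V0" "0 < U1 \<longleftrightarrow> 0 < V1" "0 < U0 + U1"
    using assms(5) H by (auto simp: U0_def U1_def V0_def V1_def)
  have part1: "(Min (A0 S) \<in> selected0 S \<and> Min (A1 S) \<in> selected1 S \<or>
       Max (A0 S) \<in> selected0 S \<and> Max (A1 S) \<in> selected1 S) \<and> e0_min_at_e1_min S \<noteq> 0"
    unfolding sel0 sel1 W using UV by (auto simp: U0_def U1_def V0_def V1_def split: if_splits)
  define two where "two \<longleftrightarrow> 0 < u0 \<and> 0 < v0 \<and> 0 < u1 \<and> 0 < v1 \<and> delta S \<noteq> 0"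
  have delta: "delta S = int (u1 * v0) - int (u0 * v1)"
    unfolding delta_def u0_def u1_def v0_def v1_def using numerator_range by (simp add: of_nat_diff)
  define q where "q = (if delta S < 0 then (v0, u1) else (v1, u0))"
  have q: "corner_vertex S = (real (fst q), real (snd q))"
    unfolding corner_vertex_def q_def u0_def u1_def v0_def v1_def using numerator_range by (simp add: of_nat_diff)
  \<comment> \<open>exponents of the monomials that have to occur in the resultant\<close>
  define M where "M = {(0, U0 + U1), (V0 + V1, 0)} \<union> (if two then {q} else {})"
  define a where "a = (0 :: real, real (U0 + U1))"
  define b where "b = (real (V0 + V1), 0 :: real)"
  define shape where "shape N \<longleftrightarrow> (if two
      then closed_segment a (corner_vertex S) edge_of N \<and> closed_segment (corner_vertex S) b edge_of N \<and>
        lower_left_corner N a b = closed_segment a (corner_vertex S) \<union> closed_segment (corner_vertex S) b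
      else closed_segment a b edge_of N \<and> lower_left_corner N a b = closed_segment a b)" for N
  have shape: "shape (newton_polygon \<phi>)" if c: "c \<in> coef_space S" and min0: "Min (A0 S) = 0" "Min (A1 S) = 0"
    and M: "\<forall>(i, j)\<in>M. coeff (coeff (curve_resultant m n c) j) i \<noteq> 0"
    and supp: "\<And>i j. coeff (coeff \<phi> j) i = 0 \<longleftrightarrow> coeff (coeff (curve_resultant m n c) j) i = 0"
    for c \<phi>
  proof -
    let ?R = "curve_resultant m n c"
    define P where "P = {(real i, real j) | i j. coeff (coeff ?R j) i \<noteq> 0}"
    have N: "newton_polygon \<phi> = convex hull P" by (simp add: newton_polygon_def P_def supp)
    have "P \<subseteq> (\<lambda>(i, j). (real i, real j)) ` ({..m} \<times> {..n})"
    proof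
      fix z assume "z \<in> P"
      then obtain i j where z: "z = (real i, real j)" "coeff (coeff ?R j) i \<noteq> 0" by (auto simp: P_def)
      have "coeff ?R j \<noteq> 0" using z(2) by auto
      then have "j \<le> n" using le_degree[of ?R j] curve_resultant_degree_y[of m n c] by linarith
      moreover have "i \<le> m" using le_degree[OF z(2)] curve_resultant_degree_x[of m n c j] by linarith
      ultimately show "z \<in> (\<lambda>(i, j). (real i, real j)) ` ({..m} \<times> {..n})" using z(1) by force
    qed
    then have fin: "finite P" by (rule finite_subset) simp
    have bounds: "end_bounds P U0 V0 U1 V1"
      unfolding end_bounds_def
    proof (intro ballI, clarify, intro conjI allI impI)
      fix x y assume xy: "(x, y) \<in> P"
      show "0 \<le> x" "0 \<le> y" using xy by (auto simp: P_def)
      fix \<alpha> \<beta> \<gamma> \<gamma>' :: real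
      assume "0 \<le> \<alpha> \<and> 0 \<le> \<beta> \<and> 0 \<le> \<gamma> \<and> 0 \<le> \<gamma>' \<and> \<gamma> * real U0 \<le> \<alpha> \<and> \<gamma> * real V0 \<le> \<beta> \<and>
        \<gamma>' * real U1 \<le> \<alpha> \<and> \<gamma>' * real V1 \<le> \<beta>"
      then have nn: "0 \<le> \<alpha>" "0 \<le> \<beta>" "0 \<le> \<gamma>" "0 \<le> \<gamma>'" and g: "\<gamma> * real U0 \<le> \<alpha>"
        "\<gamma> * real V0 \<le> \<beta>" "\<gamma>' * real U1 \<le> \<alpha>" "\<gamma>' * real V1 \<le> \<beta>" by auto
      have le: "U0 \<le> u0" "U1 \<le> u1" "V0 \<le> v0" "V1 \<le> v1" by (auto simp: U0_def U1_def V0_def V1_def)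
      have size: "u0 + u1 \<le> n" "v0 + v1 \<le> m"
        using support_ends(3)[of NumX] support_ends(3)[of NumY] numerator_range(2,4) by (simp_all add: u0_def u1_def v0_def v1_def m_def n_def)
      have z: "c (s, l) = 0" if "l \<notin> S s" for s l using coef_space_zero_iff[OF c] that by simp
      have out: "l \<notin> S NumX" "l \<notin> S DenX" if "n < l" for l
      proof -
        have "l \<notin> A0 S" using that Max_ge[OF finite_rows(1), of l] unfolding n_def by (meson leD)
        then show "l \<notin> S NumX" "l \<notin> S DenX" by (simp_all add: A0_def)
      qed
      have out': "l \<notin> S NumY" "l \<notin> S DenY" if "m < l" for l
      proof -
        have "l \<notin> A1 S" using that Max_ge[OF finite_rows(2), of l] unfolding m_def by (meson leD)
        then show "l \<notin> S NumY" "l \<notin> S DenY" by (simp_all add: A1_def)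
      qed
      have "weight_ge \<alpha> \<beta> (\<gamma> * real U0 * real V0 + \<gamma>' * real U1 * real V1) ?R"
      proof (rule curve_resultant_weight[OF nn g])
        show "U0 + U1 \<le> n" "V0 + V1 \<le> m" using le size by linarith+
        show "U0 \<le> l \<and> l + U1 \<le> n" if "c (NumX, l) \<noteq> 0" for l
        proof -
          have "l \<in> S NumX" using that z by blast
          then have "Min (S NumX) \<le> l" "l \<le> Max (S NumX)" using assms(1) by simp_all
          then show ?thesis using le(1,2) numerator_range(2) min0 by (simp add: u0_def u1_def n_def)
        qed
        show "V0 \<le> l \<and> l + V1 \<le> m" if "c (NumY, l) \<noteq> 0" for l
        proof -
          have "l \<in> S NumY" using that z by blast
          then have "Min (S NumY) \<le> l" "l \<le> Max (S NumY)" using assms(1) by simp_all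
          then show ?thesis using le(3,4) numerator_range(4) min0 by (simp add: v0_def v1_def m_def)
        qed
      qed (use z out out' in blast)+
      then show "\<gamma> * real U0 * real V0 + \<gamma>' * real U1 * real V1 \<le> \<alpha> * x + \<beta> * y"
        using xy by (auto simp: P_def weight_ge_def)
    qed
    have axis: "(0, real U0 + real U1) \<in> P" "(real V0 + real V1, 0) \<in> P"
    proof -
      have "coeff (coeff ?R (U0 + U1)) 0 \<noteq> 0" "coeff (coeff ?R 0) (V0 + V1) \<noteq> 0"
        using M by (auto simp: M_def)
      then have "(real 0, real (U0 + U1)) \<in> P" "(real (V0 + V1), real 0) \<in> P"
        unfolding P_def by blast+
      then show "(0, real U0 + real U1) \<in> P" "(real V0 + real V1, 0) \<in> P" by simp_all
    qed
    show ?thesis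
    proof (cases two)
      case False
      have "U1 * V0 = U0 * V1"
        using False delta by (auto simp: two_def U0_def U1_def V0_def V1_def) (metis of_nat_eq_iff of_nat_mult)
      then have "real U1 * real V0 = real U0 * real V1" by (metis of_nat_mult)
      moreover have "0 < real U0 + real U1" using UV(3) by linarith
      ultimately have "closed_segment (0, real U0 + real U1) (real V0 + real V1, 0) edge_of convex hull P \<and>
        lower_left_corner (convex hull P) (0, real U0 + real U1) (real V0 + real V1, 0) =
        closed_segment (0, real U0 + real U1) (real V0 + real V1, 0)"
        using UV by (intro one_edge_of_bounds[OF fin bounds _ _ _ _ _ _ _ _ axis]) auto
      then show ?thesis using False by (simp add: shape_def N a_def b_def)
    next
      case True
      then have pos: "0 < u0" "0 < v0" "0 < u1" "0 < v1" "delta S \<noteq> 0" by (auto simp: two_def)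
      then have eq: "U0 = u0" "U1 = u1" "V0 = v0" "V1 = v1" by (auto simp: U0_def U1_def V0_def V1_def)
      have qP: "(real (fst q), real (snd q)) \<in> P"
        using M True unfolding M_def P_def by (cases q) auto
      note bounds = bounds[unfolded eq] and axis = axis[unfolded eq]
      define r where "r = (real (fst q), real (snd q))"
      let ?a = "(0, real u0 + real u1)" and ?b = "(real v0 + real v1, 0)"
      have "closed_segment ?a r edge_of convex hull P \<and> closed_segment r ?b edge_of convex hull P \<and>
        lower_left_corner (convex hull P) ?a ?b = closed_segment ?a r \<union> closed_segment r ?b"
      proof (cases "delta S < 0")
        case neg: True
        then have "int (u1 * v0) < int (u0 * v1)" using delta by simp
        then have "u1 * v0 < u0 * v1" by linarith
        then have "real u1 * real v0 < real u0 * real v1" by (metis of_nat_less_iff of_nat_mult)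
        moreover have r: "r = (real v0, real u1)" using neg by (simp add: r_def q_def)
        ultimately show ?thesis
          using pos qP unfolding r_def[symmetric] r
          by (intro two_edges_of_bounds[OF fin bounds _ _ _ _ _ axis(1) _ axis(2)]) auto
      next
        case False
        then have "int (u0 * v1) < int (u1 * v0)" using delta pos(5) by linarith
        then have "u0 * v1 < u1 * v0" by linarith
        then have steep: "real u0 * real v1 < real u1 * real v0" by (metis of_nat_less_iff of_nat_mult)
        have r: "r = (real v1, real u0)" using False by (simp add: r_def q_def)
        have axis': "(0, real u1 + real u0) \<in> P" "(real v1 + real v0, 0) \<in> P"
          using axis by (simp_all add: add.commute)
        have "(real v1, real u0) \<in> P" using qP unfolding r_def[symmetric] r .
        from two_edges_of_bounds[OF fin end_bounds_swap[OF bounds] _ _ _ _ steep axis'(1) this axis'(2)]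
        show ?thesis unfolding r using pos by (simp add: add.commute)
      qed
      then show ?thesis using True by (simp add: shape_def N a_def b_def q eq r_def)
    qed
  qed
  \<comment> \<open>if \<open>0\<close> is missing from a row, its numerator and denominator have the common zero \<open>t = 0\<close>\<close>
  define M' where "M' = (if Min (A0 S) = 0 \<and> Min (A1 S) = 0 then M else {})"
  have generic: "generically S (\<lambda>c. c \<in> coef_space S \<and>
    (\<forall>(i, j)\<in>M'. coeff (coeff (curve_resultant m n c) j) i \<noteq> 0))"
  proof (rule generically_monomials)
    show "finite M'" by (simp add: M'_def M_def)
    fix i j assume "(i, j) \<in> M'"
    then have min0: "Min (A0 S) = 0" "Min (A1 S) = 0"
      and "(i, j) = (0, U0 + U1) \<or> (i, j) = (V0 + V1, 0) \<or> two \<and> (i, j) = q"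
      by (auto simp: M'_def M_def split: if_splits)
    then consider "(i, j) = (0, U0 + U1)" | "(i, j) = (V0 + V1, 0)" | "two" "(i, j) = q" by blast
    then show "\<exists>c\<in>coef_space S. coeff (coeff (curve_resultant m n c) j) i \<noteq> 0"
    proof cases
      case 1
      then show ?thesis using vertex_on_y_axis[OF min0] ends(1) H by (simp add: m_def n_def)
    next
      case 2
      then show ?thesis using vertex_on_x_axis[OF min0] ends(2) W by (simp add: m_def n_def)
    next
      case 3
      then have "0 \<notin> S NumX" "0 \<notin> S NumY" "Max (A0 S) \<notin> S NumX" "Max (A1 S) \<notin> S NumY"
        using non0 non1 min0 by (auto simp: two_def)
      from inner_vertices[OF min0 this] 3(2) show ?thesis
        by (auto simp: q_def m_def n_def u0_def u1_def v0_def v1_def min0 split: if_splits)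
    qed
  qed
  have corner: "shape (newton_polygon \<phi>)"
    if c: "c \<in> coef_space S" and M': "\<forall>(i, j)\<in>M'. coeff (coeff (curve_resultant m n c) j) i \<noteq> 0"
      and co: "coprime (slot_poly S c NumX) (slot_poly S c DenX)"
        "coprime (slot_poly S c NumY) (slot_poly S c DenY)"
      and deg: "has_param_degree (slot_poly S c NumX) (slot_poly S c DenX)
        (slot_poly S c NumY) (slot_poly S c DenY) 1"
      and \<phi>: "implicit_equation (slot_poly S c NumX) (slot_poly S c DenX)
        (slot_poly S c NumY) (slot_poly S c DenY) \<phi>" for c \<phi>
  proof -
    have "0 \<in> A0 S" "0 \<in> A1 S"
      using not_coprime_slot_polys[OF c] co by (auto simp: A0_def A1_def)
    then have min0: "Min (A0 S) = 0" "Min (A1 S) = 0"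
      using finite_rows Min_le by (metis le_zero_eq)+
    then have M: "\<forall>(i, j)\<in>M. coeff (coeff (curve_resultant m n c) j) i \<noteq> 0" using M' by (simp add: M'_def)
    then have "coeff (coeff (curve_resultant m n c) (U0 + U1)) 0 \<noteq> 0" by (auto simp: M_def)
    then have "curve_resultant m n c \<noteq> 0" by auto
    moreover have "0 < n" "0 < m" using lt by (simp_all add: m_def n_def)
    ultimately show ?thesis
      using implicit_equation_support[where S = S, OF fin ne c n_def _ m_def _ co deg \<phi>]
      by (intro shape[OF c min0 M]) blast
  qed
  show ?thesis
  proof (rule conjI[OF part1], rule generically_mono[OF generic], unfold Let_def, intro impI allI,
      elim conjE, goal_cases)
    case (1 c \<phi>)
    then have "shape (newton_polygon \<phi>)" by (intro corner)
    then show ?case unfolding shape_def a_def b_def two_def sel0 sel1 H W .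
  qed
qed

end
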